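(* Let $k$ be a field and let $\mathcal D$ be the cluster category of Dynkin type $A_\infty$ over $k$. Let $(\mathcal U,\mathcal V)$ be a t-structure in $\mathcal D$, that is, $(\mathcal U,\mathcal V)$ is a torsion theory with $\Sigma\,\mathcal U\subseteq\mathcal U$. Suppose that $\mathcal U$ is neither zero nor all of $\mathcal D$. Then there is a half line $\{(x,n)\mid x\le n-2\}$ in the Auslander-Reiten quiver of $\mathcal D$, for some integer $n$, such that the indecomposable objects of $\mathcal U$ are precisely (up to isomorphism) the objects on this half line and to the left of it, i.e. the indecomposable objects with coordinates in $\{(x,y)\mid y\le n,\ y-x\ge 2\}$.
   Context: The category $\mathcal D$: let $k[T]$ be the DG algebra over the field $k$ with $T$ in homological degree $1$ and zero differential; $\mathcal D = D^{f}(k[T])$ is the finite derived category, i.e. the full subcategory of the derived category of DG $k[T]$-modules consisting of those whose total homology is finite dimensional over $k$. It is $k$-linear, Hom-finite, Krull-Schmidt, triangulated with suspension $\Sigma$, and $2$-Calabi-Yau. (Equivalently, $\mathcal D$ is the algebraic triangulated category generated by a $2$-spherical object.) Write $(x,y)$ for the space of morphisms between objects $x\to y$ in $\mathcal D$. Coordinates: the Auslander-Reiten quiver of $\mathcal D$ is $\mathbb Z A_\infty$. Its vertices (isomorphism classes of indecomposable objects) are labelled by the pairs of integers $(m,n)$ with $n-m\ge 2$, with arrows $(m,n)\to(m,n+1)$, and $(m,n)\to(m+1,n)$ whenever $n-m\ge 3$, and with $\Sigma(m,n)=\tau(m,n)=(m-1,n-1)$, where $\tau$ is the AR translation; one such labelling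 is fixed. Subcategories: a subcategory of $\mathcal D$ always means a full subcategory closed under (finite) direct sums and direct summands (hence isomorphisms). Torsion theory: a pair $(\mathcal U,\mathcal V)$ of subcategories of $\mathcal D$ such that all morphism spaces $(u,v)$ with $u\in\mathcal U$, $v\in\mathcal V$ are zero, and such that each $d\in\mathcal D$ admits a distinguished triangle $u\to d\to v\to\Sigma u$ with $u\in\mathcal U$, $v\in\mathcal V$. *)

theory Defs
  imports "HOL-Computational_Algebra.Polynomial" "HOL-Library.Product_Plus"
begin

section \<open>DG modules over \<open>k[T]\<close>\<close>

text \<open>
  The DG algebra \<open>k[T]\<close> is \<^typ>\<open>'k poly\<close> with zero differential; \<open>T\<close> has homological degree 1,
  so the component of degree \<open>n\<close> is \<open>k T^n\<close>.
\<close>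

definition kT :: "nat \<Rightarrow> 'k::field poly set" where
  "kT n = range (\<lambda>c. monom c n)"

definition koszul :: "nat \<Rightarrow> 'v::ab_group_add \<Rightarrow> 'v" where
  "koszul n x = (if even n then x else - x)"

text \<open>
  A DG module \<open>M\<close> is a family of subsets \<open>gr M i\<close> (the components) of a type \<open>'v\<close>, a differential
  \<open>dif M i\<close> from \<open>gr M i\<close> to \<open>gr M (i - 1)\<close>, and for homogeneous \<open>p\<close> of degree \<open>n\<close> the
  multiplication \<open>act M p i\<close> from \<open>gr M i\<close> to \<open>gr M (i + n)\<close>. Values of maps outside the components
  (and of \<open>act M p\<close> for inhomogeneous \<open>p\<close>) carry no meaning.
\<close>

record (overloaded) ('k::field, 'v) dgmod =
  gr :: "int \<Rightarrow> 'v set"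
  dif :: "int \<Rightarrow> 'v \<Rightarrow> 'v"
  act :: "'k poly \<Rightarrow> int \<Rightarrow> 'v \<Rightarrow> 'v"

type_synonym ('v, 'w) gmap = "int \<Rightarrow> 'v \<Rightarrow> 'w"

definition additive_on :: "'v::ab_group_add set \<Rightarrow> ('v \<Rightarrow> 'w::ab_group_add) \<Rightarrow> bool" where
  "additive_on S f \<longleftrightarrow> (\<forall>x\<in>S. \<forall>y\<in>S. f (x + y) = f x + f y)"

definition gid :: "('v, 'v) gmap" where
  "gid = (\<lambda>i x. x)"

definition gcomp :: "('w, 'u) gmap \<Rightarrow> ('v, 'w) gmap \<Rightarrow> ('v, 'u) gmap"  (infixl "\<odot>" 70) where
  "g \<odot> f = (\<lambda>i x. g i (f i x))"

text \<open>\<open>k\<close>-linearity of chain maps and homotopies is the case \<open>n = 0\<close> of \<open>k[T]\<close>-linearity.\<close>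

definition chain_map ::
  "('k::field, 'v::ab_group_add) dgmod \<Rightarrow> ('k, 'w::ab_group_add) dgmod \<Rightarrow> ('v, 'w) gmap \<Rightarrow> bool" where
  "chain_map M N f \<longleftrightarrow> (\<forall>i. additive_on (gr M i) (f i) \<and>
     (\<forall>x\<in>gr M i. f i x \<in> gr N i \<and>
        f (i - 1) (dif M i x) = dif N i (f i x) \<and>
        (\<forall>n. \<forall>p\<in>kT n. f (i + int n) (act M p i x) = act N p i (f i x))))"

definition dg_iso ::
  "('k::field, 'v::ab_group_add) dgmod \<Rightarrow> ('k, 'w::ab_group_add) dgmod \<Rightarrow> ('v, 'w) gmap \<Rightarrow> bool" where
  "dg_iso M N f \<longleftrightarrow> chain_map M N f \<and> (\<forall>i. bij_betw (f i) (gr M i) (gr N i))"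

text \<open>A null homotopy is a \<open>k[T]\<close>-linear map of degree 1, whence the sign in \<open>s (p x) = (-1)^n p s(x)\<close>.\<close>

definition homotopic ::
  "('k::field, 'v::ab_group_add) dgmod \<Rightarrow> ('k, 'w::ab_group_add) dgmod
    \<Rightarrow> ('v, 'w) gmap \<Rightarrow> ('v, 'w) gmap \<Rightarrow> bool" where
  "homotopic M N f g \<longleftrightarrow> (\<exists>s. \<forall>i. additive_on (gr M i) (s i) \<and>
     (\<forall>x\<in>gr M i. s i x \<in> gr N (i + 1) \<and>
        (\<forall>n. \<forall>p\<in>kT n. s (i + int n) (act M p i x) = koszul n (act N p (i + 1) (s i x))) \<and>
        f i x - g i x = dif N (i + 1) (s i x) + s (i - 1) (dif M i x)))"

definition cycles :: "('k::field, 'v::ab_group_add) dgmod \<Rightarrow> int \<Rightarrow> 'v set" where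
  "cycles M i = {x \<in> gr M i. dif M i x = 0}"

definition boundaries :: "('k::field, 'v::ab_group_add) dgmod \<Rightarrow> int \<Rightarrow> 'v set" where
  "boundaries M i = dif M (i + 1) ` gr M (i + 1)"

text \<open>The two conjuncts on each degree: injectivity and surjectivity of the map induced on homology.\<close>

definition quasi_iso ::
  "('k::field, 'v::ab_group_add) dgmod \<Rightarrow> ('k, 'w::ab_group_add) dgmod \<Rightarrow> ('v, 'w) gmap \<Rightarrow> bool" where
  "quasi_iso M N f \<longleftrightarrow> chain_map M N f \<and>
     (\<forall>i. (\<forall>z\<in>cycles M i. f i z \<in> boundaries N i \<longrightarrow> z \<in> boundaries M i) \<and>
          (\<forall>w\<in>cycles N i. \<exists>z\<in>cycles M i. w - f i z \<in> boundaries N i))"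

definition Sus :: "('k::field, 'v::ab_group_add) dgmod \<Rightarrow> ('k, 'v) dgmod" where
  "Sus M = \<lparr> gr = (\<lambda>i. gr M (i - 1)),
             dif = (\<lambda>i x. - dif M (i - 1) x),
             act = (\<lambda>p i x. koszul (degree p) (act M p (i - 1) x)) \<rparr>"

definition sus_map :: "('v, 'w) gmap \<Rightarrow> ('v, 'w) gmap" where
  "sus_map f = (\<lambda>i. f (i - 1))"

text \<open>The mapping cone of \<open>f : A \<rightarrow> B\<close>, with underlying graded module \<open>B \<oplus> \<Sigma>A\<close>.\<close>

definition cone ::
  "('k::field, 'v::ab_group_add) dgmod \<Rightarrow> ('k, 'v) dgmod \<Rightarrow> ('v, 'v) gmap \<Rightarrow> ('k, 'v \<times> 'v) dgmod" where
  "cone A B f = \<lparr> gr = (\<lambda>i. gr B i \<times> gr A (i - 1)),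
     dif = (\<lambda>i (b, a). (dif B i b + f (i - 1) a, - dif A (i - 1) a)),
     act = (\<lambda>p i (b, a). (act B p i b, koszul (degree p) (act A p (i - 1) a))) \<rparr>"


section \<open>The derived category\<close>

text \<open>
  A morphism \<open>M \<rightarrow> N\<close> of the derived category is a class of roofs \<open>M \<leftarrow> P \<rightarrow> N\<close>, that is of triples
  \<open>(P, s, f)\<close> with \<open>s : P \<rightarrow> M\<close> a quasi-isomorphism and \<open>f : P \<rightarrow> N\<close> a chain map (localisation of
  the homotopy category at the quasi-isomorphisms by calculus of fractions).
\<close>

type_synonym ('k, 'v) roof = "('k, 'v) dgmod \<times> ('v, 'v) gmap \<times> ('v, 'v) gmap"
type_synonym ('k, 'v) dmor = "('k, 'v) roof set"

text \<open>
  HOL has no proper class of all modules. The components of the DG modules are taken to be subspaces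
  of an ambient \<open>k\<close>-vector space, which is arbitrary apart from being infinite-dimensional; up to
  isomorphism these are all vector spaces of at most its dimension. The infinite dimension makes
  direct sums, cones and semi-free resolutions available.
\<close>

locale dg_universe = vector_space scale
  for scale :: "'k::field \<Rightarrow> 'v::ab_group_add \<Rightarrow> 'v" +
  assumes infinite_dimensional: "\<not> (\<exists>B. finite B \<and> span B = UNIV)"
begin

definition dg_module :: "('k, 'v) dgmod \<Rightarrow> bool" where
  "dg_module M \<longleftrightarrow>
     (\<forall>i. subspace (gr M i) \<and> additive_on (gr M i) (dif M i) \<and>
        (\<forall>x\<in>gr M i. dif M i x \<in> gr M (i - 1) \<and> dif M (i - 1) (dif M i x) = 0)) \<and>
     (\<forall>i n. \<forall>p\<in>kT n. additive_on (gr M i) (act M p i) \<and>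
        (\<forall>x\<in>gr M i. act M p i x \<in> gr M (i + int n) \<and>
           dif M (i + int n) (act M p i x) = koszul n (act M p (i - 1) (dif M i x)) \<and>
           (\<forall>q\<in>kT n. act M (p + q) i x = act M p i x + act M q i x) \<and>
           (\<forall>m. \<forall>q\<in>kT m. act M (q * p) i x = act M q (i + int n) (act M p i x)))) \<and>
     (\<forall>i c. \<forall>x\<in>gr M i. act M [:c:] i x = scale c x)"

definition finite_homology :: "('k, 'v) dgmod \<Rightarrow> bool" where
  "finite_homology M \<longleftrightarrow> finite {i. cycles M i \<noteq> boundaries M i} \<and>
     (\<forall>i. \<exists>B. finite B \<and> cycles M i \<subseteq> span (B \<union> boundaries M i))"

definition Df :: "('k, 'v) dgmod set" where
  "Df = {M. dg_module M \<and> finite_homology M}"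

definition is_roof :: "('k, 'v) dgmod \<Rightarrow> ('k, 'v) dgmod \<Rightarrow> ('k, 'v) roof \<Rightarrow> bool" where
  "is_roof M N = (\<lambda>(P, s, f). dg_module P \<and> quasi_iso P M s \<and> chain_map P N f)"

definition roof_eq ::
  "('k, 'v) dgmod \<Rightarrow> ('k, 'v) dgmod \<Rightarrow> ('k, 'v) roof \<Rightarrow> ('k, 'v) roof \<Rightarrow> bool" where
  "roof_eq M N = (\<lambda>(P, s, f) (P', s', f').
     \<exists>Q a b. dg_module Q \<and> chain_map Q P a \<and> chain_map Q P' b \<and> quasi_iso Q M (s \<odot> a) \<and>
       homotopic Q M (s \<odot> a) (s' \<odot> b) \<and> homotopic Q N (f \<odot> a) (f' \<odot> b))"

definition roof_class ::
  "('k, 'v) dgmod \<Rightarrow> ('k, 'v) dgmod \<Rightarrow> ('k, 'v) roof \<Rightarrow> ('k, 'v) dmor" where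
  "roof_class M N r = {r'. is_roof M N r' \<and> roof_eq M N r r'}"

definition dHom :: "('k, 'v) dgmod \<Rightarrow> ('k, 'v) dgmod \<Rightarrow> ('k, 'v) dmor set" where
  "dHom M N = roof_class M N ` {r. is_roof M N r}"

definition dmap :: "('k, 'v) dgmod \<Rightarrow> ('k, 'v) dgmod \<Rightarrow> ('v, 'v) gmap \<Rightarrow> ('k, 'v) dmor" where
  "dmap M N f = roof_class M N (M, gid, f)"

definition did :: "('k, 'v) dgmod \<Rightarrow> ('k, 'v) dmor" where
  "did M = dmap M M gid"

definition dzero :: "('k, 'v) dgmod \<Rightarrow> ('k, 'v) dgmod \<Rightarrow> ('k, 'v) dmor" where
  "dzero M N = dmap M N (\<lambda>i x. 0)"

text \<open>
  \<open>dcomp L M N G F\<close> is the composite of \<open>F : L \<rightarrow> M\<close> and \<open>G : M \<rightarrow> N\<close>: roofs \<open>(P, s, f)\<close> and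
  \<open>(P', s', g)\<close> are composed by completing \<open>P \<rightarrow> M \<leftarrow> P'\<close> to a square commuting up to homotopy.
\<close>

definition dcomp ::
  "('k, 'v) dgmod \<Rightarrow> ('k, 'v) dgmod \<Rightarrow> ('k, 'v) dgmod \<Rightarrow> ('k, 'v) dmor \<Rightarrow> ('k, 'v) dmor
    \<Rightarrow> ('k, 'v) dmor" where
  "dcomp L M N G F = {r. \<exists>P s f P' s' g Q t h.
     (P, s, f) \<in> F \<and> (P', s', g) \<in> G \<and>
     dg_module Q \<and> quasi_iso Q P t \<and> chain_map Q P' h \<and> homotopic Q M (f \<odot> t) (s' \<odot> h) \<and>
     r \<in> roof_class L N (Q, s \<odot> t, g \<odot> h)}"

definition dadd ::
  "('k, 'v) dgmod \<Rightarrow> ('k, 'v) dgmod \<Rightarrow> ('k, 'v) dmor \<Rightarrow> ('k, 'v) dmor \<Rightarrow> ('k, 'v) dmor" where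
  "dadd M N F G = {r. \<exists>P s f g. (P, s, f) \<in> F \<and> (P, s, g) \<in> G \<and>
     r \<in> roof_class M N (P, s, \<lambda>i x. f i x + g i x)}"

definition dSus :: "('k, 'v) dgmod \<Rightarrow> ('k, 'v) dgmod \<Rightarrow> ('k, 'v) dmor \<Rightarrow> ('k, 'v) dmor" where
  "dSus M N F = {r. \<exists>P s f. (P, s, f) \<in> F \<and>
     r \<in> roof_class (Sus M) (Sus N) (Sus P, sus_map s, sus_map f)}"

definition d_iso :: "('k, 'v) dgmod \<Rightarrow> ('k, 'v) dgmod \<Rightarrow> ('k, 'v) dmor \<Rightarrow> bool" where
  "d_iso M N F \<longleftrightarrow> F \<in> dHom M N \<and>
     (\<exists>G\<in>dHom N M. dcomp M N M G F = did M \<and> dcomp N M N F G = did N)"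

definition isomorphic :: "('k, 'v) dgmod \<Rightarrow> ('k, 'v) dgmod \<Rightarrow> bool" where
  "isomorphic M N \<longleftrightarrow> (\<exists>F. d_iso M N F)"

definition zero_object :: "('k, 'v) dgmod \<Rightarrow> bool" where
  "zero_object M \<longleftrightarrow> did M = dzero M M"

definition direct_sum :: "('k, 'v) dgmod \<Rightarrow> ('k, 'v) dgmod \<Rightarrow> ('k, 'v) dgmod \<Rightarrow> bool" where
  "direct_sum A B S \<longleftrightarrow>
     (\<exists>i\<in>dHom A S. \<exists>j\<in>dHom B S. \<exists>p\<in>dHom S A. \<exists>q\<in>dHom S B.
        dcomp A S A p i = did A \<and> dcomp B S B q j = did B \<and>
        dcomp B S A p j = dzero B A \<and> dcomp A S B q i = dzero A B \<and>
        dadd S S (dcomp S A S i p) (dcomp S B S j q) = did S)"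

definition indecomposable :: "('k, 'v) dgmod \<Rightarrow> bool" where
  "indecomposable M \<longleftrightarrow> M \<in> Df \<and> \<not> zero_object M \<and>
     (\<forall>A\<in>Df. \<forall>B\<in>Df. direct_sum A B M \<longrightarrow> zero_object A \<or> zero_object B)"

text \<open>
  A triangle is distinguished if it is isomorphic to a standard one \<open>A \<rightarrow> B \<rightarrow> C \<rightarrow> \<Sigma>A\<close>, where \<open>C\<close>
  is a copy in the ambient space, via \<open>\<phi>\<close>, of the cone of a chain map \<open>A \<rightarrow> B\<close>.
\<close>

definition distinguished ::
  "('k, 'v) dgmod \<Rightarrow> ('k, 'v) dgmod \<Rightarrow> ('k, 'v) dgmod
    \<Rightarrow> ('k, 'v) dmor \<Rightarrow> ('k, 'v) dmor \<Rightarrow> ('k, 'v) dmor \<Rightarrow> bool" where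
  "distinguished X Y Z F G H \<longleftrightarrow>
     F \<in> dHom X Y \<and> G \<in> dHom Y Z \<and> H \<in> dHom Z (Sus X) \<and>
     (\<exists>A B C f \<phi> \<alpha> \<beta> \<gamma>.
        dg_module A \<and> dg_module B \<and> dg_module C \<and> chain_map A B f \<and>
        dg_iso C (cone A B f) \<phi> \<and>
        d_iso X A \<alpha> \<and> d_iso Y B \<beta> \<and> d_iso Z C \<gamma> \<and>
        dcomp X Y B \<beta> F = dcomp X A B (dmap A B f) \<alpha> \<and>
        dcomp Y Z C \<gamma> G
          = dcomp Y B C (dmap B C (\<lambda>i b. inv_into (gr C i) (\<phi> i) (b, 0))) \<beta> \<and>
        dcomp Z (Sus X) (Sus A) (dSus X A \<alpha>) H
          = dcomp Z C (Sus A) (dmap C (Sus A) (\<lambda>i c. snd (\<phi> i c))) \<gamma>)"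


section \<open>Auslander--Reiten theory of the finite derived category\<close>

definition split_mono :: "('k, 'v) dgmod \<Rightarrow> ('k, 'v) dgmod \<Rightarrow> ('k, 'v) dmor \<Rightarrow> bool" where
  "split_mono M N F \<longleftrightarrow> (\<exists>G\<in>dHom N M. dcomp M N M G F = did M)"

definition split_epi :: "('k, 'v) dgmod \<Rightarrow> ('k, 'v) dgmod \<Rightarrow> ('k, 'v) dmor \<Rightarrow> bool" where
  "split_epi M N F \<longleftrightarrow> (\<exists>G\<in>dHom N M. dcomp N M N F G = did N)"

definition irreducible_mor :: "('k, 'v) dgmod \<Rightarrow> ('k, 'v) dgmod \<Rightarrow> ('k, 'v) dmor \<Rightarrow> bool" where
  "irreducible_mor M N F \<longleftrightarrow>
     F \<in> dHom M N \<and> \<not> split_mono M N F \<and> \<not> split_epi M N F \<and>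
     (\<forall>L\<in>Df. \<forall>H\<in>dHom M L. \<forall>G\<in>dHom L N.
        dcomp M L N G H = F \<longrightarrow> split_mono M L H \<or> split_epi L N G)"

definition ar_triangle ::
  "('k, 'v) dgmod \<Rightarrow> ('k, 'v) dgmod \<Rightarrow> ('k, 'v) dgmod
    \<Rightarrow> ('k, 'v) dmor \<Rightarrow> ('k, 'v) dmor \<Rightarrow> ('k, 'v) dmor \<Rightarrow> bool" where
  "ar_triangle X Y Z F G H \<longleftrightarrow>
     Y \<in> Df \<and> indecomposable X \<and> indecomposable Z \<and> distinguished X Y Z F G H \<and>
     H \<noteq> dzero Z (Sus X) \<and>
     (\<forall>W\<in>Df. \<forall>E\<in>dHom W Z. \<not> split_epi W Z E \<longrightarrow> (\<exists>E'\<in>dHom W Y. dcomp W Y Z G E' = E))"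

text \<open>\<open>is_tau X Z\<close>: \<open>X\<close> is (up to isomorphism) the Auslander--Reiten translate of \<open>Z\<close>.\<close>

definition is_tau :: "('k, 'v) dgmod \<Rightarrow> ('k, 'v) dgmod \<Rightarrow> bool" where
  "is_tau X Z \<longleftrightarrow> (\<exists>Y F G H. ar_triangle X Y Z F G H)"

text \<open>
  \<open>X m n\<close>, for \<open>n - m \<ge> 2\<close>, represents the vertex \<open>(m, n)\<close> of the Auslander--Reiten quiver, which has
  an arrow between two vertices iff there is an irreducible morphism between the objects.
\<close>

definition ar_labelling :: "(int \<Rightarrow> int \<Rightarrow> ('k, 'v) dgmod) \<Rightarrow> bool" where
  "ar_labelling X \<longleftrightarrow>
     (\<forall>m n. n - m \<ge> 2 \<longrightarrow> indecomposable (X m n)) \<and>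
     (\<forall>M. indecomposable M \<longrightarrow> (\<exists>m n. n - m \<ge> 2 \<and> isomorphic M (X m n))) \<and>
     (\<forall>m n m' n'. n - m \<ge> 2 \<longrightarrow> n' - m' \<ge> 2 \<longrightarrow>
        isomorphic (X m n) (X m' n') \<longrightarrow> m = m' \<and> n = n') \<and>
     (\<forall>m n m' n'. n - m \<ge> 2 \<longrightarrow> n' - m' \<ge> 2 \<longrightarrow>
        ((\<exists>F. irreducible_mor (X m n) (X m' n') F) \<longleftrightarrow>
          (m' = m \<and> n' = n + 1) \<or> (n - m \<ge> 3 \<and> m' = m + 1 \<and> n' = n))) \<and>
     (\<forall>m n. n - m \<ge> 2 \<longrightarrow> isomorphic (Sus (X m n)) (X (m - 1) (n - 1))) \<and>
     (\<forall>m n. n - m \<ge> 2 \<longrightarrow> is_tau (X (m - 1) (n - 1)) (X m n))"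


section \<open>Torsion theories and t-structures\<close>

text \<open>The second conjunct is closure under the empty direct sum.\<close>

definition subcategory :: "('k, 'v) dgmod set \<Rightarrow> bool" where
  "subcategory U \<longleftrightarrow> U \<subseteq> Df \<and>
     (\<forall>M\<in>Df. zero_object M \<longrightarrow> M \<in> U) \<and>
     (\<forall>M\<in>U. \<forall>N\<in>Df. isomorphic M N \<longrightarrow> N \<in> U) \<and>
     (\<forall>A\<in>Df. \<forall>B\<in>Df. \<forall>S\<in>Df. direct_sum A B S \<longrightarrow> (S \<in> U \<longleftrightarrow> A \<in> U \<and> B \<in> U))"

definition torsion_theory :: "('k, 'v) dgmod set \<Rightarrow> ('k, 'v) dgmod set \<Rightarrow> bool" where
  "torsion_theory U V \<longleftrightarrow> subcategory U \<and> subcategory V \<and>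
     (\<forall>M\<in>U. \<forall>N\<in>V. dHom M N = {dzero M N}) \<and>
     (\<forall>D\<in>Df. \<exists>M\<in>U. \<exists>N\<in>V. \<exists>F G H. distinguished M D N F G H)"

definition t_structure :: "('k, 'v) dgmod set \<Rightarrow> ('k, 'v) dgmod set \<Rightarrow> bool" where
  "t_structure U V \<longleftrightarrow> torsion_theory U V \<and> Sus ` U \<subseteq> U"

end

end

theory Submission
  imports Defs
begin

text \<open>
  Every object of \<open>D\<close> is a finite direct sum of bars: \<open>bar a b\<close> has one homology class in each degree
  from \<open>a\<close> to \<open>b\<close>, and \<open>T\<close> links them. Bars have an explicit two-step free model, so morphisms out of
  them are given by the images of two generators.

  If \<open>(U, V)\<close> is a t-structure and \<open>M \<in> U\<close>, \<open>N \<in> V\<close> are nonzero, then the lowest homology of \<open>M\<close> lies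
  above the highest homology of \<open>N\<close>: otherwise some suspension of \<open>M\<close>, which is again in \<open>U\<close>, has a
  nonzero map to \<open>N\<close>. With the long exact sequence of the triangle of the torsion theory this shows that
  \<open>U\<close> consists of all objects with no homology below some fixed degree \<open>s\<close>.

  It remains to express the lowest degree of homology in the coordinates. An irreducible morphism out of
  \<open>bar a b\<close> either extends along \<open>bar a b \<rightarrow> bar (a - 1) b\<close>, and then its target is \<open>bar (a - 1) b\<close>, or it is
  a projection onto some \<open>bar a d\<close> with \<open>d < b\<close>. Compatibility with the suspension and injectivity of the
  labelling then force the vertex \<open>(m, n)\<close> to have lowest degree \<open>c - n\<close> for a constant \<open>c\<close>.
\<close>

text \<open>Two obstacles shape the proof. A morphism of the derived category is a set of roofs, so
  nothing can be computed with it directly. Since bars are K-projective, a morphism becomes a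
  homotopy class of chain maps on a resolution of its source (\<open>hclass\<close>), and questions
  about splitting are decided by its effect on homology (\<open>hgraph\<close>). The latter is a
  relation between cycles, because homology is never formed as a quotient type.

  The other obstacle is that the labelling is an arbitrary one with the required properties, so
  which bar sits at a vertex has to be recovered. The case distinction for an irreducible morphism
  out of \<open>bar a b\<close> is whether the image of the bottom class is divisible by
  \<open>T\<close>. It leaves open by how much a projection shortens the bar; the path from
  \<open>(m, n)\<close> through \<open>(m, n + 1)\<close> to \<open>(m + 1, n + 1)\<close> removes
  this freedom, as it leads to the inverse suspension. What remains is a choice between lengthening
  and shortening along a ray, and shortening cannot go on forever.\<close>

context dg_universe
begin

section \<open>Elementary properties of DG modules and chain maps\<close>

definition tpow :: "('k, 'v) dgmod \<Rightarrow> nat \<Rightarrow> int \<Rightarrow> 'v \<Rightarrow> 'v" where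
  "tpow M n i x = act M (monom 1 n) i x"

text \<open>\<open>koszul\<close> with an integer exponent: signs attached to degrees, which may be
  negative, can then be combined by adding exponents (\<open>sg_simps\<close>).\<close>

definition sg :: "int \<Rightarrow> 'v \<Rightarrow> 'v" where
  "sg i x = (if even i then x else - x)"

lemma monom_in_kT: "monom c n \<in> kT n"
  by (simp add: kT_def)

lemma const_in_kT: "[:c:] \<in> kT 0"
  by (metis monom_0 monom_in_kT)

context
  fixes M :: "('k, 'v) dgmod"
  assumes M: "dg_module M"
begin

lemma gr_subspace: "subspace (gr M i)"
  using M by (simp add: dg_module_def)

lemma gr_0 [simp]: "0 \<in> gr M i"
  using gr_subspace subspace_0 by blast

lemma gr_add: "x \<in> gr M i \<Longrightarrow> y \<in> gr M i \<Longrightarrow> x + y \<in> gr M i"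
  using gr_subspace subspace_add by blast

lemma gr_diff: "x \<in> gr M i \<Longrightarrow> y \<in> gr M i \<Longrightarrow> x - y \<in> gr M i"
  using gr_subspace subspace_diff by blast

lemma gr_neg: "x \<in> gr M i \<Longrightarrow> - x \<in> gr M i"
  using gr_subspace subspace_neg by blast

lemma gr_scale: "x \<in> gr M i \<Longrightarrow> scale c x \<in> gr M i"
  using gr_subspace subspace_scale by blast

lemma gr_sg: "x \<in> gr M i \<Longrightarrow> sg j x \<in> gr M i"
  by (simp add: sg_def gr_neg)

lemma gr_sum: "(\<And>j. j \<in> J \<Longrightarrow> f j \<in> gr M i) \<Longrightarrow> sum f J \<in> gr M i"
  using gr_subspace subspace_sum by blast

lemma dif_in: "x \<in> gr M i \<Longrightarrow> dif M i x \<in> gr M (i - 1)"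
  using M by (simp add: dg_module_def)

lemma dif_in': "x \<in> gr M (i + 1) \<Longrightarrow> dif M (i + 1) x \<in> gr M i"
  using dif_in[of x "i + 1"] by simp

lemma dif_dif: "x \<in> gr M i \<Longrightarrow> dif M (i - 1) (dif M i x) = 0"
  using M by (simp add: dg_module_def)

lemma dif_add: "x \<in> gr M i \<Longrightarrow> y \<in> gr M i \<Longrightarrow> dif M i (x + y) = dif M i x + dif M i y"
  using M by (simp add: dg_module_def additive_on_def)

lemma dif_0 [simp]: "dif M i 0 = 0"
  using dif_add[of 0 i 0] by simp

lemma dif_neg: "x \<in> gr M i \<Longrightarrow> dif M i (- x) = - dif M i x"
  using dif_add[of x i "- x"] by (simp add: gr_neg eq_neg_iff_add_eq_0 add.commute)

lemma dif_diff: "x \<in> gr M i \<Longrightarrow> y \<in> gr M i \<Longrightarrow> dif M i (x - y) = dif M i x - dif M i y"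
  using dif_add[of x i "- y"] by (simp add: gr_neg dif_neg)

lemma act_const: "x \<in> gr M i \<Longrightarrow> act M [:c:] i x = scale c x"
  using M by (simp add: dg_module_def)

lemma act_in: "x \<in> gr M i \<Longrightarrow> p \<in> kT n \<Longrightarrow> act M p i x \<in> gr M (i + int n)"
  using M by (simp add: dg_module_def)

lemma dif_act: "x \<in> gr M i \<Longrightarrow> p \<in> kT n \<Longrightarrow>
    dif M (i + int n) (act M p i x) = koszul n (act M p (i - 1) (dif M i x))"
  using M by (simp add: dg_module_def)

lemma act_add: "x \<in> gr M i \<Longrightarrow> y \<in> gr M i \<Longrightarrow> p \<in> kT n \<Longrightarrow>
    act M p i (x + y) = act M p i x + act M p i y"
  using M by (simp add: dg_module_def additive_on_def)

lemma act_mult: "x \<in> gr M i \<Longrightarrow> p \<in> kT n \<Longrightarrow> q \<in> kT m \<Longrightarrow>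
    act M (q * p) i x = act M q (i + int n) (act M p i x)"
  using M by (simp add: dg_module_def)

lemma act_0 [simp]: "p \<in> kT n \<Longrightarrow> act M p i 0 = 0"
  using act_add[of 0 i 0 p n] by simp

lemma act_neg: "x \<in> gr M i \<Longrightarrow> p \<in> kT n \<Longrightarrow> act M p i (- x) = - act M p i x"
  using act_add[of x i "- x" p n] by (simp add: gr_neg eq_neg_iff_add_eq_0 add.commute)

lemma act_diff: "x \<in> gr M i \<Longrightarrow> y \<in> gr M i \<Longrightarrow> p \<in> kT n \<Longrightarrow>
    act M p i (x - y) = act M p i x - act M p i y"
  using act_add[of x i "- y" p n] by (simp add: gr_neg act_neg)

lemma dif_scale: "x \<in> gr M i \<Longrightarrow> dif M i (scale c x) = scale c (dif M i x)"
  using dif_act[of x i "[:c:]" 0] const_in_kT[of c] by (simp add: act_const dif_in koszul_def)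

lemma dif_sg: "x \<in> gr M i \<Longrightarrow> dif M i (sg j x) = sg j (dif M i x)"
  by (simp add: sg_def dif_neg)

lemma dif_sum: "(\<And>j. j \<in> J \<Longrightarrow> f j \<in> gr M i) \<Longrightarrow> dif M i (sum f J) = (\<Sum>j\<in>J. dif M i (f j))"
  by (induction J rule: infinite_finite_induct) (auto simp: dif_add gr_sum)

lemma act_monom:
  assumes "x \<in> gr M i"
  shows "act M (monom c n) i x = scale c (tpow M n i x)"
proof -
  have "monom c n = [:c:] * monom 1 n"
    by (simp add: smult_monom)
  then show ?thesis
    using act_mult[OF assms monom_in_kT[of 1 n] const_in_kT[of c]] assms
    by (simp add: tpow_def act_const act_in monom_in_kT)
qed

lemma tpow_in: "x \<in> gr M i \<Longrightarrow> tpow M n i x \<in> gr M (i + int n)"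
  by (simp add: tpow_def act_in monom_in_kT)

lemma tpow_in': "x \<in> gr M i \<Longrightarrow> j = i + int n \<Longrightarrow> tpow M n i x \<in> gr M j"
  by (simp add: tpow_in)

lemma tpow_add: "x \<in> gr M i \<Longrightarrow> y \<in> gr M i \<Longrightarrow> tpow M n i (x + y) = tpow M n i x + tpow M n i y"
  unfolding tpow_def by (rule act_add[OF _ _ monom_in_kT])

lemma tpow_diff: "x \<in> gr M i \<Longrightarrow> y \<in> gr M i \<Longrightarrow> tpow M n i (x - y) = tpow M n i x - tpow M n i y"
  unfolding tpow_def by (rule act_diff[OF _ _ monom_in_kT])

lemma tpow_neg: "x \<in> gr M i \<Longrightarrow> tpow M n i (- x) = - tpow M n i x"
  unfolding tpow_def by (rule act_neg[OF _ monom_in_kT])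

lemma tpow_0 [simp]: "tpow M n i 0 = 0"
  unfolding tpow_def by (rule act_0[OF monom_in_kT])

lemma tpow_sg: "x \<in> gr M i \<Longrightarrow> tpow M n i (sg j x) = sg j (tpow M n i x)"
  by (simp add: sg_def tpow_neg)

lemma tpow_zero_exp: "x \<in> gr M i \<Longrightarrow> tpow M 0 i x = x"
  using act_const[of x i 1] by (simp add: tpow_def one_pCons)

lemma tpow_tpow: "x \<in> gr M i \<Longrightarrow> j = i + int n \<Longrightarrow> tpow M m j (tpow M n i x) = tpow M (m + n) i x"
  using act_mult[OF _ monom_in_kT[of 1 n] monom_in_kT[of 1 m], of x i] by (simp add: tpow_def mult_monom)

lemma tpow_scale:
  assumes "x \<in> gr M i"
  shows "tpow M n i (scale c x) = scale c (tpow M n i x)"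
proof -
  have "monom c n = monom 1 n * [:c:]"
    by (simp add: smult_monom)
  then have "act M (monom c n) i x = tpow M n i (scale c x)"
    using act_mult[OF assms const_in_kT[of c] monom_in_kT[of 1 n]] assms
    by (simp add: tpow_def act_const)
  then show ?thesis
    using act_monom[OF assms] by simp
qed

lemma tpow_sum: "(\<And>j. j \<in> J \<Longrightarrow> f j \<in> gr M i) \<Longrightarrow> tpow M n i (sum f J) = (\<Sum>j\<in>J. tpow M n i (f j))"
  by (induction J rule: infinite_finite_induct) (auto simp: tpow_add gr_sum)

lemma dif_tpow: "x \<in> gr M i \<Longrightarrow> j = i + int n \<Longrightarrow> dif M j (tpow M n i x) = sg (int n) (tpow M n (i - 1) (dif M i x))"
  using dif_act[OF _ monom_in_kT[of 1 n], of x i] by (simp add: tpow_def koszul_def sg_def)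

lemma cycle_gr: "z \<in> cycles M i \<Longrightarrow> z \<in> gr M i"
  by (simp add: cycles_def)

lemma cycle_dif: "z \<in> cycles M i \<Longrightarrow> dif M i z = 0"
  by (simp add: cycles_def)

lemma boundariesI: "p \<in> gr M (i + 1) \<Longrightarrow> z = dif M (i + 1) p \<Longrightarrow> z \<in> boundaries M i"
  by (auto simp: boundaries_def)

lemma boundariesE:
  assumes "z \<in> boundaries M i"
  obtains p where "p \<in> gr M (i + 1)" "z = dif M (i + 1) p"
  using assms by (auto simp: boundaries_def)

lemma cycles_subspace: "subspace (cycles M i)"
  by (rule subspaceI) (auto simp: cycles_def gr_add gr_scale dif_add dif_scale)

lemma boundaries_subspace: "subspace (boundaries M i)"
proof (rule subspaceI)
  show "0 \<in> boundaries M i"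
    by (rule boundariesI[of 0]) simp_all
  show "x + y \<in> boundaries M i" if "x \<in> boundaries M i" "y \<in> boundaries M i" for x y
    using that by (metis boundariesI boundariesE dif_add gr_add)
  show "scale c x \<in> boundaries M i" if "x \<in> boundaries M i" for c x
    using that by (metis boundariesI boundariesE dif_scale gr_scale)
qed

lemma boundary_cycle: "z \<in> boundaries M i \<Longrightarrow> z \<in> cycles M i"
  using dif_dif[of _ "i + 1"] dif_in' by (auto simp: cycles_def elim!: boundariesE)

lemma tpow_cycle: "z \<in> cycles M i \<Longrightarrow> j = i + int n \<Longrightarrow> tpow M n i z \<in> cycles M j"
  by (auto simp: cycles_def tpow_in dif_tpow sg_def)

lemma tpow_boundary:
  assumes "z \<in> boundaries M i" "j = i + int n"
  shows "tpow M n i z \<in> boundaries M j"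
proof -
  obtain p where p: "p \<in> gr M (i + 1)" "z = dif M (i + 1) p"
    using assms(1) by (rule boundariesE)
  have in': "tpow M n (i + 1) p \<in> gr M (j + 1)"
    using p assms(2) by (simp add: tpow_in')
  then have "dif M (j + 1) (sg (int n) (tpow M n (i + 1) p)) = tpow M n i z"
    using p assms(2) by (simp add: dif_sg dif_tpow) (simp add: sg_def)
  then show ?thesis
    using boundariesI[OF gr_sg[OF in']] by metis
qed

lemmas cycle_diff = subspace_diff[OF cycles_subspace]
  and cycle_scale = subspace_scale[OF cycles_subspace]
  and cycle_0 = subspace_0[OF cycles_subspace]
  and boundary_add = subspace_add[OF boundaries_subspace]
  and boundary_diff = subspace_diff[OF boundaries_subspace]
  and boundary_neg = subspace_neg[OF boundaries_subspace]
  and boundary_scale = subspace_scale[OF boundaries_subspace]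
  and boundary_0 = subspace_0[OF boundaries_subspace]
  and boundary_sum = subspace_sum[OF boundaries_subspace]

lemma boundary_sg: "x \<in> boundaries M i \<Longrightarrow> sg j x \<in> boundaries M i"
  by (simp add: sg_def boundary_neg)

lemma boundary_trans: "x - y \<in> boundaries M i \<Longrightarrow> y - z \<in> boundaries M i \<Longrightarrow> x - z \<in> boundaries M i"
  using boundary_add[of "x - y" i "y - z"] by simp

lemma boundary_sym: "x - y \<in> boundaries M i \<Longrightarrow> y - x \<in> boundaries M i"
  using boundary_neg[of "x - y" i] by simp

lemma boundary_cong: "x - y \<in> boundaries M i \<Longrightarrow> x \<in> boundaries M i \<longleftrightarrow> y \<in> boundaries M i"
  using boundary_add[of "x - y" i y] boundary_diff[of x i "x - y"] by auto

end

lemma chain_map_in: "chain_map M N f \<Longrightarrow> x \<in> gr M i \<Longrightarrow> f i x \<in> gr N i"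
  by (simp add: chain_map_def)

lemma chain_map_add: "chain_map M N f \<Longrightarrow> x \<in> gr M i \<Longrightarrow> y \<in> gr M i \<Longrightarrow> f i (x + y) = f i x + f i y"
  by (simp add: chain_map_def additive_on_def)

lemma chain_map_dif: "chain_map M N f \<Longrightarrow> x \<in> gr M i \<Longrightarrow> f (i - 1) (dif M i x) = dif N i (f i x)"
  by (simp add: chain_map_def)

lemma chain_map_dif': "chain_map M N f \<Longrightarrow> x \<in> gr M (i + 1) \<Longrightarrow> f i (dif M (i + 1) x) = dif N (i + 1) (f (i + 1) x)"
  using chain_map_dif[of M N f x "i + 1"] by simp

lemma chain_map_act: "chain_map M N f \<Longrightarrow> x \<in> gr M i \<Longrightarrow> p \<in> kT n \<Longrightarrow>
    f (i + int n) (act M p i x) = act N p i (f i x)"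
  by (simp add: chain_map_def)

lemma chain_map_tpow: "chain_map M N f \<Longrightarrow> x \<in> gr M i \<Longrightarrow> j = i + int n \<Longrightarrow>
    f j (tpow M n i x) = tpow N n i (f i x)"
  using chain_map_act[OF _ _ monom_in_kT[of 1 n], of M N f x i] by (simp add: tpow_def)

lemma chain_map_0: "dg_module M \<Longrightarrow> chain_map M N f \<Longrightarrow> f i 0 = 0"
  using chain_map_add[of M N f 0 i 0] by simp

lemma chain_map_neg: "dg_module M \<Longrightarrow> chain_map M N f \<Longrightarrow> x \<in> gr M i \<Longrightarrow> f i (- x) = - f i x"
  using chain_map_add[of M N f x i "- x"] by (simp add: gr_neg chain_map_0 eq_neg_iff_add_eq_0 add.commute)

lemma chain_map_diff: "dg_module M \<Longrightarrow> chain_map M N f \<Longrightarrow> x \<in> gr M i \<Longrightarrow> y \<in> gr M i \<Longrightarrow>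
    f i (x - y) = f i x - f i y"
  using chain_map_add[of M N f x i "- y"] by (simp add: gr_neg chain_map_neg)

lemma chain_map_sum: "dg_module M \<Longrightarrow> chain_map M N f \<Longrightarrow> (\<And>j. j \<in> J \<Longrightarrow> g j \<in> gr M i) \<Longrightarrow>
    f i (sum g J) = (\<Sum>j\<in>J. f i (g j))"
  by (induction J rule: infinite_finite_induct) (auto simp: chain_map_0 chain_map_add gr_sum)

lemma chain_map_scale: "dg_module M \<Longrightarrow> dg_module N \<Longrightarrow> chain_map M N f \<Longrightarrow> x \<in> gr M i \<Longrightarrow>
    f i (scale c x) = scale c (f i x)"
  using chain_map_act[of M N f x i "[:c:]" 0] const_in_kT[of c]
  by (simp add: act_const chain_map_in)

lemma chain_map_sg: "dg_module M \<Longrightarrow> chain_map M N f \<Longrightarrow> x \<in> gr M i \<Longrightarrow> f i (sg j x) = sg j (f i x)"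
  by (simp add: sg_def chain_map_neg)

lemma chain_map_cycle: "dg_module M \<Longrightarrow> chain_map M N f \<Longrightarrow> z \<in> cycles M i \<Longrightarrow> f i z \<in> cycles N i"
  using chain_map_dif[of M N f z i] by (auto simp: cycles_def chain_map_in chain_map_0)

lemma chain_map_boundary: "chain_map M N f \<Longrightarrow> z \<in> boundaries M i \<Longrightarrow> f i z \<in> boundaries N i"
  by (auto simp: boundaries_def chain_map_dif' chain_map_in)

lemma chain_map_gid: "chain_map M M gid"
  by (simp add: chain_map_def gid_def additive_on_def)

lemma chain_map_comp: "chain_map L M f \<Longrightarrow> chain_map M N g \<Longrightarrow> chain_map L N (g \<odot> f)"
  by (simp add: chain_map_def gcomp_def additive_on_def)

lemma chain_map_minus:
  assumes "dg_module N" "chain_map M N f" "chain_map M N g"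
  shows "chain_map M N (\<lambda>i x. f i x - g i x)"
  using assms unfolding chain_map_def additive_on_def
  by (auto simp: gr_diff dif_diff act_diff)

lemma chain_map_plus:
  assumes "dg_module N" "chain_map M N f" "chain_map M N g"
  shows "chain_map M N (\<lambda>i x. f i x + g i x)"
  using assms unfolding chain_map_def additive_on_def
  by (auto simp: gr_add dif_add act_add)

lemma chain_map_zero: "dg_module N \<Longrightarrow> chain_map M N (\<lambda>i x. 0)"
  by (auto simp: chain_map_def additive_on_def)

lemma gid_comp [simp]: "gid \<odot> f = f" "f \<odot> gid = f"
  by (simp_all add: gid_def gcomp_def)

lemma gcomp_assoc: "f \<odot> g \<odot> h = f \<odot> (g \<odot> h)"
  by (simp add: gcomp_def)

section \<open>Homotopies and quasi-isomorphisms\<close>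

lemma koszul_simps:
  "koszul n (x + y) = koszul n x + koszul n (y :: 'v)" "koszul n (- x) = - koszul n (x :: 'v)"
  "koszul n (0 :: 'v) = 0" "koszul n (x - y) = koszul n x - koszul n (y :: 'v)"
  by (simp_all add: koszul_def)

lemma homotopic_of_eq:
  assumes "dg_module N" "\<And>i x. x \<in> gr M i \<Longrightarrow> f i x = g i x"
  shows "homotopic M N f g"
  unfolding homotopic_def
  by (rule exI[of _ "\<lambda>i x. 0"]) (use assms in \<open>auto simp: additive_on_def koszul_simps\<close>)

lemma homotopic_refl: "dg_module N \<Longrightarrow> homotopic M N f f"
  by (simp add: homotopic_of_eq)

lemma homotopic_sym:
  assumes N: "dg_module N" and h: "homotopic M N f g"
  shows "homotopic M N g f"
proof -
  obtain s where s: "\<And>i. additive_on (gr M i) (s i)"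
    and s': "\<And>i x. x \<in> gr M i \<Longrightarrow> s i x \<in> gr N (i + 1) \<and>
        (\<forall>n. \<forall>p\<in>kT n. s (i + int n) (act M p i x) = koszul n (act N p (i + 1) (s i x))) \<and>
        f i x - g i x = dif N (i + 1) (s i x) + s (i - 1) (dif M i x)"
    using h unfolding homotopic_def by blast
  have "g i x - f i x = - dif N (i + 1) (s i x) - s (i - 1) (dif M i x)" if "x \<in> gr M i" for i x
    using s'[OF that] by (metis minus_add_distrib minus_diff_eq uminus_add_conv_diff add.commute)
  then show ?thesis
    unfolding homotopic_def
    by (intro exI[of _ "\<lambda>i x. - s i x"])
      (use s s' in \<open>auto simp: additive_on_def koszul_simps act_neg[OF N] gr_neg[OF N] dif_neg[OF N]\<close>)
qed

lemma homotopic_trans: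
  assumes N: "dg_module N" and h: "homotopic M N f g" "homotopic M N g h"
  shows "homotopic M N f h"
proof -
  obtain s where s: "\<And>i. additive_on (gr M i) (s i)"
    and s': "\<And>i x. x \<in> gr M i \<Longrightarrow> s i x \<in> gr N (i + 1) \<and>
        (\<forall>n. \<forall>p\<in>kT n. s (i + int n) (act M p i x) = koszul n (act N p (i + 1) (s i x))) \<and>
        f i x - g i x = dif N (i + 1) (s i x) + s (i - 1) (dif M i x)"
    using h(1) unfolding homotopic_def by blast
  obtain t where t: "\<And>i. additive_on (gr M i) (t i)"
    and t': "\<And>i x. x \<in> gr M i \<Longrightarrow> t i x \<in> gr N (i + 1) \<and>
        (\<forall>n. \<forall>p\<in>kT n. t (i + int n) (act M p i x) = koszul n (act N p (i + 1) (t i x))) \<and>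
        g i x - h i x = dif N (i + 1) (t i x) + t (i - 1) (dif M i x)"
    using h(2) unfolding homotopic_def by blast
  have "f i x - h i x = dif N (i + 1) (s i x) + dif N (i + 1) (t i x) + (s (i - 1) (dif M i x) + t (i - 1) (dif M i x))"
    if "x \<in> gr M i" for i x
  proof -
    have "f i x - h i x = (f i x - g i x) + (g i x - h i x)" by simp
    then show ?thesis using s'[OF that] t'[OF that] by (simp add: algebra_simps)
  qed
  then show ?thesis
    unfolding homotopic_def
    by (intro exI[of _ "\<lambda>i x. s i x + t i x"])
      (use s s' t t' in \<open>auto simp: additive_on_def koszul_simps act_add[OF N] gr_add[OF N] dif_add[OF N]\<close>)
qed

lemma homotopic_comp_left:
  assumes N: "dg_module N" and h: "homotopic M N f f'" and g: "chain_map N L g"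
    and f: "\<And>i x. x \<in> gr M i \<Longrightarrow> f i x \<in> gr N i" "\<And>i x. x \<in> gr M i \<Longrightarrow> f' i x \<in> gr N i"
    and M: "\<And>i x. x \<in> gr M i \<Longrightarrow> dif M i x \<in> gr M (i - 1)"
  shows "homotopic M L (g \<odot> f) (g \<odot> f')"
proof -
  obtain s where s: "\<And>i. additive_on (gr M i) (s i)"
    and s': "\<And>i x. x \<in> gr M i \<Longrightarrow> s i x \<in> gr N (i + 1) \<and>
        (\<forall>n. \<forall>p\<in>kT n. s (i + int n) (act M p i x) = koszul n (act N p (i + 1) (s i x))) \<and>
        f i x - f' i x = dif N (i + 1) (s i x) + s (i - 1) (dif M i x)"
    using h unfolding homotopic_def by blast
  have eq: "g i (f i x) - g i (f' i x) = dif L (i + 1) (g (i + 1) (s i x)) + g i (s (i - 1) (dif M i x))"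
    if "x \<in> gr M i" for i x
  proof -
    have "s (i - 1) (dif M i x) \<in> gr N i"
      using s'[OF M[OF that]] by simp
    then have "g i (f i x - f' i x) = dif L (i + 1) (g (i + 1) (s i x)) + g i (s (i - 1) (dif M i x))"
      using s'[OF that] by (simp add: chain_map_add[OF g] dif_in'[OF N] chain_map_dif'[OF g])
    then show ?thesis
      by (simp only: chain_map_diff[OF N g f[OF that]])
  qed
  have k: "g (i + int n + 1) (koszul n (act N p (i + 1) (s i x))) = koszul n (act L p (i + 1) (g (i + 1) (s i x)))"
    if "x \<in> gr M i" "p \<in> kT n" for i x n p
  proof -
    have "g (i + 1 + int n) (act N p (i + 1) (s i x)) = act L p (i + 1) (g (i + 1) (s i x))"
      using s'[OF that(1)] that(2) chain_map_act[OF g] by blast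
    moreover have "act N p (i + 1) (s i x) \<in> gr N (i + 1 + int n)"
      using s'[OF that(1)] that(2) by (simp add: act_in[OF N])
    ultimately show ?thesis
      by (simp add: koszul_def chain_map_neg[OF N g] algebra_simps)
  qed
  show ?thesis
    unfolding homotopic_def
    apply (intro exI[of _ "\<lambda>i x. g (i + 1) (s i x)"])
    using s s' eq k by (auto simp: additive_on_def gcomp_def chain_map_add[OF g] chain_map_in[OF g])
qed

lemma homotopic_comp_right:
  assumes h: "homotopic M N f f'" and g: "chain_map L M g"
  shows "homotopic L N (f \<odot> g) (f' \<odot> g)"
proof -
  obtain s where s: "\<And>i. additive_on (gr M i) (s i)"
    and s': "\<And>i x. x \<in> gr M i \<Longrightarrow> s i x \<in> gr N (i + 1) \<and>
        (\<forall>n. \<forall>p\<in>kT n. s (i + int n) (act M p i x) = koszul n (act N p (i + 1) (s i x))) \<and>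
        f i x - f' i x = dif N (i + 1) (s i x) + s (i - 1) (dif M i x)"
    using h unfolding homotopic_def by blast
  show ?thesis
    unfolding homotopic_def
    apply (intro exI[of _ "\<lambda>i x. s i (g i x)"])
    using s s' g by (auto simp: additive_on_def gcomp_def chain_map_add[OF g] chain_map_in[OF g]
        chain_map_dif[OF g] chain_map_act[OF g])
qed

lemma homotopic_plus:
  assumes N: "dg_module N" and h: "homotopic M N f f'" "homotopic M N g g'"
  shows "homotopic M N (\<lambda>i x. f i x + g i x) (\<lambda>i x. f' i x + g' i x)"
proof -
  obtain s where s: "\<And>i. additive_on (gr M i) (s i)"
    and s': "\<And>i x. x \<in> gr M i \<Longrightarrow> s i x \<in> gr N (i + 1) \<and>
        (\<forall>n. \<forall>p\<in>kT n. s (i + int n) (act M p i x) = koszul n (act N p (i + 1) (s i x))) \<and>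
        f i x - f' i x = dif N (i + 1) (s i x) + s (i - 1) (dif M i x)"
    using h(1) unfolding homotopic_def by blast
  obtain t where t: "\<And>i. additive_on (gr M i) (t i)"
    and t': "\<And>i x. x \<in> gr M i \<Longrightarrow> t i x \<in> gr N (i + 1) \<and>
        (\<forall>n. \<forall>p\<in>kT n. t (i + int n) (act M p i x) = koszul n (act N p (i + 1) (t i x))) \<and>
        g i x - g' i x = dif N (i + 1) (t i x) + t (i - 1) (dif M i x)"
    using h(2) unfolding homotopic_def by blast
  have "f i x + g i x - (f' i x + g' i x) = dif N (i + 1) (s i x) + dif N (i + 1) (t i x) + (s (i - 1) (dif M i x) + t (i - 1) (dif M i x))"
    if "x \<in> gr M i" for i x
  proof -
    have "f i x + g i x - (f' i x + g' i x) = (f i x - f' i x) + (g i x - g' i x)" by simp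
    then show ?thesis using s'[OF that] t'[OF that] by (simp add: algebra_simps)
  qed
  then show ?thesis
    unfolding homotopic_def
    by (intro exI[of _ "\<lambda>i x. s i x + t i x"])
      (use s s' t t' in \<open>auto simp: additive_on_def koszul_simps act_add[OF N] gr_add[OF N] dif_add[OF N]\<close>)
qed

lemma homotopic_cycle:
  assumes "homotopic M N f g" "dg_module M" "dg_module N" "z \<in> cycles M i"
  shows "f i z - g i z \<in> boundaries N i"
proof -
  obtain s where s: "\<And>i. additive_on (gr M i) (s i)"
    and s': "\<And>i x. x \<in> gr M i \<Longrightarrow> s i x \<in> gr N (i + 1) \<and>
        f i x - g i x = dif N (i + 1) (s i x) + s (i - 1) (dif M i x)"
    using assms(1) unfolding homotopic_def by blast
  have "s (i - 1) 0 = 0"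
    using s[of "i - 1"] assms(2) unfolding additive_on_def by (metis add_cancel_right_right gr_0)
  then show ?thesis
    using s'[of z i] assms(4) boundariesI[OF assms(3)] by (auto simp: cycles_def)
qed

lemma quasi_iso_chain: "quasi_iso M N f \<Longrightarrow> chain_map M N f"
  by (simp add: quasi_iso_def)

lemma quasi_iso_inj: "quasi_iso M N f \<Longrightarrow> z \<in> cycles M i \<Longrightarrow> f i z \<in> boundaries N i \<Longrightarrow> z \<in> boundaries M i"
  by (simp add: quasi_iso_def)

lemma quasi_iso_surj:
  assumes "quasi_iso M N f" "w \<in> cycles N i"
  obtains z where "z \<in> cycles M i" "w - f i z \<in> boundaries N i"
  using assms unfolding quasi_iso_def by meson

lemma quasi_iso_gid: "dg_module M \<Longrightarrow> quasi_iso M M gid"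
  by (auto simp: quasi_iso_def chain_map_gid) (auto simp: gid_def intro!: bexI boundary_0)

lemma quasi_iso_comp:
  assumes "dg_module L" "dg_module M" "dg_module N" "quasi_iso L M f" "quasi_iso M N g"
  shows "quasi_iso L N (g \<odot> f)"
  unfolding quasi_iso_def
proof (intro conjI allI ballI impI)
  show "chain_map L N (g \<odot> f)"
    using assms quasi_iso_chain chain_map_comp by blast
  fix i
  show "z \<in> boundaries L i" if "z \<in> cycles L i" "(g \<odot> f) i z \<in> boundaries N i" for z
    using that(2) quasi_iso_inj[OF assms(5) chain_map_cycle[OF assms(1) quasi_iso_chain[OF assms(4)] that(1)]]
      quasi_iso_inj[OF assms(4) that(1)] by (simp add: gcomp_def)
  fix w assume "w \<in> cycles N i"
  then obtain y where y: "y \<in> cycles M i" "w - g i y \<in> boundaries N i"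
    using assms quasi_iso_surj by blast
  then obtain x where x: "x \<in> cycles L i" "y - f i x \<in> boundaries M i"
    using assms quasi_iso_surj by blast
  have "g i y - g i (f i x) \<in> boundaries N i"
    using chain_map_boundary[OF quasi_iso_chain[OF assms(5)] x(2)] x(1) y(1)
      chain_map_cycle[OF assms(1) quasi_iso_chain[OF assms(4)] x(1)]
    by (simp add: chain_map_diff[OF assms(2) quasi_iso_chain[OF assms(5)]] cycle_gr[OF assms(2)])
  then show "\<exists>z\<in>cycles L i. w - (g \<odot> f) i z \<in> boundaries N i"
    using x(1) boundary_trans[OF assms(3) y(2)] unfolding gcomp_def by blast
qed

text \<open>Two out of three: on a cycle, homotopic maps differ by a boundary, so in homology
  \<open>h\<close> equals \<open>g\<close> after \<open>f\<close>, and \<open>g\<close> and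
  \<open>h\<close> are bijective there. Lifts through quasi-isomorphisms are shown to be
  quasi-isomorphisms this way.\<close>

lemma quasi_iso_cancel:
  assumes M: "dg_module L" "dg_module M" "dg_module N"
    and f: "chain_map L M f" and g: "quasi_iso M N g" and h: "quasi_iso L N h"
    and hom: "homotopic L N (g \<odot> f) h"
  shows "quasi_iso L M f"
  unfolding quasi_iso_def
proof (intro conjI allI ballI impI)
  show "chain_map L M f" by (rule f)
  fix i
  note g' = quasi_iso_chain[OF g]
  have hc: "g i (f i z) - h i z \<in> boundaries N i" if "z \<in> cycles L i" for z
    using homotopic_cycle[OF hom M(1,3) that] by (simp add: gcomp_def)
  show "z \<in> boundaries L i" if "z \<in> cycles L i" "f i z \<in> boundaries M i" for z
    using hc[OF that(1)] that chain_map_boundary[OF g' that(2)] boundary_cong[OF M(3)] quasi_iso_inj[OF h]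
    by blast
  fix w assume w: "w \<in> cycles M i"
  obtain x where x: "x \<in> cycles L i" "g i w - h i x \<in> boundaries N i"
    using quasi_iso_surj[OF h chain_map_cycle[OF M(2) g' w]] by blast
  then have "g i w - g i (f i x) \<in> boundaries N i"
    using boundary_trans[OF M(3)] boundary_sym[OF M(3)] hc by blast
  then have "g i (w - f i x) \<in> boundaries N i"
    using w x(1) chain_map_cycle[OF M(1) f x(1)] by (simp add: chain_map_diff[OF M(2) g'] cycle_gr[OF M(2)])
  then have "w - f i x \<in> boundaries M i"
    using quasi_iso_inj[OF g] cycle_diff[OF M(2) w chain_map_cycle[OF M(1) f x(1)]] by blast
  then show "\<exists>z\<in>cycles L i. w - f i z \<in> boundaries M i"
    using x by blast
qed

lemma quasi_iso_homotopic:
  assumes "dg_module M" "dg_module N" "quasi_iso M N f" "chain_map M N g" "homotopic M N g f"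
  shows "quasi_iso M N g"
  using quasi_iso_cancel[of M N N g gid f] quasi_iso_gid assms by simp

section \<open>Morphisms of the derived category via K-projective resolutions\<close>

text \<open>Existence and uniqueness of lifts: composing with a quasi-isomorphism is a bijection on
  homotopy classes of chain maps out of \<open>K\<close>. This is what makes homotopy classes on
  \<open>K\<close> the morphisms of the derived category.\<close>

definition kproj :: "('k, 'v) dgmod \<Rightarrow> bool" where
  "kproj K \<longleftrightarrow> dg_module K \<and>
     (\<forall>P N s f. dg_module P \<longrightarrow> dg_module N \<longrightarrow> quasi_iso P N s \<longrightarrow> chain_map K N f \<longrightarrow>
        (\<exists>g. chain_map K P g \<and> homotopic K N (s \<odot> g) f)) \<and>
     (\<forall>P N s g g'. dg_module P \<longrightarrow> dg_module N \<longrightarrow> quasi_iso P N s \<longrightarrow>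
        chain_map K P g \<longrightarrow> chain_map K P g' \<longrightarrow> homotopic K N (s \<odot> g) (s \<odot> g') \<longrightarrow>
        homotopic K P g g')"

definition resolution :: "('k, 'v) dgmod \<Rightarrow> ('v, 'v) gmap \<Rightarrow> ('k, 'v) dgmod \<Rightarrow> bool" where
  "resolution K k M \<longleftrightarrow> kproj K \<and> dg_module M \<and> quasi_iso K M k"

text \<open>The morphism \<open>M \<rightarrow> N\<close> represented by a chain map \<open>f : K \<rightarrow> N\<close> on a resolution \<open>k : K \<rightarrow> M\<close>.\<close>

definition hclass :: "('k, 'v) dgmod \<Rightarrow> ('v, 'v) gmap \<Rightarrow> ('k, 'v) dgmod \<Rightarrow> ('k, 'v) dgmod
    \<Rightarrow> ('v, 'v) gmap \<Rightarrow> ('k, 'v) dmor" where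
  "hclass K k M N f = {(P, s, g). is_roof M N (P, s, g) \<and>
     (\<exists>l. chain_map K P l \<and> homotopic K M (s \<odot> l) k \<and> homotopic K N (g \<odot> l) f)}"

lemma kproj_dg: "kproj K \<Longrightarrow> dg_module K"
  by (simp add: kproj_def)

lemma kproj_lift:
  assumes "kproj K" "dg_module P" "dg_module N" "quasi_iso P N s" "chain_map K N f"
  obtains g where "chain_map K P g" "homotopic K N (s \<odot> g) f"
  using assms unfolding kproj_def by blast

lemma kproj_unique:
  assumes "kproj K" "dg_module P" "dg_module N" "quasi_iso P N s" "chain_map K P g" "chain_map K P g'"
    "homotopic K N (s \<odot> g) (s \<odot> g')"
  shows "homotopic K P g g'"
  using assms unfolding kproj_def by blast

lemma resolutionD:
  assumes "resolution K k M"
  shows "kproj K" "dg_module K" "dg_module M" "quasi_iso K M k" "chain_map K M k"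
  using assms by (auto simp: resolution_def kproj_dg quasi_iso_chain)

lemma is_roofD:
  assumes "is_roof M N (P, s, f)"
  shows "dg_module P" "quasi_iso P M s" "chain_map P M s" "chain_map P N f"
  using assms by (auto simp: is_roof_def quasi_iso_chain)

lemma homotopic_comp_left':
  assumes "dg_module M" "dg_module N" "homotopic M N f f'" "chain_map N L g" "chain_map M N f" "chain_map M N f'"
  shows "homotopic M L (g \<odot> f) (g \<odot> f')"
  by (rule homotopic_comp_left[of N]) (use assms in \<open>auto intro: chain_map_in dif_in\<close>)

text \<open>A roof restricts along the lift \<open>l\<close> of \<open>k\<close> to a chain map on
  \<open>K\<close>. Equivalent roofs give homotopic restrictions, because any common refinement
  \<open>Q\<close> also receives a lift of \<open>k\<close>, and lifts are unique up to homotopy.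
  Conversely, \<open>K\<close> itself with \<open>l\<close> and \<open>l'\<close> is a common
  refinement.\<close>

lemma roof_class_eq:
  assumes res: "resolution K k M" and N: "dg_module N" and r: "is_roof M N (P, s, g)"
    and l: "chain_map K P l" "homotopic K M (s \<odot> l) k" "homotopic K N (g \<odot> l) f"
  shows "roof_class M N (P, s, g) = hclass K k M N f"
proof -
  note K = resolutionD[OF res] and P = is_roofD[OF r]
  have "roof_eq M N (P, s, g) (P', s', g') \<longleftrightarrow>
      (\<exists>l'. chain_map K P' l' \<and> homotopic K M (s' \<odot> l') k \<and> homotopic K N (g' \<odot> l') f)"
    (is "_ \<longleftrightarrow> ?R")
    if r': "is_roof M N (P', s', g')" for P' s' g'
  proof
    note P' = is_roofD[OF r']
    assume "roof_eq M N (P, s, g) (P', s', g')"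
    then obtain Q a b where Q: "dg_module Q" and a: "chain_map Q P a" and b: "chain_map Q P' b"
      and sa: "quasi_iso Q M (s \<odot> a)" and h: "homotopic Q M (s \<odot> a) (s' \<odot> b)"
      and h': "homotopic Q N (g \<odot> a) (g' \<odot> b)"
      unfolding roof_eq_def by auto
    obtain u where u: "chain_map K Q u" "homotopic K M (s \<odot> a \<odot> u) k"
      using kproj_lift[OF K(1) Q K(3) sa K(5)] by blast
    have "homotopic K M (s \<odot> (a \<odot> u)) (s \<odot> l)"
      using u(2) homotopic_sym[OF K(3) l(2)] homotopic_trans[OF K(3)] by (metis gcomp_assoc)
    then have au: "homotopic K P (a \<odot> u) l"
      using kproj_unique[OF K(1) P(1) K(3) P(2)] u a l(1) chain_map_comp by blast
    have "homotopic K M (s' \<odot> (b \<odot> u)) k"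
      using homotopic_comp_right[OF h u(1)] u(2) homotopic_trans[OF K(3)] homotopic_sym[OF K(3)]
      by (metis gcomp_assoc)
    moreover have "homotopic K N (g \<odot> (a \<odot> u)) f"
      using homotopic_comp_left'[OF K(2) P(1) au P(4)] u a l(1,3) chain_map_comp homotopic_trans[OF N] by blast
    then have "homotopic K N (g' \<odot> (b \<odot> u)) f"
      using homotopic_comp_right[OF h' u(1)] homotopic_trans[OF N] homotopic_sym[OF N]
      by (metis gcomp_assoc)
    moreover have "chain_map K P' (b \<odot> u)"
      using u(1) b chain_map_comp by blast
    ultimately show ?R by blast
  next
    note P' = is_roofD[OF r']
    assume ?R
    then obtain l' where l': "chain_map K P' l'" "homotopic K M (s' \<odot> l') k" "homotopic K N (g' \<odot> l') f"
      by blast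
    have "quasi_iso K M (s \<odot> l)"
      using quasi_iso_homotopic[OF K(2,3,4) chain_map_comp[OF l(1) P(3)] l(2)] .
    moreover have "homotopic K M (s \<odot> l) (s' \<odot> l')"
      using l(2) l'(2) homotopic_trans[OF K(3)] homotopic_sym[OF K(3)] by blast
    moreover have "homotopic K N (g \<odot> l) (g' \<odot> l')"
      using l(3) l'(3) homotopic_trans[OF N] homotopic_sym[OF N] by blast
    ultimately show "roof_eq M N (P, s, g) (P', s', g')"
      unfolding roof_eq_def using K(2) l(1) l'(1) by blast
  qed
  then show ?thesis
    unfolding roof_class_def hclass_def by auto
qed

lemma roof_lift:
  assumes "resolution K k M" "is_roof M N (P, s, g)"
  obtains l where "chain_map K P l" "homotopic K M (s \<odot> l) k"
  using kproj_lift resolutionD[OF assms(1)] is_roofD[OF assms(2)] by metis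

lemma is_roof_resolution: "resolution K k M \<Longrightarrow> chain_map K N f \<Longrightarrow> is_roof M N (K, k, f)"
  by (simp add: is_roof_def resolutionD)

lemma hclass_eq_roof_class:
  assumes "resolution K k M" "dg_module N" "chain_map K N f"
  shows "hclass K k M N f = roof_class M N (K, k, f)"
  by (rule roof_class_eq[OF assms(1,2) is_roof_resolution[OF assms(1,3)] chain_map_gid, symmetric])
    (simp_all add: homotopic_refl assms resolutionD[OF assms(1)])

lemma hclass_in_dHom:
  "resolution K k M \<Longrightarrow> dg_module N \<Longrightarrow> chain_map K N f \<Longrightarrow> hclass K k M N f \<in> dHom M N"
  by (auto simp: hclass_eq_roof_class dHom_def is_roof_resolution)

lemma dHomE:
  assumes "F \<in> dHom M N" "resolution K k M" "dg_module N"
  obtains f where "chain_map K N f" "F = hclass K k M N f"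
proof -
  obtain P s g where r: "is_roof M N (P, s, g)" and F: "F = roof_class M N (P, s, g)"
    using assms(1) by (auto simp: dHom_def)
  obtain l where l: "chain_map K P l" "homotopic K M (s \<odot> l) k"
    using roof_lift[OF assms(2) r] .
  show thesis
    using that[OF chain_map_comp[OF l(1) is_roofD(4)[OF r]]]
      roof_class_eq[OF assms(2,3) r l homotopic_refl[OF assms(3)]] F by blast
qed

lemma hclass_homotopic:
  assumes "homotopic K N f g" "dg_module N"
  shows "hclass K k M N f = hclass K k M N g"
  unfolding hclass_def using assms homotopic_trans[OF assms(2)] homotopic_sym[OF assms(2)] by blast

lemma dmap_eq_hclass:
  assumes "resolution K k M" "dg_module N" "chain_map M N f"
  shows "dmap M N f = hclass K k M N (f \<odot> k)"
proof -
  note K = resolutionD[OF assms(1)]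
  have "is_roof M N (M, gid, f)"
    using K assms(3) quasi_iso_gid by (simp add: is_roof_def)
  then show ?thesis
    unfolding dmap_def by (rule roof_class_eq[OF assms(1,2) _ K(5)]) (simp_all add: K assms homotopic_refl)
qed

lemma did_eq_hclass: "resolution K k M \<Longrightarrow> did M = hclass K k M M k"
  using dmap_eq_hclass[of K k M M gid] by (simp add: did_def resolutionD chain_map_gid)

lemma dzero_eq_hclass: "resolution K k M \<Longrightarrow> dg_module N \<Longrightarrow> dzero M N = hclass K k M N (\<lambda>i x. 0)"
  using dmap_eq_hclass[of K k M N "\<lambda>i x. 0"] by (simp add: dzero_def chain_map_zero gcomp_def)

lemma hclass_mem: "resolution K k M \<Longrightarrow> dg_module N \<Longrightarrow> chain_map K N f \<Longrightarrow> (K, k, f) \<in> hclass K k M N f"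
  unfolding hclass_def
  by (auto simp: is_roof_resolution resolutionD chain_map_gid homotopic_refl intro!: exI[of _ gid])

lemma dcompI:
  assumes "(P, s, f) \<in> F" "(P', s', g) \<in> G" "dg_module Q" "quasi_iso Q P t" "chain_map Q P' h"
    "homotopic Q M (f \<odot> t) (s' \<odot> h)" "r \<in> roof_class L N (Q, s \<odot> t, g \<odot> h)"
  shows "r \<in> dcomp L M N G F"
  unfolding dcomp_def using assms by blast

text \<open>\<open>dcomp\<close> collects all ways of completing the square, so two things are
  needed. Every completion \<open>Q\<close> gives the same class (\<open>main\<close>), since both
  ways of going from \<open>K\<close> to \<open>P'\<close> lift \<open>f\<close> through the
  quasi-isomorphism \<open>s'\<close>. And there is a completion at all, namely \<open>K\<close>
  with the identity and \<open>f'\<close>.\<close>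

lemma dcomp_hclass:
  assumes res: "resolution K k L" and res': "resolution K' k' M" and N: "dg_module N"
    and f: "chain_map K M f" and g: "chain_map K' N g"
    and f': "chain_map K K' f'" "homotopic K M (k' \<odot> f') f"
  shows "dcomp L M N (hclass K' k' M N g) (hclass K k L M f) = hclass K k L N (g \<odot> f')"
proof -
  note K = resolutionD[OF res] and K' = resolutionD[OF res']
  have main: "roof_class L N (Q, s \<odot> t, g1 \<odot> h) = hclass K k L N (g \<odot> f')"
    if PF: "(P, s, f1) \<in> hclass K k L M f" and PG: "(P', s', g1) \<in> hclass K' k' M N g"
      and Q: "dg_module Q" and t: "quasi_iso Q P t" and h: "chain_map Q P' h"
      and fth: "homotopic Q M (f1 \<odot> t) (s' \<odot> h)" for P s f1 P' s' g1 Q t h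
  proof -
    note t' = quasi_iso_chain[OF t]
    obtain l where r: "is_roof L M (P, s, f1)" and l: "chain_map K P l" "homotopic K L (s \<odot> l) k" "homotopic K M (f1 \<odot> l) f"
      using PF by (auto simp: hclass_def)
    obtain l' where r': "is_roof M N (P', s', g1)" and l': "chain_map K' P' l'" "homotopic K' M (s' \<odot> l') k'" "homotopic K' N (g1 \<odot> l') g"
      using PG by (auto simp: hclass_def)
    note P = is_roofD[OF r] and P' = is_roofD[OF r']
    have r'': "is_roof L N (Q, s \<odot> t, g1 \<odot> h)"
      using Q t h P P' quasi_iso_comp[OF Q P(1) K(3) t P(2)] chain_map_comp by (auto simp: is_roof_def)
    obtain u where u: "chain_map K Q u" "homotopic K L (s \<odot> t \<odot> u) k"
      using roof_lift[OF res r''] .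
    have tu: "homotopic K P (t \<odot> u) l"
    proof (rule kproj_unique[OF K(1) P(1) K(3) P(2) chain_map_comp[OF u(1) t'] l(1)])
      show "homotopic K L (s \<odot> (t \<odot> u)) (s \<odot> l)"
        using u(2) homotopic_sym[OF K(3) l(2)] homotopic_trans[OF K(3)] by (metis gcomp_assoc)
    qed
    have "homotopic K M (f1 \<odot> (t \<odot> u)) f"
      using homotopic_comp_left'[OF K(2) P(1) tu P(4) chain_map_comp[OF u(1) t'] l(1)] l(3)
        homotopic_trans[OF K'(3)] by blast
    then have shu: "homotopic K M (s' \<odot> (h \<odot> u)) f"
      using homotopic_comp_right[OF fth u(1)] homotopic_trans[OF K'(3)] homotopic_sym[OF K'(3)]
      by (metis gcomp_assoc)
    have "homotopic K M (s' \<odot> (l' \<odot> f')) f"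
      using homotopic_comp_right[OF l'(2) f'(1)] f'(2) homotopic_trans[OF K'(3)] by (metis gcomp_assoc)
    then have "homotopic K M (s' \<odot> (h \<odot> u)) (s' \<odot> (l' \<odot> f'))"
      using shu homotopic_trans[OF K'(3)] homotopic_sym[OF K'(3)] by blast
    then have hu: "homotopic K P' (h \<odot> u) (l' \<odot> f')"
      using kproj_unique[OF K(1) P'(1) K'(3) P'(2)] chain_map_comp[OF u(1) h] chain_map_comp[OF f'(1) l'(1)]
      by blast
    have "homotopic K N (g1 \<odot> (h \<odot> u)) (g1 \<odot> (l' \<odot> f'))"
      by (rule homotopic_comp_left'[OF K(2) P'(1) hu P'(4) chain_map_comp[OF u(1) h] chain_map_comp[OF f'(1) l'(1)]])
    moreover have "homotopic K N (g1 \<odot> (l' \<odot> f')) (g \<odot> f')"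
      using homotopic_comp_right[OF l'(3) f'(1)] by (simp add: gcomp_assoc)
    ultimately have "homotopic K N (g1 \<odot> h \<odot> u) (g \<odot> f')"
      using homotopic_trans[OF N] by (metis gcomp_assoc)
    then show ?thesis
      using roof_class_eq[OF res N r'' u] by blast
  qed
  have m: "(K, k, f) \<in> hclass K k L M f" "(K', k', g) \<in> hclass K' k' M N g"
    using hclass_mem[OF res K'(3) f] hclass_mem[OF res' N g] by auto
  have m': "roof_class L N (K, k \<odot> gid, g \<odot> f') = hclass K k L N (g \<odot> f')"
    by (rule main[OF m K(2) quasi_iso_gid[OF K(2)] f'(1)])
      (simp add: homotopic_sym[OF K'(3) f'(2)])
  have "r \<in> hclass K k L N (g \<odot> f')"
    if r: "r \<in> dcomp L M N (hclass K' k' M N g) (hclass K k L M f)" for r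
  proof -
    obtain P s f1 P' s' g1 Q t h where
     "(P, s, f1) \<in> hclass K k L M f" "(P', s', g1) \<in> hclass K' k' M N g" "dg_module Q"
     "quasi_iso Q P t" "chain_map Q P' h" "homotopic Q M (f1 \<odot> t) (s' \<odot> h)"
     "r \<in> roof_class L N (Q, s \<odot> t, g1 \<odot> h)"
      using r unfolding dcomp_def by blast
    then show ?thesis
      using main[of P s f1 P' s' g1 Q t h] by simp
  qed
  moreover have "r \<in> dcomp L M N (hclass K' k' M N g) (hclass K k L M f)"
    if "r \<in> hclass K k L N (g \<odot> f')" for r
    by (rule dcompI[OF m K(2) quasi_iso_gid[OF K(2)] f'(1)])
      (use homotopic_sym[OF K'(3) f'(2)] that m' in simp_all)
  ultimately show ?thesis
    by blast
qed

text \<open>\<open>dadd\<close> adds numerators over a common denominator \<open>s\<close>. The two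
  lifts of \<open>k\<close> through \<open>s\<close> found for the summands are homotopic, so one of
  them serves for both.\<close>

lemma dadd_hclass:
  assumes res: "resolution K k M" and N: "dg_module N"
    and f: "chain_map K N f" and g: "chain_map K N g"
  shows "dadd M N (hclass K k M N f) (hclass K k M N g) = hclass K k M N (\<lambda>i x. f i x + g i x)"
proof -
  note K = resolutionD[OF res]
  have main: "roof_class M N (P, s, \<lambda>i x. f1 i x + g1 i x) = hclass K k M N (\<lambda>i x. f i x + g i x)"
    if PF: "(P, s, f1) \<in> hclass K k M N f" and PG: "(P, s, g1) \<in> hclass K k M N g" for P s f1 g1
  proof -
    obtain l where r: "is_roof M N (P, s, f1)" and l: "chain_map K P l" "homotopic K M (s \<odot> l) k" "homotopic K N (f1 \<odot> l) f"
      using PF by (auto simp: hclass_def)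
    obtain l' where r': "is_roof M N (P, s, g1)" and l': "chain_map K P l'" "homotopic K M (s \<odot> l') k" "homotopic K N (g1 \<odot> l') g"
      using PG by (auto simp: hclass_def)
    note P = is_roofD[OF r] and P' = is_roofD[OF r']
    have "homotopic K P l l'"
      using kproj_unique[OF K(1) P(1) K(3) P(2) l(1) l'(1)] l(2) l'(2) homotopic_trans[OF K(3)] homotopic_sym[OF K(3)]
      by blast
    then have "homotopic K N (g1 \<odot> l) g"
      using homotopic_comp_left'[OF K(2) P(1) _ P'(4) l(1) l'(1)] l'(3) homotopic_trans[OF N] by blast
    then have "homotopic K N ((\<lambda>i x. f1 i x + g1 i x) \<odot> l) (\<lambda>i x. f i x + g i x)"
      using homotopic_plus[OF N l(3)] by (simp add: gcomp_def)
    moreover have "is_roof M N (P, s, \<lambda>i x. f1 i x + g1 i x)"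
      using P P' chain_map_plus[OF N] by (simp add: is_roof_def)
    ultimately show ?thesis
      using roof_class_eq[OF res N _ l(1,2)] by blast
  qed
  have m: "(K, k, f) \<in> hclass K k M N f" "(K, k, g) \<in> hclass K k M N g"
    using hclass_mem[OF res N] f g by auto
  show ?thesis
    using main main[OF m] m unfolding dadd_def by blast
qed

text \<open>Under the resolutions, the isomorphism and its inverse both correspond to the identity
  of the shared \<open>K\<close>.\<close>

lemma d_iso_of_resolutions:
  assumes "resolution K k M" "resolution K k' N"
  shows "d_iso M N (hclass K k M N k')"
proof -
  note M = resolutionD[OF assms(1)] and N = resolutionD[OF assms(2)]
  have "dcomp M N M (hclass K k' N M k) (hclass K k M N k') = did M"
    using dcomp_hclass[OF assms M(3) N(5) M(5) chain_map_gid]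
    by (simp add: homotopic_refl N did_eq_hclass[OF assms(1)])
  moreover have "dcomp N M N (hclass K k M N k') (hclass K k' N M k) = did N"
    using dcomp_hclass[OF assms(2,1) N(3) M(5) N(5) chain_map_gid]
    by (simp add: homotopic_refl M did_eq_hclass[OF assms(2)])
  ultimately show ?thesis
    unfolding d_iso_def using hclass_in_dHom assms M N by blast
qed

section \<open>The action of morphisms on homology\<close>

text \<open>The graph, on the level of cycles, of the map which a morphism induces on homology.\<close>

definition roof_graph :: "('k, 'v) dgmod \<Rightarrow> ('k, 'v) dgmod \<Rightarrow> ('k, 'v) roof \<Rightarrow> int \<Rightarrow> ('v \<times> 'v) set" where
  "roof_graph M N r i = (case r of (P, s, f) \<Rightarrow>
     {(x, y). x \<in> cycles M i \<and> y \<in> cycles N i \<and>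
        (\<exists>p\<in>cycles P i. x - s i p \<in> boundaries M i \<and> y - f i p \<in> boundaries N i)})"

definition hgraph :: "('k, 'v) dgmod \<Rightarrow> ('k, 'v) dgmod \<Rightarrow> ('k, 'v) dmor \<Rightarrow> int \<Rightarrow> ('v \<times> 'v) set" where
  "hgraph M N F i = (\<Union>r\<in>F. roof_graph M N r i)"

lemma roof_graph_mono:
  assumes MN: "dg_module M" "dg_module N" and r: "is_roof M N r" "is_roof M N r'" and e: "roof_eq M N r r'"
  shows "roof_graph M N r i \<subseteq> roof_graph M N r' i"
proof -
  obtain P s f where rr: "r = (P, s, f)" by (cases r)
  obtain P' s' f' where rr': "r' = (P', s', f')" by (cases r')
  note P = is_roofD[OF r(1)[unfolded rr]] and P' = is_roofD[OF r(2)[unfolded rr']]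
  obtain Q a b where Q: "dg_module Q" and a: "chain_map Q P a" and b: "chain_map Q P' b"
      and sa: "quasi_iso Q M (s \<odot> a)" and h: "homotopic Q M (s \<odot> a) (s' \<odot> b)"
      and h': "homotopic Q N (f \<odot> a) (f' \<odot> b)"
    using e rr rr' unfolding roof_eq_def by auto
  have "\<exists>p\<in>cycles P' i. x - s' i p \<in> boundaries M i \<and> y - f' i p \<in> boundaries N i"
    if x: "x \<in> cycles M i" and p: "p \<in> cycles P i" "x - s i p \<in> boundaries M i" "y - f i p \<in> boundaries N i" for x y p
  proof -
    obtain q where q: "q \<in> cycles Q i" "x - s i (a i q) \<in> boundaries M i"
      using quasi_iso_surj[OF sa x] by (auto simp: gcomp_def)
    have aq: "a i q \<in> cycles P i"
      using chain_map_cycle[OF Q a q(1)] .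
    have "s i (p - a i q) = (x - s i (a i q)) - (x - s i p)"
      using chain_map_diff[OF P(1,3)] p(1) aq cycle_gr[OF P(1)] by simp
    then have "s i (p - a i q) \<in> boundaries M i"
      using boundary_diff[OF MN(1) q(2) p(2)] by metis
    then have "p - a i q \<in> boundaries P i"
      using quasi_iso_inj[OF P(2) cycle_diff[OF P(1) p(1) aq]] by blast
    then have "f i p - f i (a i q) \<in> boundaries N i"
      using chain_map_boundary[OF P(4)] chain_map_diff[OF P(1,4)] p(1) aq cycle_gr[OF P(1)] by metis
    then have "y - f i (a i q) \<in> boundaries N i"
      using boundary_trans[OF MN(2) p(3)] by blast
    moreover have "f i (a i q) - f' i (b i q) \<in> boundaries N i"
      using homotopic_cycle[OF h' Q MN(2) q(1)] by (simp add: gcomp_def)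
    moreover have "s i (a i q) - s' i (b i q) \<in> boundaries M i"
      using homotopic_cycle[OF h Q MN(1) q(1)] by (simp add: gcomp_def)
    ultimately show ?thesis
      using boundary_trans[OF MN(1) q(2)] boundary_trans[OF MN(2)] chain_map_cycle[OF Q b q(1)] by blast
  qed
  then show ?thesis
    unfolding rr rr' roof_graph_def by auto
qed

lemma roof_eq_sym:
  assumes "dg_module M" "dg_module N" "is_roof M N r" "is_roof M N r'" "roof_eq M N r r'"
  shows "roof_eq M N r' r"
proof -
  obtain P s f P' s' f' where rr: "r = (P, s, f)" "r' = (P', s', f')" by (cases r, cases r')
  note P' = is_roofD[OF assms(4)[unfolded rr]]
  obtain Q a b where Q: "dg_module Q" and a: "chain_map Q P a" and b: "chain_map Q P' b"
      and sa: "quasi_iso Q M (s \<odot> a)" and h: "homotopic Q M (s \<odot> a) (s' \<odot> b)"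
      and h': "homotopic Q N (f \<odot> a) (f' \<odot> b)"
    using assms(5) rr unfolding roof_eq_def by auto
  have "quasi_iso Q M (s' \<odot> b)"
    using quasi_iso_homotopic[OF Q assms(1) sa chain_map_comp[OF b P'(3)] homotopic_sym[OF assms(1) h]] .
  then show ?thesis
    unfolding rr roof_eq_def
    using Q a b homotopic_sym[OF assms(1) h] homotopic_sym[OF assms(2) h'] by blast
qed

lemma dHom_is_roof: "F \<in> dHom M N \<Longrightarrow> r \<in> F \<Longrightarrow> is_roof M N r"
  by (auto simp: dHom_def roof_class_def)

text \<open>All roofs of one morphism have the same graph, so the union in \<open>hgraph\<close> is
  over equal sets and further properties can be checked on a single roof.\<close>

lemma hgraph_eq_roof_graph:
  assumes MN: "dg_module M" "dg_module N" and F: "F \<in> dHom M N" "r \<in> F"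
  shows "hgraph M N F i = roof_graph M N r i"
proof -
  obtain r0 where r0: "is_roof M N r0" "F = roof_class M N r0"
    using F by (auto simp: dHom_def)
  have "roof_graph M N r' i = roof_graph M N r0 i" if "r' \<in> F" for r'
  proof -
    have r': "is_roof M N r'" "roof_eq M N r0 r'"
      using that r0 by (simp_all add: roof_class_def)
    show ?thesis
      using roof_graph_mono[OF MN r0(1) r'] roof_graph_mono[OF MN r'(1) r0(1)] roof_eq_sym[OF MN r0(1) r'] by blast
  qed
  then show ?thesis
    unfolding hgraph_def using F(2) by auto
qed

lemma roof_graph_functional:
  assumes MN: "dg_module M" "dg_module N" and r: "is_roof M N r"
    and g: "(x, y) \<in> roof_graph M N r i" "(x', y') \<in> roof_graph M N r i" "x - x' \<in> boundaries M i"
  shows "y - y' \<in> boundaries N i"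
proof -
  obtain P s f where rr: "r = (P, s, f)" by (cases r)
  note P = is_roofD[OF r[unfolded rr]]
  obtain p where p: "p \<in> cycles P i" "x - s i p \<in> boundaries M i" "y - f i p \<in> boundaries N i"
    using g(1) by (auto simp: rr roof_graph_def)
  obtain p' where p': "p' \<in> cycles P i" "x' - s i p' \<in> boundaries M i" "y' - f i p' \<in> boundaries N i"
    using g(2) by (auto simp: rr roof_graph_def)
  have "s i p - s i p' \<in> boundaries M i"
    using boundary_trans[OF MN(1)] boundary_sym[OF MN(1)] p p' g(3) by meson
  then have "p - p' \<in> boundaries P i"
    using quasi_iso_inj[OF P(2) cycle_diff[OF P(1) p(1) p'(1)]] p(1) p'(1)
    by (simp add: chain_map_diff[OF P(1,3)] cycle_gr[OF P(1)])
  then have "f i p - f i p' \<in> boundaries N i"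
    using chain_map_boundary[OF P(4), of "p - p'" i] p(1) p'(1)
    by (simp add: chain_map_diff[OF P(1,4)] cycle_gr[OF P(1)])
  then show ?thesis
    using boundary_trans[OF MN(2)] boundary_sym[OF MN(2)] p p' by meson
qed

lemma dHom_nonempty:
  assumes "dg_module M" "dg_module N" "F \<in> dHom M N"
  obtains r where "r \<in> F" "is_roof M N r"
proof -
  obtain P s f where r: "is_roof M N (P, s, f)" "F = roof_class M N (P, s, f)"
    using assms by (auto simp: dHom_def)
  have "roof_eq M N (P, s, f) (P, s, f)"
    unfolding roof_eq_def using r(1) assms(1,2)
    by (auto simp: is_roof_def homotopic_refl chain_map_gid intro!: exI[of _ P] exI[of _ gid])
  then show thesis
    using that r by (simp add: roof_class_def)
qed

context
  fixes M N :: "('k, 'v) dgmod" and F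
  assumes MN: "dg_module M" "dg_module N" and F: "F \<in> dHom M N"
begin

lemma hgraph_cycles: "(x, y) \<in> hgraph M N F i \<Longrightarrow> x \<in> cycles M i \<and> y \<in> cycles N i"
  by (auto simp: hgraph_def roof_graph_def)

lemma hgraph_functional:
  "(x, y) \<in> hgraph M N F i \<Longrightarrow> (x', y') \<in> hgraph M N F i \<Longrightarrow> x - x' \<in> boundaries M i \<Longrightarrow> y - y' \<in> boundaries N i"
  using roof_graph_functional[OF MN] dHom_nonempty[OF MN F] hgraph_eq_roof_graph[OF MN F] by metis

lemma hgraph_total:
  assumes "x \<in> cycles M i"
  obtains y where "(x, y) \<in> hgraph M N F i"
proof -
  obtain P s f where r: "(P, s, f) \<in> F" "is_roof M N (P, s, f)"
    using dHom_nonempty[OF MN F] by (metis prod_cases3)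
  note P = is_roofD[OF r(2)]
  obtain p where p: "p \<in> cycles P i" "x - s i p \<in> boundaries M i"
    using quasi_iso_surj[OF P(2) assms] .
  have "(x, f i p) \<in> roof_graph M N (P, s, f) i"
    using p assms chain_map_cycle[OF P(1,4) p(1)] boundary_0[OF MN(2)] by (auto simp: roof_graph_def)
  then show thesis
    using that hgraph_eq_roof_graph[OF MN F r(1)] by blast
qed

lemma hgraph_tpow:
  assumes "(x, y) \<in> hgraph M N F i" "j = i + int n"
  shows "(tpow M n i x, tpow N n i y) \<in> hgraph M N F j"
proof -
  obtain P s f where r: "(P, s, f) \<in> F" "(x, y) \<in> roof_graph M N (P, s, f) i"
    using assms(1) by (force simp: hgraph_def)
  note P = is_roofD[OF dHom_is_roof[OF F r(1)]]
  obtain p where p: "p \<in> cycles P i" "x - s i p \<in> boundaries M i" "y - f i p \<in> boundaries N i"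
    and xy: "x \<in> cycles M i" "y \<in> cycles N i"
    using r(2) by (auto simp: roof_graph_def)
  note gr = cycle_gr[OF MN(1)] cycle_gr[OF MN(2)] cycle_gr[OF P(1)]
  have "tpow M n i x - s j (tpow P n i p) \<in> boundaries M j"
    using tpow_boundary[OF MN(1) p(2) assms(2)] xy p(1) chain_map_cycle[OF P(1,3) p(1)]
    by (simp add: tpow_diff[OF MN(1)] gr chain_map_tpow[OF P(3) _ assms(2)])
  moreover have "tpow N n i y - f j (tpow P n i p) \<in> boundaries N j"
    using tpow_boundary[OF MN(2) p(3) assms(2)] xy p(1) chain_map_cycle[OF P(1,4) p(1)]
    by (simp add: tpow_diff[OF MN(2)] gr chain_map_tpow[OF P(4) _ assms(2)])
  ultimately have "(tpow M n i x, tpow N n i y) \<in> roof_graph M N (P, s, f) j"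
    using tpow_cycle[OF MN(1) xy(1) assms(2)] tpow_cycle[OF MN(2) xy(2) assms(2)] tpow_cycle[OF P(1) p(1) assms(2)]
    by (auto simp: roof_graph_def)
  then show ?thesis
    using r(1) by (auto simp: hgraph_def)
qed

lemma hgraph_0: "(0, 0) \<in> hgraph M N F i"
proof -
  obtain P s f where r: "(P, s, f) \<in> F" "is_roof M N (P, s, f)"
    using dHom_nonempty[OF MN F] by (metis prod_cases3)
  note P = is_roofD[OF r(2)]
  have "(0, 0) \<in> roof_graph M N (P, s, f) i"
    using cycle_0[OF MN(1)] cycle_0[OF MN(2)] cycle_0[OF P(1)] boundary_0[OF MN(1)] boundary_0[OF MN(2)]
    by (auto simp: roof_graph_def chain_map_0[OF P(1,3)] chain_map_0[OF P(1,4)] intro!: bexI[of _ 0])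
  then show ?thesis
    using r(1) by (auto simp: hgraph_def)
qed

end

lemma roof_graph_comp:
  assumes "dg_module L" "dg_module M" "dg_module N"
    and r: "is_roof L M (P, s, f)" "is_roof M N (P', s', g)"
    and Q: "dg_module Q" "quasi_iso Q P t" "chain_map Q P' h" "homotopic Q M (f \<odot> t) (s' \<odot> h)"
    and xy: "(x, y) \<in> roof_graph L M (P, s, f) i" and yz: "(y, z) \<in> roof_graph M N (P', s', g) i"
  shows "(x, z) \<in> roof_graph L N (Q, s \<odot> t, g \<odot> h) i"
proof -
  note P = is_roofD[OF r(1)] and P' = is_roofD[OF r(2)]
  note t' = quasi_iso_chain[OF Q(2)]
  have x: "x \<in> cycles L i" "z \<in> cycles N i" "y \<in> cycles M i"
    using xy yz by (auto simp: roof_graph_def)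
  obtain q where q: "q \<in> cycles Q i" "x - (s \<odot> t) i q \<in> boundaries L i"
    using quasi_iso_surj[OF quasi_iso_comp[OF Q(1) P(1) assms(1) Q(2) P(2)] x(1)] .
  have tq: "t i q \<in> cycles P i"
    using chain_map_cycle[OF Q(1) t' q(1)] .
  have hq: "h i q \<in> cycles P' i"
    using chain_map_cycle[OF Q(1) Q(3) q(1)] .
  have "(x, f i (t i q)) \<in> roof_graph L M (P, s, f) i"
    using x q(2) tq chain_map_cycle[OF P(1,4) tq] boundary_0[OF assms(2)] by (auto simp: roof_graph_def gcomp_def)
  then have "y - f i (t i q) \<in> boundaries M i"
    using roof_graph_functional[OF assms(1,2) r(1) xy] boundary_0[OF assms(1)] by simp
  moreover have "f i (t i q) - s' i (h i q) \<in> boundaries M i"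
    using homotopic_cycle[OF Q(4) Q(1) assms(2) q(1)] by (simp add: gcomp_def)
  ultimately have "y - s' i (h i q) \<in> boundaries M i"
    using boundary_trans[OF assms(2)] by blast
  moreover have "(y, g i (h i q)) \<in> roof_graph M N (P', s', g) i"
    using x calculation hq chain_map_cycle[OF P'(1,4) hq] boundary_0[OF assms(3)] by (auto simp: roof_graph_def)
  then have "z - g i (h i q) \<in> boundaries N i"
    using roof_graph_functional[OF assms(2,3) r(2) yz] boundary_0[OF assms(2)] by simp
  ultimately show ?thesis
    using q x by (auto simp: roof_graph_def gcomp_def)
qed

text \<open>Requiring the composite to be an element \<open>E\<close> of \<open>dHom\<close>
  guarantees that the set \<open>dcomp\<close> has a member, from which a completed square is read
  off.\<close>

lemma hgraph_dcomp:
  assumes L: "dg_module L" and M: "dg_module M" and N: "dg_module N"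
    and F: "F \<in> dHom L M" and G: "G \<in> dHom M N" and E: "E \<in> dHom L N" "dcomp L M N G F = E"
    and xy: "(x, y) \<in> hgraph L M F i" and yz: "(y, z) \<in> hgraph M N G i"
  shows "(x, z) \<in> hgraph L N E i"
proof -
  obtain r where "r \<in> E" "is_roof L N r"
    using dHom_nonempty[OF L N E(1)] by blast
  then obtain P s f P' s' g Q t h where
     w: "(P, s, f) \<in> F" "(P', s', g) \<in> G" "dg_module Q"
     "quasi_iso Q P t" "chain_map Q P' h" "homotopic Q M (f \<odot> t) (s' \<odot> h)"
     and r: "r \<in> roof_class L N (Q, s \<odot> t, g \<odot> h)"
    using E(2) unfolding dcomp_def by blast
  note rF = dHom_is_roof[OF F w(1)] and rG = dHom_is_roof[OF G w(2)]
  have rE: "is_roof L N (Q, s \<odot> t, g \<odot> h)"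
    using w(3) quasi_iso_comp[OF w(3) is_roofD(1)[OF rF] L w(4) is_roofD(2)[OF rF]]
      chain_map_comp[OF w(5) is_roofD(4)[OF rG]] by (simp add: is_roof_def)
  have "(x, z) \<in> roof_graph L N (Q, s \<odot> t, g \<odot> h) i"
    using roof_graph_comp[OF L M N rF rG w(3-6)] xy yz
      hgraph_eq_roof_graph[OF L M F w(1)] hgraph_eq_roof_graph[OF M N G w(2)] by blast
  then have "(x, z) \<in> roof_graph L N r i"
    using roof_graph_mono[OF L N rE, of r] r by (simp add: roof_class_def subset_iff)
  then show ?thesis
    using \<open>r \<in> E\<close> by (auto simp: hgraph_def)
qed

lemma dmap_in_dHom:
  assumes "dg_module M" "chain_map M N f"
  shows "dmap M N f \<in> dHom M N"
  using assms by (auto simp: dmap_def dHom_def is_roof_def quasi_iso_gid)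

lemma hgraph_dmap:
  assumes MN: "dg_module M" "dg_module N" and f: "chain_map M N f"
  shows "(x, y) \<in> hgraph M N (dmap M N f) i \<longleftrightarrow> x \<in> cycles M i \<and> y \<in> cycles N i \<and> y - f i x \<in> boundaries N i"
proof -
  have r: "is_roof M N (M, gid, f)"
    using assms by (simp add: is_roof_def quasi_iso_gid)
  have "roof_eq M N (M, gid, f) (M, gid, f)"
    unfolding roof_eq_def using assms quasi_iso_gid[OF MN(1)]
    by (auto simp: homotopic_refl chain_map_gid intro!: exI[of _ M] exI[of _ gid])
  then have "(M, gid, f) \<in> dmap M N f"
    using r by (simp add: dmap_def roof_class_def)
  then have *: "hgraph M N (dmap M N f) i = roof_graph M N (M, gid, f) i"
    using hgraph_eq_roof_graph[OF MN dmap_in_dHom] assms by blast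
  have "y - f i x \<in> boundaries N i"
    if "x \<in> cycles M i" "p \<in> cycles M i" "x - p \<in> boundaries M i" "y - f i p \<in> boundaries N i" for p
  proof -
    have "f i p - f i x \<in> boundaries N i"
      using chain_map_boundary[OF f boundary_sym[OF MN(1) that(3)]] chain_map_diff[OF MN(1) f] that(1,2) cycle_gr[OF MN(1)]
      by metis
    then show ?thesis
      using boundary_trans[OF MN(2) that(4)] by blast
  qed
  then show ?thesis
    unfolding * using boundary_0[OF MN(1)] by (force simp: roof_graph_def gid_def)
qed

lemma did_in_dHom: "dg_module M \<Longrightarrow> did M \<in> dHom M M"
  by (simp add: did_def dmap_in_dHom chain_map_gid)

lemma hgraph_did: "dg_module M \<Longrightarrow>
    (x, y) \<in> hgraph M M (did M) i \<longleftrightarrow> x \<in> cycles M i \<and> y \<in> cycles M i \<and> y - x \<in> boundaries M i"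
  using hgraph_dmap[OF _ _ chain_map_gid, of M x y i] by (simp add: did_def gid_def)

lemma hgraph_hclass:
  assumes "resolution K k M" "dg_module N" "chain_map K N f" "x \<in> cycles K i"
  shows "(k i x, f i x) \<in> hgraph M N (hclass K k M N f) i"
proof -
  note K = resolutionD[OF assms(1)]
  have "(k i x, f i x) \<in> roof_graph M N (K, k, f) i"
    using chain_map_cycle[OF K(2,5) assms(4)] chain_map_cycle[OF K(2) assms(3,4)] boundary_0[OF K(3)]
      boundary_0[OF assms(2)] assms(4) by (auto simp: roof_graph_def intro!: bexI[of _ x])
  then show ?thesis
    using hclass_mem[OF assms(1-3)] by (auto simp: hgraph_def)
qed

text \<open>An isomorphism is bijective on homology, which forces the numerator of any of its roofs
  to be a quasi-isomorphism. Isomorphic objects are thus linked by quasi-isomorphisms.\<close>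

lemma d_iso_roof:
  assumes MN: "dg_module M" "dg_module N" and F: "d_iso M N F"
  obtains P s f where "dg_module P" "quasi_iso P M s" "quasi_iso P N f"
proof -
  obtain G where FG: "F \<in> dHom M N" "G \<in> dHom N M" "dcomp M N M G F = did M" "dcomp N M N F G = did N"
    using F by (auto simp: d_iso_def)
  obtain P s f where r: "(P, s, f) \<in> F" "is_roof M N (P, s, f)"
    using dHom_nonempty[OF MN FG(1)] by (metis prod_cases3)
  note P = is_roofD[OF r(2)]
  have eq: "hgraph M N F i = roof_graph M N (P, s, f) i" for i
    using hgraph_eq_roof_graph[OF MN FG(1) r(1)] .
  have "quasi_iso P N f"
    unfolding quasi_iso_def
  proof (intro conjI allI ballI impI)
    show "chain_map P N f" by (rule P(4))
    fix i
    show "p \<in> boundaries P i" if p: "p \<in> cycles P i" "f i p \<in> boundaries N i" for p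
    proof -
      have "(s i p, 0) \<in> hgraph M N F i"
        unfolding eq using p chain_map_cycle[OF P(1,3) p(1)] boundary_0[OF MN(1)] boundary_neg[OF MN(2) p(2)] cycle_0[OF MN(2)]
        by (auto simp: roof_graph_def intro!: bexI[of _ p])
      then have "(s i p, 0) \<in> hgraph M M (did M) i"
        using hgraph_dcomp[OF MN(1,2,1) FG(1,2) did_in_dHom[OF MN(1)] FG(3)] hgraph_0[OF MN(2,1) FG(2)] by blast
      then have "s i p \<in> boundaries M i"
        using hgraph_did[OF MN(1)] boundary_neg[OF MN(1)] by force
      then show ?thesis
        using quasi_iso_inj[OF P(2) p(1)] by blast
    qed
    show "\<exists>p\<in>cycles P i. y - f i p \<in> boundaries N i" if y: "y \<in> cycles N i" for y
    proof -
      obtain x where x: "(y, x) \<in> hgraph N M G i"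
        using hgraph_total[OF MN(2,1) FG(2) y] .
      then obtain z where z: "(x, z) \<in> hgraph M N F i"
        using hgraph_total[OF MN FG(1)] hgraph_cycles[OF MN(2,1) FG(2)] by metis
      have "(y, z) \<in> hgraph N N (did N) i"
        using hgraph_dcomp[OF MN(2,1,2) FG(2,1) did_in_dHom[OF MN(2)] FG(4) x z] .
      then have "y - z \<in> boundaries N i"
        using hgraph_did[OF MN(2)] boundary_sym[OF MN(2)] by blast
      moreover obtain p where "p \<in> cycles P i" "z - f i p \<in> boundaries N i"
        using z unfolding eq by (auto simp: roof_graph_def)
      ultimately show ?thesis
        using boundary_trans[OF MN(2)] by blast
    qed
  qed
  then show thesis
    using that P by blast
qed

definition acyclic_at :: "('k, 'v) dgmod \<Rightarrow> int \<Rightarrow> bool" where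
  "acyclic_at M i \<longleftrightarrow> cycles M i \<subseteq> boundaries M i"

lemma quasi_iso_acyclic:
  assumes "dg_module M" "dg_module N" "quasi_iso M N f"
  shows "acyclic_at M i \<longleftrightarrow> acyclic_at N i"
proof -
  note f = quasi_iso_chain[OF assms(3)]
  have "z \<in> boundaries M i" if "acyclic_at N i" "z \<in> cycles M i" for z
    using that quasi_iso_inj[OF assms(3) that(2)] chain_map_cycle[OF assms(1) f that(2)] by (auto simp: acyclic_at_def)
  moreover have "w \<in> boundaries N i" if a: "acyclic_at M i" and w: "w \<in> cycles N i" for w
  proof -
    obtain z where z: "z \<in> cycles M i" "w - f i z \<in> boundaries N i"
      using quasi_iso_surj[OF assms(3) w] .
    then have "f i z \<in> boundaries N i"
      using a chain_map_boundary[OF f] by (auto simp: acyclic_at_def)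
    then show ?thesis
      using z(2) boundary_cong[OF assms(2)] by blast
  qed
  ultimately show ?thesis
    by (auto simp: acyclic_at_def)
qed

lemma isomorphic_acyclic:
  assumes "dg_module M" "dg_module N" "isomorphic M N"
  shows "acyclic_at M i \<longleftrightarrow> acyclic_at N i"
  using assms d_iso_roof[OF assms(1,2)] quasi_iso_acyclic unfolding isomorphic_def by metis

lemma zero_object_iff:
  assumes "dg_module M"
  shows "zero_object M \<longleftrightarrow> (\<forall>i. acyclic_at M i)"
proof
  assume z: "zero_object M"
  have "x \<in> boundaries M i" if "x \<in> cycles M i" for x i
  proof -
    have "(x, x) \<in> hgraph M M (did M) i"
      using that hgraph_did[OF assms] boundary_0[OF assms] by simp
    then have "(x, x) \<in> hgraph M M (dmap M M (\<lambda>i x. 0)) i"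
      using z by (simp add: zero_object_def dzero_def)
    then show ?thesis
      using hgraph_dmap[OF assms assms chain_map_zero[OF assms]] by simp
  qed
  then show "\<forall>i. acyclic_at M i"
    by (auto simp: acyclic_at_def)
next
  assume a: "\<forall>i. acyclic_at M i"
  \<comment> \<open>The map from the zero module to an acyclic \<open>M\<close> is a
    quasi-isomorphism, so it refines any two roofs on \<open>M\<close> and identifies them.\<close>
  define Z :: "('k, 'v) dgmod" where "Z = \<lparr>gr = \<lambda>i. {0}, dif = \<lambda>i x. 0, act = \<lambda>p i x. 0\<rparr>"
  have Z: "dg_module Z"
    by (simp add: Z_def dg_module_def additive_on_def koszul_def)
  have eq: "roof_eq M M r r'" if r: "is_roof M M r" "is_roof M M r'" for r r'
  proof -
    obtain P s f P' s' f' where rr: "r = (P, s, f)" "r' = (P', s', f')" by (cases r, cases r')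
    note P = is_roofD[OF r(1)[unfolded rr]] and P' = is_roofD[OF r(2)[unfolded rr]]
    have "quasi_iso Z M (s \<odot> (\<lambda>i x. 0))"
      using a chain_map_comp[OF chain_map_zero[OF P(1)] P(3)]
      by (auto simp: quasi_iso_def acyclic_at_def Z_def cycles_def boundaries_def gcomp_def
          chain_map_0[OF P(1,3)])
    then show ?thesis
      unfolding rr roof_eq_def
      using Z chain_map_zero[OF P(1)] chain_map_zero[OF P'(1)]
      by (auto intro!: exI[of _ Z] exI[of _ "\<lambda>i x. 0"] homotopic_of_eq[OF assms]
          simp: gcomp_def chain_map_0[OF P(1,3)] chain_map_0[OF P'(1,3)] chain_map_0[OF P(1,4)] chain_map_0[OF P'(1,4)])
  qed
  have "is_roof M M (M, gid, gid)" "is_roof M M (M, gid, \<lambda>i x. 0)"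
    using assms by (auto simp: is_roof_def quasi_iso_gid chain_map_gid chain_map_zero)
  then show "zero_object M"
    using eq by (auto simp: zero_object_def did_def dzero_def dmap_def roof_class_def)
qed

section \<open>Bar modules\<close>

text \<open>The infinite dimension of the ambient space is used here: it provides the independent
  vectors from which bar modules are built.\<close>

lemma ex_independent_sequence: "\<exists>e :: nat \<Rightarrow> 'v. inj e \<and> independent (range e)"
proof -
  define B where "B = extend_basis {}"
  have B: "independent B" "span B = UNIV"
    by (simp_all add: B_def independent_extend_basis span_extend_basis independent_empty)
  then have "infinite B"
    using infinite_dimensional by blast
  then obtain e :: "nat \<Rightarrow> 'v" where "inj e" "range e \<subseteq> B"
    using infinite_countable_subset by blast
  then show ?thesis
    using B(1) independent_mono by blast
qed

definition gen :: "nat \<Rightarrow> 'v" where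
  "gen = (SOME e. inj e \<and> independent (range e))"

text \<open>Coordinates refer to a basis of the whole ambient space that contains the generators, so
  \<open>coef n\<close> is linear on all vectors, without membership conditions.\<close>

definition coef :: "nat \<Rightarrow> 'v \<Rightarrow> 'k" where
  "coef n x = representation (extend_basis (range gen)) x (gen n)"

lemma gen: "inj gen" "independent (range gen)"
  using someI_ex[OF ex_independent_sequence] by (auto simp: gen_def)

lemma coef_add: "coef n (x + y) = coef n x + coef n y"
  and coef_scale: "coef n (scale c x) = c * coef n x"
  and coef_zero [simp]: "coef n 0 = 0"
  by (simp_all add: coef_def representation_add representation_scale representation_zero
      independent_extend_basis gen(2) span_extend_basis)

lemma coef_gen: "coef n (gen m) = (if m = n then 1 else 0)"
proof -
  have "gen m \<in> extend_basis (range gen)"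
    using extend_basis_superset[OF gen(2)] by blast
  then show ?thesis
    using gen(1) by (auto simp: coef_def representation_basis independent_extend_basis gen(2) inj_eq)
qed

definition vgen :: "nat \<Rightarrow> 'v" where "vgen j = gen (2 * j)"
definition ugen :: "nat \<Rightarrow> 'v" where "ugen j = gen (2 * j + 1)"
definition vc :: "nat \<Rightarrow> 'v \<Rightarrow> 'k" where "vc j = coef (2 * j)"
definition uc :: "nat \<Rightarrow> 'v \<Rightarrow> 'k" where "uc j = coef (2 * j + 1)"

lemma vuc_simps [simp]:
  "vc j (x + y) = vc j x + vc j y" "uc j (x + y) = uc j x + uc j y"
  "vc j (scale c x) = c * vc j x" "uc j (scale c x) = c * uc j x"
  "vc j 0 = 0" "uc j 0 = 0"
  by (simp_all add: vc_def uc_def coef_add coef_scale)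

lemma vuc_gens [simp]:
  "vc j (vgen l) = (if l = j then 1 else 0)" "uc j (vgen l) = 0"
  "uc j (ugen l) = (if l = j then 1 else 0)" "vc j (ugen l) = 0"
  unfolding vc_def uc_def vgen_def ugen_def coef_gen by (auto; presburger)+

lemma vuc_neg [simp]: "vc j (- x) = - vc j x" "uc j (- x) = - uc j x"
  using vuc_simps(3,4)[of j "- 1" x] by simp_all

lemma vuc_sum: "vc j (sum f J) = (\<Sum>l\<in>J. vc j (f l))" "uc j (sum f J) = (\<Sum>l\<in>J. uc j (f l))"
  by (induction J rule: infinite_finite_induct) auto

lemma sg_simps [simp]:
  "sg i (sg j x) = sg (i + j) x" "sg i 0 = 0" "sg i (- x) = - sg i x" "sg i (x + y) = sg i x + sg i y"
  "sg i (x - y) = sg i x - sg i y" "sg 0 x = x"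
  by (auto simp: sg_def)

lemma scale_sg: "scale c (sg i x) = sg i (scale c x)"
  by (simp add: sg_def)

lemma sg_sum: "sg i (sum f J) = (\<Sum>j\<in>J. sg i (f j))"
  by (simp add: sg_def sum_negf)

lemma sg_cong: "even (i - j) \<Longrightarrow> sg i x = sg j x"
  by (auto simp: sg_def)

lemma sg_Suc: "odd (i - j) \<Longrightarrow> sg i x = - sg j x"
  by (auto simp: sg_def)

lemma sg_eq_0 [simp]: "sg i x = 0 \<longleftrightarrow> x = 0"
  by (simp add: sg_def)

definition comb :: "nat set \<Rightarrow> (nat \<Rightarrow> 'k) \<Rightarrow> (nat \<Rightarrow> 'k) \<Rightarrow> 'v" where
  "comb J c d = (\<Sum>j\<in>J. scale (c j) (vgen j) + scale (d j) (ugen j))"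

text \<open>
  \<open>barmod J a b\<close> is the direct sum, over \<open>j \<in> J\<close>, of the cones of
  \<open>T^(b j + 1 - a j) : \<Sigma>^(b j + 1) k[T] \<rightarrow> \<Sigma>^(a j) k[T]\<close>; it has one homology class in each of the degrees
  from \<open>a j\<close> to \<open>b j\<close>. The powers of \<open>T\<close> act injectively, and each component is identified with its
  image in the localisation at \<open>T\<close>. So \<open>vgen j\<close> stands for all \<open>T^n\<close> times the generator in degree
  \<open>a j\<close>, \<open>ugen j\<close> for all \<open>T^n\<close> times the generator in degree \<open>b j + 2\<close>, and \<open>T\<close> acts as the inclusion.
\<close>

definition barmod :: "nat set \<Rightarrow> (nat \<Rightarrow> int) \<Rightarrow> (nat \<Rightarrow> int) \<Rightarrow> ('k, 'v) dgmod" where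
  "barmod J a b = \<lparr>
     gr = (\<lambda>i. {x. x = comb J (\<lambda>j. vc j x) (\<lambda>j. uc j x) \<and>
             (\<forall>j\<in>J. (vc j x \<noteq> 0 \<longrightarrow> a j \<le> i) \<and> (uc j x \<noteq> 0 \<longrightarrow> b j + 2 \<le> i))}),
     dif = (\<lambda>i x. sg i (comb J (\<lambda>j. uc j x) (\<lambda>j. 0))),
     act = (\<lambda>p i x. scale (lead_coeff p) x) \<rparr>"

lemma comb_add: "comb J c d + comb J c' d' = comb J (\<lambda>j. c j + c' j) (\<lambda>j. d j + d' j)"
  by (simp add: comb_def sum.distrib[symmetric] scale_left_distrib algebra_simps)

lemma comb_scale: "scale r (comb J c d) = comb J (\<lambda>j. r * c j) (\<lambda>j. r * d j)"
  by (simp add: comb_def scale_sum_right scale_right_distrib)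

lemma comb_0: "comb J (\<lambda>j. 0) (\<lambda>j. 0) = 0"
  by (simp add: comb_def)

context
  fixes J :: "nat set" and a b :: "nat \<Rightarrow> int"
  assumes J: "finite J" and ab': "\<forall>j\<in>J. a j \<le> b j"
begin

lemma ab: "j \<in> J \<Longrightarrow> a j \<le> b j"
  using ab' by blast

private abbreviation (input) K :: "('k, 'v) dgmod" where "K \<equiv> barmod J a b"

lemma comb_vc [simp]: "vc j (comb J c d) = (if j \<in> J then c j else 0)"
  and comb_uc [simp]: "uc j (comb J c d) = (if j \<in> J then d j else 0)"
  using J by (simp_all add: comb_def vuc_sum if_distrib[of "(*) _"] sum.delta cong: if_cong)

lemma comb_cong: "(\<And>j. j \<in> J \<Longrightarrow> c j = c' j \<and> d j = d' j) \<Longrightarrow> comb J c d = comb J c' d'"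
  by (simp add: comb_def)

lemma comb_if [simp]: "comb J (\<lambda>j. if j \<in> J then c j else 0) (\<lambda>j. if j \<in> J then d j else 0) = comb J c d"
  by (rule comb_cong) simp

lemma barmod_gr: "x \<in> gr K i \<longleftrightarrow> x = comb J (\<lambda>j. vc j x) (\<lambda>j. uc j x) \<and>
    (\<forall>j\<in>J. (vc j x \<noteq> 0 \<longrightarrow> a j \<le> i) \<and> (uc j x \<noteq> 0 \<longrightarrow> b j + 2 \<le> i))"
  by (simp add: barmod_def)

lemma comb_gr: "(\<And>j. j \<in> J \<Longrightarrow> (c j \<noteq> 0 \<longrightarrow> a j \<le> i) \<and> (d j \<noteq> 0 \<longrightarrow> b j + 2 \<le> i)) \<Longrightarrow> comb J c d \<in> gr K i"
  unfolding barmod_gr by (auto intro: comb_cong)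

lemma barmod_dif: "dif K i x = sg i (comb J (\<lambda>j. uc j x) (\<lambda>j. 0))"
  by (simp add: barmod_def)

lemma barmod_dif_coef [simp]: "j \<in> J \<Longrightarrow> vc j (dif K i x) = (if even i then uc j x else - uc j x)" "uc j (dif K i x) = 0"
  by (auto simp: barmod_dif sg_def)

lemma barmod_act: "act K p i x = scale (lead_coeff p) x"
  by (simp add: barmod_def)

lemma barmod_act_monom: "act K (monom c n) i x = scale c x"
  using lead_coeff_monom[of c n] by (simp only: barmod_act)

lemma barmod_tpow [simp]: "tpow K n i x = x"
  by (simp add: tpow_def barmod_act_monom)

lemma gr_mono: "x \<in> gr K i \<Longrightarrow> i \<le> i' \<Longrightarrow> x \<in> gr K i'"
  unfolding barmod_gr by force

lemma barmod_ext:
  assumes "x \<in> gr K i" "y \<in> gr K i'" "\<And>j. j \<in> J \<Longrightarrow> vc j x = vc j y \<and> uc j x = uc j y"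
  shows "x = y"
proof -
  have "x = comb J (\<lambda>j. vc j x) (\<lambda>j. uc j x)" "y = comb J (\<lambda>j. vc j y) (\<lambda>j. uc j y)"
    using assms(1,2) unfolding barmod_gr by simp_all
  moreover have "comb J (\<lambda>j. vc j x) (\<lambda>j. uc j x) = comb J (\<lambda>j. vc j y) (\<lambda>j. uc j y)"
    using assms(3) by (rule comb_cong)
  ultimately show ?thesis by simp
qed

lemma barmod_subspace: "subspace (gr K i)"
proof (rule subspaceI)
  show "0 \<in> gr K i"
    by (simp add: barmod_gr comb_0)
  show "x + y \<in> gr K i" if "x \<in> gr K i" "y \<in> gr K i" for x y
  proof -
    have "x + y = comb J (\<lambda>j. vc j (x + y)) (\<lambda>j. uc j (x + y))"
      using that comb_add[of J "\<lambda>j. vc j x" "\<lambda>j. uc j x" "\<lambda>j. vc j y" "\<lambda>j. uc j y"] unfolding barmod_gr by simp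
    then show ?thesis
      unfolding barmod_gr by (rule conjI) (use that in \<open>force simp: barmod_gr\<close>)
  qed
  show "scale c x \<in> gr K i" if "x \<in> gr K i" for c x
  proof -
    have "scale c x = comb J (\<lambda>j. vc j (scale c x)) (\<lambda>j. uc j (scale c x))"
      using that comb_scale[of c J "\<lambda>j. vc j x" "\<lambda>j. uc j x"] unfolding barmod_gr by simp
    then show ?thesis
      unfolding barmod_gr by (rule conjI) (use that in \<open>auto simp: barmod_gr\<close>)
  qed
qed

lemma barmod_dif_in:
  assumes "x \<in> gr K i"
  shows "dif K i x \<in> gr K (i - 1)"
proof -
  have "comb J (\<lambda>j. uc j x) (\<lambda>j. 0) \<in> gr K (i - 1)"
    using assms ab by (intro comb_gr) (force simp: barmod_gr)
  then show ?thesis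
    using barmod_subspace subspace_neg by (auto simp: barmod_dif sg_def)
qed

lemma barmod_dif_dif: "dif K i' (dif K i x) = 0"
  by (simp add: barmod_dif[of i'] comb_0)

lemma barmod_dif_add: "dif K i (x + y) = dif K i x + dif K i y"
  by (simp add: barmod_dif comb_add flip: sg_simps)

lemma barmod_dif_scale: "dif K i (scale c x) = scale c (dif K i x)"
  by (simp add: barmod_dif comb_scale scale_sg)

lemma dg_module_barmod: "dg_module K"
  unfolding dg_module_def
proof (intro conjI allI ballI)
  fix i n x and p :: "'k poly" assume p: "p \<in> kT n" and x: "x \<in> gr K i"
  show "act K p i x \<in> gr K (i + int n)"
    using gr_mono[OF subspace_scale[OF barmod_subspace x]] by (simp add: barmod_act)
  show "dif K (i + int n) (act K p i x) = koszul n (act K p (i - 1) (dif K i x))"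
    unfolding barmod_act barmod_dif_scale
    by (simp add: barmod_dif koszul_def sg_def)
  fix q :: "'k poly"
  show "act K (p + q) i x = act K p i x + act K q i x" if "q \<in> kT n"
    using p that by (auto simp: kT_def barmod_act_monom add_monom scale_left_distrib)
  show "act K (q * p) i x = act K q (i + int n) (act K p i x)" if "q \<in> kT m" for m
    using p that by (auto simp: kT_def barmod_act_monom mult_monom)
qed (auto simp: barmod_subspace barmod_dif_in barmod_dif_dif barmod_dif_add additive_on_def barmod_act scale_right_distrib)

lemma vgen_gr: "j \<in> J \<Longrightarrow> a j \<le> i \<Longrightarrow> vgen j \<in> gr K i"
  and ugen_gr: "j \<in> J \<Longrightarrow> b j + 2 \<le> i \<Longrightarrow> ugen j \<in> gr K i"
  unfolding barmod_gr using J
  by (auto simp: comb_def if_distrib[of "\<lambda>r. scale r _"] sum.delta' cong: if_cong)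

lemma dif_vgen: "dif K i (vgen j) = 0"
  by (simp add: barmod_dif comb_0)

lemma dif_ugen: "j \<in> J \<Longrightarrow> dif K i (ugen j) = sg i (vgen j)"
  using J by (simp add: barmod_dif comb_def if_distrib[of "\<lambda>r. scale r _"] sum.delta' cong: if_cong)

lemma barmod_cycles: "x \<in> cycles K i \<longleftrightarrow> x \<in> gr K i \<and> (\<forall>j\<in>J. uc j x = 0)"
proof -
  have "dif K i x = 0" if "\<forall>j\<in>J. uc j x = 0"
    using that comb_cong[of "\<lambda>j. uc j x" "\<lambda>j. 0" "\<lambda>j. 0" "\<lambda>j. 0"] by (simp add: barmod_dif comb_0)
  moreover have "uc j x = 0" if "dif K i x = 0" "j \<in> J" for j
    using that comb_vc[of j "\<lambda>j. uc j x" "\<lambda>j. 0"] by (simp add: barmod_dif)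
  ultimately show ?thesis
    by (auto simp: cycles_def)
qed

text \<open>\<open>ugen j\<close> is available from degree \<open>b j + 2\<close> on, and its
  differential is \<open>vgen j\<close> up to sign, one degree lower. So \<open>vgen j\<close>
  starts to be a boundary in degree \<open>b j + 1\<close>.\<close>

lemma barmod_boundaries:
  "x \<in> boundaries K i \<longleftrightarrow> x \<in> gr K i \<and> (\<forall>j\<in>J. uc j x = 0 \<and> (vc j x \<noteq> 0 \<longrightarrow> b j < i))"
proof
  assume "x \<in> boundaries K i"
  then obtain y where y: "y \<in> gr K (i + 1)" "x = dif K (i + 1) y"
    by (auto simp: boundaries_def)
  then show "x \<in> gr K i \<and> (\<forall>j\<in>J. uc j x = 0 \<and> (vc j x \<noteq> 0 \<longrightarrow> b j < i))"
    using barmod_dif_in[OF y(1)] by (force simp: barmod_gr[of y] split: if_splits)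
next
  assume x: "x \<in> gr K i \<and> (\<forall>j\<in>J. uc j x = 0 \<and> (vc j x \<noteq> 0 \<longrightarrow> b j < i))"
  define y where "y = comb J (\<lambda>j. 0) (\<lambda>j. if even (i + 1) then vc j x else - vc j x)"
  have y: "y \<in> gr K (i + 1)"
    unfolding y_def using x by (intro comb_gr) force
  have "x = dif K (i + 1) y"
    by (rule barmod_ext[of x i _ i]) (use x barmod_dif_in[OF y] in \<open>auto simp: y_def\<close>)
  then show "x \<in> boundaries K i"
    using y by (auto simp: boundaries_def)
qed

lemma vgen_cycle: "j \<in> J \<Longrightarrow> a j \<le> i \<Longrightarrow> vgen j \<in> cycles K i"
  by (simp add: barmod_cycles vgen_gr)

lemma vgen_boundary: "j \<in> J \<Longrightarrow> a j \<le> i \<Longrightarrow> vgen j \<in> boundaries K i \<longleftrightarrow> b j < i"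
  by (auto simp: barmod_boundaries vgen_gr)

lemma barmod_acyclic_at: "acyclic_at K i \<longleftrightarrow> (\<forall>j\<in>J. \<not> (a j \<le> i \<and> i \<le> b j))"
proof
  assume A: "acyclic_at K i"
  show "\<forall>j\<in>J. \<not> (a j \<le> i \<and> i \<le> b j)"
    using A vgen_cycle[of _ i] vgen_boundary[of _ i] by (fastforce simp: acyclic_at_def)
next
  assume "\<forall>j\<in>J. \<not> (a j \<le> i \<and> i \<le> b j)"
  then show "acyclic_at K i"
    unfolding acyclic_at_def by (force simp: barmod_cycles barmod_boundaries barmod_gr)
qed

lemma barmod_Df: "K \<in> Df"
proof -
  have "finite {i. cycles K i \<noteq> boundaries K i}"
  proof (rule finite_subset)
    show "{i. cycles K i \<noteq> boundaries K i} \<subseteq> (\<Union>j\<in>J. {a j..b j})"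
      using barmod_acyclic_at boundary_cycle[OF dg_module_barmod] by (fastforce simp: acyclic_at_def)
  qed (use J in simp)
  moreover have "cycles K i \<subseteq> span (vgen ` J \<union> boundaries K i)" for i
  proof
    fix x assume "x \<in> cycles K i"
    then have "x = comb J (\<lambda>j. vc j x) (\<lambda>j. 0)"
      using comb_cong[of "\<lambda>j. vc j x" "\<lambda>j. vc j x" "\<lambda>j. uc j x" "\<lambda>j. 0"]
      by (auto simp: barmod_cycles barmod_gr)
    also have "\<dots> \<in> span (vgen ` J \<union> boundaries K i)"
      unfolding comb_def by (rule span_sum) (simp add: span_scale span_base)
    finally show "x \<in> span (vgen ` J \<union> boundaries K i)" .
  qed
  ultimately show ?thesis
    using dg_module_barmod J by (auto simp: Df_def finite_homology_def)
qed

section \<open>Maps and homotopies out of bar modules, given on generators\<close>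

text \<open>The \<open>k[T]\<close>-linear map of degree \<open>d\<close> with given values on the generators, up to sign.\<close>

definition bar_map :: "('k, 'v) dgmod \<Rightarrow> int \<Rightarrow> (nat \<Rightarrow> 'v) \<Rightarrow> (nat \<Rightarrow> 'v) \<Rightarrow> int \<Rightarrow> 'v \<Rightarrow> 'v" where
  "bar_map N d z w i x = (\<Sum>j\<in>J. scale (vc j x) (tpow N (nat (i - a j)) (a j + d) (z j)) +
      scale (uc j x) (tpow N (nat (i - b j - 2)) (b j + 2 + d) (w j)))"

lemma bar_map_add: "bar_map N d z w i (x + y) = bar_map N d z w i x + bar_map N d z w i y"
  by (simp add: bar_map_def sum.distrib[symmetric] scale_left_distrib algebra_simps)

lemma bar_map_scale: "bar_map N d z w i (scale c x) = scale c (bar_map N d z w i x)"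
  by (simp add: bar_map_def scale_sum_right scale_right_distrib)

lemma bar_map_cong: "(\<And>j. j \<in> J \<Longrightarrow> z j = z' j \<and> w j = w' j) \<Longrightarrow> bar_map N d z w i x = bar_map N d z' w' i x"
  by (simp add: bar_map_def)

context
  fixes N :: "('k, 'v) dgmod" and d :: int and z w :: "nat \<Rightarrow> 'v"
  assumes N: "dg_module N" and z: "\<And>j. j \<in> J \<Longrightarrow> z j \<in> gr N (a j + d)"
    and w: "\<And>j. j \<in> J \<Longrightarrow> w j \<in> gr N (b j + 2 + d)"
begin

lemma bar_term_in:
  assumes "x \<in> gr K i" "j \<in> J"
  shows "scale (vc j x) (tpow N (nat (i - a j)) (a j + d) (z j)) \<in> gr N (i + d)"
    "scale (uc j x) (tpow N (nat (i - b j - 2)) (b j + 2 + d) (w j)) \<in> gr N (i + d)"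
proof -
  have "scale (vc j x) (tpow N (nat (i - a j)) (a j + d) (z j)) \<in> gr N (i + d)" if "vc j x \<noteq> 0"
    by (rule gr_scale[OF N tpow_in'[OF N z[OF assms(2)]]]) (use assms that in \<open>auto simp: barmod_gr\<close>)
  then show "scale (vc j x) (tpow N (nat (i - a j)) (a j + d) (z j)) \<in> gr N (i + d)"
    using gr_0[OF N] by (cases "vc j x = 0") auto
  have "scale (uc j x) (tpow N (nat (i - b j - 2)) (b j + 2 + d) (w j)) \<in> gr N (i + d)" if "uc j x \<noteq> 0"
    by (rule gr_scale[OF N tpow_in'[OF N w[OF assms(2)]]]) (use assms that in \<open>auto simp: barmod_gr\<close>)
  then show "scale (uc j x) (tpow N (nat (i - b j - 2)) (b j + 2 + d) (w j)) \<in> gr N (i + d)"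
    using gr_0[OF N] by (cases "uc j x = 0") auto
qed

lemma bar_map_in: "x \<in> gr K i \<Longrightarrow> bar_map N d z w i x \<in> gr N (i + d)"
  unfolding bar_map_def by (intro gr_sum[OF N] gr_add[OF N] bar_term_in)

lemma bar_map_tpow:
  assumes x: "x \<in> gr K i"
  shows "bar_map N d z w (i + int n) x = tpow N n (i + d) (bar_map N d z w i x)"
proof -
  have "scale (vc j x) (tpow N (nat (i + int n - a j)) (a j + d) (z j)) =
      tpow N n (i + d) (scale (vc j x) (tpow N (nat (i - a j)) (a j + d) (z j)))" if "j \<in> J" for j
  proof (cases "vc j x = 0")
    case False
    then have "a j \<le> i" using x that by (simp add: barmod_gr)
    moreover from this have "nat (i + int n - a j) = n + nat (i - a j)"
      by simp
    ultimately show ?thesis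
      using z[OF that] by (simp add: tpow_scale[OF N tpow_in'[OF N]] tpow_tpow[OF N])
  qed (simp add: tpow_0[OF N])
  moreover have "scale (uc j x) (tpow N (nat (i + int n - b j - 2)) (b j + 2 + d) (w j)) =
      tpow N n (i + d) (scale (uc j x) (tpow N (nat (i - b j - 2)) (b j + 2 + d) (w j)))" if "j \<in> J" for j
  proof (cases "uc j x = 0")
    case False
    then have "b j + 2 \<le> i" using x that by (simp add: barmod_gr)
    moreover from this have "nat (i + int n - b j - 2) = n + nat (i - b j - 2)"
      by simp
    ultimately show ?thesis
      using w[OF that] by (simp add: tpow_scale[OF N tpow_in'[OF N]] tpow_tpow[OF N])
  qed (simp add: tpow_0[OF N])
  ultimately show ?thesis
    unfolding bar_map_def
    by (subst tpow_sum[OF N]) (auto simp: gr_add[OF N] bar_term_in[OF x] tpow_add[OF N bar_term_in[OF x]] intro!: sum.cong)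
qed

text \<open>The result is again a map of this kind, of degree \<open>d - 1\<close>. Moving the
  differential past \<open>T\<close> to the power \<open>i - a j\<close> costs the sign of
  \<open>i - a j\<close>, which is split into a common \<open>sg i\<close> and a factor
  \<open>sg (a j)\<close> absorbed in the values on generators. For \<open>ugen j\<close> the parity
  of \<open>b j + 2\<close> is that of \<open>b j\<close>.\<close>

lemma dif_bar_map:
  assumes x: "x \<in> gr K i"
  shows "dif N (i + d) (bar_map N d z w i x) =
    sg i (bar_map N (d - 1) (\<lambda>j. sg (a j) (dif N (a j + d) (z j))) (\<lambda>j. sg (b j) (dif N (b j + 2 + d) (w j))) i x)"
proof -
  have 1: "dif N (i + d) (scale (vc j x) (tpow N (nat (i - a j)) (a j + d) (z j))) =
      sg i (scale (vc j x) (tpow N (nat (i - a j)) (a j + (d - 1)) (sg (a j) (dif N (a j + d) (z j)))))"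
    if "j \<in> J" for j
  proof (cases "vc j x = 0")
    case False
    then have "a j \<le> i" using x that by (simp add: barmod_gr)
    then have "sg (int (nat (i - a j))) y = sg (i + a j) y" for y
      by (intro sg_cong) simp
    then show ?thesis
      using z[OF that] \<open>a j \<le> i\<close> dif_in[OF N z[OF that]]
      by (simp add: dif_scale[OF N tpow_in'[OF N]] dif_tpow[OF N] tpow_sg[OF N] scale_sg add_diff_eq)
  qed (simp add: dif_0[OF N])
  have 2: "dif N (i + d) (scale (uc j x) (tpow N (nat (i - b j - 2)) (b j + 2 + d) (w j))) =
      sg i (scale (uc j x) (tpow N (nat (i - b j - 2)) (b j + 2 + (d - 1)) (sg (b j) (dif N (b j + 2 + d) (w j)))))"
    if "j \<in> J" for j
  proof (cases "uc j x = 0")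
    case False
    then have "b j + 2 \<le> i" using x that by (simp add: barmod_gr)
    then have "sg (int (nat (i - b j - 2))) y = sg (i + b j) y" for y
      by (intro sg_cong) simp
    then show ?thesis
      using w[OF that] \<open>b j + 2 \<le> i\<close> dif_in[OF N w[OF that]]
      by (simp add: dif_scale[OF N tpow_in'[OF N]] dif_tpow[OF N] tpow_sg[OF N] scale_sg add_diff_eq)
  qed (simp add: dif_0[OF N])
  show ?thesis
    unfolding bar_map_def sg_sum
    by (subst dif_sum[OF N]) (auto simp: gr_add[OF N] bar_term_in[OF x] dif_add[OF N bar_term_in[OF x]] 1 2 intro!: sum.cong)
qed

text \<open>The differential sends \<open>ugen j\<close> to \<open>vgen j\<close>, and the exponent
  \<open>i - 1 - a j\<close> of \<open>T\<close> that arises splits as the sum of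
  \<open>i - b j - 2\<close> and \<open>b j + 1 - a j\<close>.\<close>

lemma bar_map_dif:
  assumes x: "x \<in> gr K i"
  shows "bar_map N d z w (i - 1) (dif K i x) =
    sg i (bar_map N (d - 1) (\<lambda>j. 0) (\<lambda>j. tpow N (nat (b j + 1 - a j)) (a j + d) (z j)) i x)"
proof -
  have "scale (if even i then uc j x else - uc j x) (tpow N (nat (i - 1 - a j)) (a j + d) (z j)) =
      sg i (scale (uc j x) (tpow N (nat (i - b j - 2)) (b j + 2 + (d - 1)) (tpow N (nat (b j + 1 - a j)) (a j + d) (z j))))"
    if "j \<in> J" for j
  proof (cases "uc j x = 0")
    case False
    then have "b j + 2 \<le> i" using x that by (simp add: barmod_gr)
    moreover from this have "nat (i - 1 - a j) = nat (i - b j - 2) + nat (b j + 1 - a j)"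
      using ab[OF that] by simp
    ultimately show ?thesis
      using z[OF that] ab[OF that] by (simp add: tpow_tpow[OF N] sg_def)
  qed simp
  then show ?thesis
    unfolding bar_map_def sg_sum by (intro sum.cong) (auto simp: tpow_0[OF N])
qed

end

lemma bar_map_plus:
  assumes N: "dg_module N" and "\<And>j. j \<in> J \<Longrightarrow> z j \<in> gr N (a j + d) \<and> z' j \<in> gr N (a j + d)"
    and "\<And>j. j \<in> J \<Longrightarrow> w j \<in> gr N (b j + 2 + d) \<and> w' j \<in> gr N (b j + 2 + d)"
  shows "bar_map N d z w i x + bar_map N d z' w' i x = bar_map N d (\<lambda>j. z j + z' j) (\<lambda>j. w j + w' j) i x"
  using assms unfolding bar_map_def sum.distrib[symmetric]
  by (intro sum.cong) (auto simp: tpow_add[OF N] scale_right_distrib)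

lemma bar_map_eq:
  assumes N: "dg_module N" and f: "chain_map K N f" and x: "x \<in> gr K i"
  shows "f i x = bar_map N 0 (\<lambda>j. f (a j) (vgen j)) (\<lambda>j. f (b j + 2) (ugen j)) i x"
proof -
  note K = dg_module_barmod
  have v: "scale (vc j x) (vgen j) \<in> gr K i \<and>
      f i (scale (vc j x) (vgen j)) = scale (vc j x) (tpow N (nat (i - a j)) (a j) (f (a j) (vgen j)))"
    if "j \<in> J" for j
  proof (cases "vc j x = 0")
    case False
    then have i: "a j \<le> i" using x that by (simp add: barmod_gr)
    then have "f i (vgen j) = tpow N (nat (i - a j)) (a j) (f (a j) (vgen j))"
      using chain_map_tpow[OF f vgen_gr[OF that], of "a j" i "nat (i - a j)"] by simp
    then show ?thesis
      using vgen_gr[OF that i] by (simp add: chain_map_scale[OF K N f] gr_scale[OF K])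
  qed (simp add: gr_0[OF K] chain_map_0[OF K f])
  have u: "scale (uc j x) (ugen j) \<in> gr K i \<and>
      f i (scale (uc j x) (ugen j)) = scale (uc j x) (tpow N (nat (i - b j - 2)) (b j + 2) (f (b j + 2) (ugen j)))"
    if "j \<in> J" for j
  proof (cases "uc j x = 0")
    case False
    then have i: "b j + 2 \<le> i" using x that by (simp add: barmod_gr)
    then have "f i (ugen j) = tpow N (nat (i - b j - 2)) (b j + 2) (f (b j + 2) (ugen j))"
      using chain_map_tpow[OF f ugen_gr[OF that], of "b j + 2" i "nat (i - b j - 2)"] by simp
    then show ?thesis
      using ugen_gr[OF that i] by (simp add: chain_map_scale[OF K N f] gr_scale[OF K])
  qed (simp add: gr_0[OF K] chain_map_0[OF K f])
  have "f i x = f i (comb J (\<lambda>j. vc j x) (\<lambda>j. uc j x))"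
    using x by (simp add: barmod_gr)
  also have "\<dots> = (\<Sum>j\<in>J. f i (scale (vc j x) (vgen j) + scale (uc j x) (ugen j)))"
    unfolding comb_def by (rule chain_map_sum[OF K f]) (use u v gr_add[OF K] in blast)
  also have "\<dots> = bar_map N 0 (\<lambda>j. f (a j) (vgen j)) (\<lambda>j. f (b j + 2) (ugen j)) i x"
    unfolding bar_map_def by (intro sum.cong) (auto simp: chain_map_add[OF f] u v)
  finally show ?thesis .
qed

text \<open>The relation imposed by the second generator. With the converse
  \<open>chain_map_bar_map\<close>, chain maps out of a bar are pairs of a cycle \<open>z\<close>
  and a chain \<open>w\<close> which witnesses that a power of \<open>T\<close> annihilates the
  class of \<open>z\<close>.\<close>

lemma dif_chain_map_ugen:
  assumes f: "chain_map K N f" and j: "j \<in> J"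
  shows "dif N (b j + 2) (f (b j + 2) (ugen j)) = sg (b j) (tpow N (nat (b j + 1 - a j)) (a j) (f (a j) (vgen j)))"
proof -
  have "f (b j + 1) (vgen j) = tpow N (nat (b j + 1 - a j)) (a j) (f (a j) (vgen j))"
    using chain_map_tpow[OF f vgen_gr[OF j order_refl], of "b j + 1" "nat (b j + 1 - a j)"] ab[OF j] by simp
  then show ?thesis
    using chain_map_dif[OF f ugen_gr[OF j order_refl]] dif_ugen[OF j, of "b j + 2"] sg_cong[of "b j + 2" "b j"]
      vgen_gr[OF j, of "b j + 1"] ab[OF j]
    by (simp add: chain_map_sg[OF dg_module_barmod f] add.commute)
qed

lemma chain_map_bar_map:
  assumes N: "dg_module N" and z: "\<And>j. j \<in> J \<Longrightarrow> z j \<in> cycles N (a j)"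
    and w: "\<And>j. j \<in> J \<Longrightarrow> w j \<in> gr N (b j + 2)"
    and dw: "\<And>j. j \<in> J \<Longrightarrow> dif N (b j + 2) (w j) = sg (b j) (tpow N (nat (b j + 1 - a j)) (a j) (z j))"
  shows "chain_map K N (bar_map N 0 z w)"
  unfolding chain_map_def
proof (intro conjI allI ballI)
  have z': "z j \<in> gr N (a j + 0)" and w': "w j \<in> gr N (b j + 2 + 0)" if "j \<in> J" for j
    using cycle_gr[OF N z[OF that]] w[OF that] by simp_all
  note h = z' w'
  fix i
  show "additive_on (gr K i) (bar_map N 0 z w i)"
    by (simp add: additive_on_def bar_map_add)
  fix x assume x: "x \<in> gr K i"
  show "bar_map N 0 z w i x \<in> gr N i"
    using bar_map_in[OF N h x] by simp
  have "bar_map N 0 z w (i - 1) (dif K i x) =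
    sg i (bar_map N (- 1) (\<lambda>j. 0) (\<lambda>j. tpow N (nat (b j + 1 - a j)) (a j) (z j)) i x)"
    using bar_map_dif[OF N h x] by simp
  also have "\<dots> = sg i (bar_map N (- 1) (\<lambda>j. sg (a j) (dif N (a j) (z j))) (\<lambda>j. sg (b j) (dif N (b j + 2) (w j))) i x)"
    using cycle_dif[OF N z] dw sg_cong[of "b j + b j" 0 for j]
    by (intro arg_cong[of _ _ "sg i"] bar_map_cong) simp
  also have "\<dots> = dif N i (bar_map N 0 z w i x)"
    using dif_bar_map[OF N h x] by simp
  finally show "bar_map N 0 z w (i - 1) (dif K i x) = dif N i (bar_map N 0 z w i x)" .
  fix n and p :: "'k poly" assume "p \<in> kT n"
  then obtain c where p: "p = monom c n" by (auto simp: kT_def)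
  have "bar_map N 0 z w i x \<in> gr N i"
    using bar_map_in[OF N h x] by simp
  then show "bar_map N 0 z w (i + int n) (act K p i x) = act N p i (bar_map N 0 z w i x)"
    using bar_map_tpow[OF N h x, of n] by (simp add: p barmod_act_monom bar_map_scale act_monom[OF N])
qed

lemma bar_map_vgen: "dg_module N \<Longrightarrow> j \<in> J \<Longrightarrow> z j \<in> gr N (a j) \<Longrightarrow> bar_map N 0 z w (a j) (vgen j) = z j"
  using J by (simp add: bar_map_def if_distrib[of "\<lambda>r. scale r _"] sum.delta' tpow_zero_exp cong: if_cong)

lemma bar_map_ugen: "dg_module N \<Longrightarrow> j \<in> J \<Longrightarrow> w j \<in> gr N (b j + 2) \<Longrightarrow> bar_map N 0 z w (b j + 2) (ugen j) = w j"
  using J by (simp add: bar_map_def if_distrib[of "\<lambda>r. scale r _"] sum.delta' tpow_zero_exp cong: if_cong)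

text \<open>A homotopy is determined by its values \<open>p\<close> and \<open>q\<close> on the
  generators, and the homotopy formula has to be checked only there. The second summand for
  \<open>ugen j\<close> is the value of the homotopy on the differential of
  \<open>ugen j\<close>.\<close>

lemma homotopic_barI:
  assumes N: "dg_module N" and f: "chain_map K N f" and g: "chain_map K N g"
    and p: "\<And>j. j \<in> J \<Longrightarrow> p j \<in> gr N (a j + 1)" and q: "\<And>j. j \<in> J \<Longrightarrow> q j \<in> gr N (b j + 3)"
    and fv: "\<And>j. j \<in> J \<Longrightarrow> f (a j) (vgen j) - g (a j) (vgen j) = dif N (a j + 1) (p j)"
    and fu: "\<And>j. j \<in> J \<Longrightarrow> f (b j + 2) (ugen j) - g (b j + 2) (ugen j) =
      dif N (b j + 3) (q j) + sg (a j + 1) (tpow N (nat (b j + 1 - a j)) (a j + 1) (p j))"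
  shows "homotopic K N f g"
proof -
  note K = dg_module_barmod
  \<comment> \<open>\<open>bar_map\<close> commutes with \<open>T\<close>, whereas a homotopy must
    anticommute with it. The outer \<open>sg i\<close> provides this sign, and the inner signs
    cancel it on the generators.\<close>
  define s where "s = (\<lambda>i x. sg i (bar_map N 1 (\<lambda>j. sg (a j) (p j)) (\<lambda>j. sg (b j) (q j)) i x))"
  have p': "sg (a j) (p j) \<in> gr N (a j + 1)" and q': "sg (b j) (q j) \<in> gr N (b j + 2 + 1)" if "j \<in> J" for j
    using p[OF that] q[OF that] gr_sg[OF N] by (simp_all add: add.assoc)
  note h = p' q'
  note h' = chain_map_minus[OF N f g]
  have s_in: "s i x \<in> gr N (i + 1)" if "x \<in> gr K i" for i x
    unfolding s_def using bar_map_in[OF N h that] gr_sg[OF N] by blast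
  have eq: "f i x - g i x = dif N (i + 1) (s i x) + s (i - 1) (dif K i x)" if x: "x \<in> gr K i" for i x
  proof -
    have "dif N (i + 1) (s i x) = sg i (sg i (bar_map N 0 (\<lambda>j. sg (a j) (dif N (a j + 1) (sg (a j) (p j))))
        (\<lambda>j. sg (b j) (dif N (b j + 2 + 1) (sg (b j) (q j)))) i x))"
      unfolding s_def by (subst dif_sg[OF N bar_map_in[OF N h x]]) (simp_all add: dif_bar_map[OF N h x])
    also have "\<dots> = bar_map N 0 (\<lambda>j. sg (a j) (dif N (a j + 1) (sg (a j) (p j))))
        (\<lambda>j. sg (b j) (dif N (b j + 2 + 1) (sg (b j) (q j)))) i x"
      using sg_cong[of "i + i" 0] by simp
    also have "\<dots> = bar_map N 0 (\<lambda>j. dif N (a j + 1) (p j)) (\<lambda>j. dif N (b j + 3) (q j)) i x"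
      using dif_sg[OF N p] dif_sg[OF N q] sg_cong[of "b j + b j" 0 for j] sg_cong[of "a j + a j" 0 for j]
      by (intro bar_map_cong) (simp add: add.assoc)
    finally have 1: "dif N (i + 1) (s i x) = bar_map N 0 (\<lambda>j. dif N (a j + 1) (p j)) (\<lambda>j. dif N (b j + 3) (q j)) i x" .
    have "s (i - 1) (dif K i x) =
        sg (i - 1 + i) (bar_map N 0 (\<lambda>j. 0) (\<lambda>j. tpow N (nat (b j + 1 - a j)) (a j + 1) (sg (a j) (p j))) i x)"
      using bar_map_dif[OF N h x] by (simp add: s_def)
    also have "\<dots> = bar_map N 0 (\<lambda>j. 0) (\<lambda>j. - tpow N (nat (b j + 1 - a j)) (a j + 1) (sg (a j) (p j))) i x"
    proof -
      have "tpow N (nat (b j + 1 - a j)) (a j + 1) (sg (a j) (p j)) \<in> gr N (b j + 2)" if "j \<in> J" for j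
        by (rule tpow_in'[OF N p'[OF that]]) (use ab[OF that] in simp)
      then show ?thesis
        by (subst sg_Suc[of _ 0])
          (simp_all add: bar_map_def sum_negf[symmetric] tpow_0[OF N] tpow_neg[OF N] cong: sum.cong)
    qed
    also have "\<dots> = bar_map N 0 (\<lambda>j. 0) (\<lambda>j. sg (a j + 1) (tpow N (nat (b j + 1 - a j)) (a j + 1) (p j))) i x"
      using p sg_Suc[of "a j + 1" "a j" for j] by (intro bar_map_cong) (simp add: tpow_sg[OF N])
    finally have 2: "s (i - 1) (dif K i x) = \<dots>" .
    have "dif N (a j + 1) (p j) \<in> gr N (a j + 0)" "dif N (b j + 3) (q j) \<in> gr N (b j + 2 + 0)"
      "sg (a j + 1) (tpow N (nat (b j + 1 - a j)) (a j + 1) (p j)) \<in> gr N (b j + 2 + 0)" if "j \<in> J" for j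
    proof -
      show "dif N (a j + 1) (p j) \<in> gr N (a j + 0)"
        using dif_in[OF N p[OF that]] by simp
      show "dif N (b j + 3) (q j) \<in> gr N (b j + 2 + 0)"
        using dif_in[OF N q[OF that]] by (simp add: add.commute)
      show "sg (a j + 1) (tpow N (nat (b j + 1 - a j)) (a j + 1) (p j)) \<in> gr N (b j + 2 + 0)"
        by (rule gr_sg[OF N tpow_in'[OF N p[OF that]]]) (use ab[OF that] in simp)
    qed
    then have "dif N (i + 1) (s i x) + s (i - 1) (dif K i x) =
      bar_map N 0 (\<lambda>j. dif N (a j + 1) (p j) + 0)
        (\<lambda>j. dif N (b j + 3) (q j) + sg (a j + 1) (tpow N (nat (b j + 1 - a j)) (a j + 1) (p j))) i x"
      unfolding 1 2 by (intro bar_map_plus[OF N]) (auto simp: gr_0[OF N])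
    also have "\<dots> = bar_map N 0 (\<lambda>j. f (a j) (vgen j) - g (a j) (vgen j)) (\<lambda>j. f (b j + 2) (ugen j) - g (b j + 2) (ugen j)) i x"
      using fv fu by (intro bar_map_cong) simp
    finally show ?thesis
      using bar_map_eq[OF N h' x] by simp
  qed
  have "s (i + int n) (act K r i x) = koszul n (act N r (i + 1) (s i x))" if x: "x \<in> gr K i" and r: "r \<in> kT n" for i x n r
  proof -
    obtain c where r: "r = monom c n" using r by (auto simp: kT_def)
    have "koszul n (act N r (i + 1) (s i x)) = koszul n (scale c (tpow N n (i + 1) (s i x)))"
      using s_in[OF x] by (simp add: r act_monom[OF N])
    also have "\<dots> = s (i + int n) (act K r i x)"
      using bar_map_tpow[OF N h x, of n] bar_map_in[OF N h x]
      by (simp add: s_def r barmod_act_monom bar_map_scale tpow_sg[OF N] scale_sg koszul_def) (simp add: sg_def)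
    finally show ?thesis ..
  qed
  moreover have "additive_on (gr K i) (s i)" for i
    by (simp add: s_def additive_on_def bar_map_add)
  ultimately show ?thesis
    unfolding homotopic_def using s_in eq by blast
qed

end

section \<open>K-projectivity of bar modules\<close>

text \<open>Lifting for a single bar. Surjectivity of \<open>s\<close> on homology lifts
  \<open>z\<close> up to the boundary of \<open>p\<close>. The bounding relation for
  \<open>w\<close> passes to \<open>z'\<close> by injectivity on homology, which gives a bounding
  chain \<open>w1\<close>. Its image matches \<open>w\<close> only up to a cycle once
  \<open>p\<close> is accounted for, and surjectivity is used again to correct it.\<close>

lemma cell_lift:
  assumes P: "dg_module P" and N: "dg_module N" and s: "quasi_iso P N s" and ab: "a \<le> b"
    and z: "z \<in> cycles N a" and w: "w \<in> gr N (b + 2)" "dif N (b + 2) w = sg b (tpow N (nat (b + 1 - a)) a z)"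
  shows "\<exists>z' w' p q. z' \<in> cycles P a \<and> w' \<in> gr P (b + 2) \<and> p \<in> gr N (a + 1) \<and> q \<in> gr N (b + 3) \<and>
    dif P (b + 2) w' = sg b (tpow P (nat (b + 1 - a)) a z') \<and>
    s a z' - z = dif N (a + 1) p \<and>
    s (b + 2) w' - w = dif N (b + 3) q + sg (a + 1) (tpow N (nat (b + 1 - a)) (a + 1) p)"
proof -
  note s' = quasi_iso_chain[OF s]
  define r where "r = nat (b + 1 - a)"
  have r: "b + 1 = a + int r" "b + 2 = a + 1 + int r"
    using ab by (simp_all add: r_def)
  obtain z' where z': "z' \<in> cycles P a" "z - s a z' \<in> boundaries N a"
    using quasi_iso_surj[OF s z] .
  obtain p where p: "p \<in> gr N (a + 1)" "s a z' - z = dif N (a + 1) p"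
    using boundary_sym[OF N z'(2)] by (rule boundariesE[OF N])
  have sz': "s a z' \<in> gr N a"
    using chain_map_in[OF s' cycle_gr[OF P z'(1)]] .
  note zg = cycle_gr[OF N z] and z'g = cycle_gr[OF P z'(1)]
  have "sg b (tpow N r a z) \<in> boundaries N (b + 1)"
    by (rule boundariesI[OF N, of w]) (use w in \<open>simp_all add: r_def algebra_simps\<close>)
  then have "sg (b + b) (tpow N r a z) \<in> boundaries N (b + 1)"
    using boundary_sg[OF N] by (metis sg_simps(1))
  then have "tpow N r a z \<in> boundaries N (b + 1)"
    using sg_cong[of "b + b" 0] by simp
  moreover have "tpow N r a (s a z' - z) \<in> boundaries N (b + 1)"
    using tpow_boundary[OF N boundary_sym[OF N z'(2)] r(1)] .
  ultimately have "tpow N r a (s a z') \<in> boundaries N (b + 1)"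
    using boundary_cong[OF N] by (metis tpow_diff[OF N sz' zg])
  then have "s (b + 1) (tpow P r a z') \<in> boundaries N (b + 1)"
    by (simp add: chain_map_tpow[OF s' z'g r(1)])
  then have "tpow P r a z' \<in> boundaries P (b + 1)"
    using quasi_iso_inj[OF s tpow_cycle[OF P z'(1) r(1)]] by blast
  then obtain w0 where w0: "w0 \<in> gr P (b + 2)" "tpow P r a z' = dif P (b + 2) w0"
    by (rule boundariesE[OF P]) (simp add: add.assoc that)
  define w1 where "w1 = sg b w0"
  have w1: "w1 \<in> gr P (b + 2)" "dif P (b + 2) w1 = sg b (tpow P r a z')"
    using w0 by (simp_all add: w1_def gr_sg[OF P] dif_sg[OF P])
  have Tp: "tpow N r (a + 1) p \<in> gr N (b + 2)"
    using tpow_in'[OF N p(1) r(2)] .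
  \<comment> \<open>The error left after the term prescribed by \<open>p\<close> in the homotopy
    formula is taken into account. It is a cycle, so subtracting a lift \<open>y\<close> of its
    class from \<open>w1\<close> turns it into a boundary.\<close>
  define e where "e = s (b + 2) w1 - w - sg (a + 1) (tpow N r (a + 1) p)"
  note e_in = chain_map_in[OF s' w1(1)] gr_sg[OF N Tp, of "a + 1"] w(1) gr_diff[OF N]
  have "dif N (b + 2) (s (b + 2) w1) = sg b (tpow N r a (s a z'))"
    using chain_map_dif'[OF s', of w1 "b + 1"] w1 z'g tpow_in'[OF P z'g r(1)]
    by (simp add: chain_map_sg[OF P s'] chain_map_tpow[OF s' _ r(1)] add.assoc)
  moreover have "dif N (b + 2) (sg (a + 1) (tpow N r (a + 1) p)) = sg b (tpow N r a (dif N (a + 1) p))"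
  proof -
    have "sg (a + 1 + int r) y = sg b y" for y
      using ab by (intro sg_cong) (simp add: r_def)
    then show ?thesis
      using dif_tpow[OF N p(1) r(2)] by (simp add: dif_sg[OF N Tp])
  qed
  ultimately have "dif N (b + 2) e = sg b (tpow N r a (s a z') - tpow N r a z - tpow N r a (dif N (a + 1) p))"
    unfolding e_def using e_in w(2) by (simp add: dif_diff[OF N] r_def)
  also have "\<dots> = 0"
    unfolding p(2)[symmetric] by (simp add: tpow_diff[OF N sz' zg])
  finally have e: "e \<in> cycles N (b + 2)"
    unfolding cycles_def using e_in by (simp add: e_def)
  obtain y where y: "y \<in> cycles P (b + 2)" "e - s (b + 2) y \<in> boundaries N (b + 2)"
    using quasi_iso_surj[OF s e] .
  obtain q where q: "q \<in> gr N (b + 3)" "e - s (b + 2) y = dif N (b + 3) q"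
    using y(2) by (rule boundariesE[OF N]) (simp add: add.assoc that)
  have yg: "y \<in> gr P (b + 2)" "dif P (b + 2) y = 0"
    using y(1) by (simp_all add: cycles_def)
  have "s (b + 2) (w1 - y) - w = (e - s (b + 2) y) + sg (a + 1) (tpow N r (a + 1) p)"
    unfolding e_def using w1 yg by (simp add: chain_map_diff[OF P s'])
  then have "s (b + 2) (w1 - y) - w = dif N (b + 3) q + sg (a + 1) (tpow N r (a + 1) p)"
    by (simp add: q(2))
  moreover have "w1 - y \<in> gr P (b + 2)" "dif P (b + 2) (w1 - y) = sg b (tpow P r a z')"
    using w1 yg by (simp_all add: gr_diff[OF P] dif_diff[OF P])
  ultimately show ?thesis
    using z'(1) p q(1) unfolding r_def by blast
qed

text \<open>Uniqueness for a single bar: a null homotopy of the composite with \<open>s\<close> is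
  pulled back to one of the map itself. A chain bounding \<open>z\<close> exists by injectivity on
  homology, but it has to be chosen so that the remaining error in \<open>w\<close> is a
  boundary.\<close>

lemma cell_null:
  assumes P: "dg_module P" and N: "dg_module N" and s: "quasi_iso P N s" and ab: "a \<le> b"
    and z: "z \<in> cycles P a" and w: "w \<in> gr P (b + 2)" "dif P (b + 2) w = sg b (tpow P (nat (b + 1 - a)) a z)"
    and p: "p \<in> gr N (a + 1)" "s a z = dif N (a + 1) p"
    and q: "q \<in> gr N (b + 3)" "s (b + 2) w = dif N (b + 3) q + sg (a + 1) (tpow N (nat (b + 1 - a)) (a + 1) p)"
  shows "\<exists>p' q'. p' \<in> gr P (a + 1) \<and> q' \<in> gr P (b + 3) \<and> z = dif P (a + 1) p' \<and>
    w = dif P (b + 3) q' + sg (a + 1) (tpow P (nat (b + 1 - a)) (a + 1) p')"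
proof -
  note s' = quasi_iso_chain[OF s]
  define r where "r = nat (b + 1 - a)"
  have r: "b + 1 = a + int r" "b + 2 = a + 1 + int r" "b + 3 = a + 2 + int r"
    using ab by (simp_all add: r_def)
  have "s a z \<in> boundaries N a"
    using p boundariesI[OF N] by blast
  then have "z \<in> boundaries P a"
    using quasi_iso_inj[OF s z] by blast
  then obtain p1 where p1: "p1 \<in> gr P (a + 1)" "z = dif P (a + 1) p1"
    by (rule boundariesE[OF P])
  have "s (a + 1) p1 - p \<in> cycles N (a + 1)"
    using chain_map_in[OF s' p1(1)] p chain_map_dif'[OF s' p1(1)] p1(2)
    by (simp add: cycles_def gr_diff[OF N] dif_diff[OF N])
  then obtain y where y: "y \<in> cycles P (a + 1)" "s (a + 1) p1 - p - s (a + 1) y \<in> boundaries N (a + 1)"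
    using quasi_iso_surj[OF s] by blast
  note yg = cycle_gr[OF P y(1)] 
  \<comment> \<open>\<open>p1\<close> bounds \<open>z\<close>, but its image may differ from
    \<open>p\<close> by a nontrivial class. Removing the cycle \<open>y\<close> makes the difference
    a boundary, from which it follows that the image of \<open>e\<close> bounds.\<close>
  define p' where "p' = p1 - y"
  have p': "p' \<in> gr P (a + 1)" "z = dif P (a + 1) p'"
    using p1 yg cycle_dif[OF P y(1)] by (simp_all add: p'_def gr_diff[OF P] dif_diff[OF P])
  have "s (a + 1) p' - p \<in> boundaries N (a + 1)"
    using y(2) unfolding p'_def chain_map_diff[OF P s' p1(1) yg] diff_diff_eq add.commute[of p] .
  then have "tpow N r (a + 1) (s (a + 1) p' - p) \<in> boundaries N (b + 2)"
    using tpow_boundary[OF N _ r(2)] by blast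
  then have T: "sg (a + 1) (tpow N r (a + 1) p) - sg (a + 1) (tpow N r (a + 1) (s (a + 1) p')) \<in> boundaries N (b + 2)"
    using boundary_sg[OF N boundary_sym[OF N], of _ _ "b + 2" "a + 1"] chain_map_in[OF s' p'(1)] p(1)
    by (simp add: tpow_diff[OF N])
  have Tp': "tpow P r (a + 1) p' \<in> gr P (b + 2)"
    using tpow_in'[OF P p'(1) r(2)] .
  define e where "e = w - sg (a + 1) (tpow P r (a + 1) p')"
  have "dif P (b + 2) (sg (a + 1) (tpow P r (a + 1) p')) = sg b (tpow P r a z)"
  proof -
    have "sg (a + 1 + int r) y = sg b y" for y
      using ab by (intro sg_cong) (simp add: r_def)
    then show ?thesis
      using dif_tpow[OF P p'(1) r(2)] p'(2) by (simp add: dif_sg[OF P Tp'])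
  qed
  then have e: "e \<in> cycles P (b + 2)"
    using w Tp' unfolding e_def r_def cycles_def by (simp add: gr_diff[OF P] gr_sg[OF P] dif_diff[OF P])
  have "dif N (b + 2 + 1) q \<in> boundaries N (b + 2)"
    by (rule boundariesI[OF N, of q]) (use q(1) in \<open>simp_all add: add.assoc\<close>)
  moreover have "s (b + 2) e = dif N (b + 2 + 1) q + (sg (a + 1) (tpow N r (a + 1) p) - sg (a + 1) (tpow N r (a + 1) (s (a + 1) p')))"
    unfolding e_def using w(1) Tp' q(2)
    by (simp add: chain_map_diff[OF P s'] gr_sg[OF P] chain_map_sg[OF P s'] chain_map_tpow[OF s' p'(1) r(2), unfolded r_def] r_def add.assoc)
  ultimately have "s (b + 2) e \<in> boundaries N (b + 2)"
    using boundary_add[OF N _ T] by simp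
  then have "e \<in> boundaries P (b + 2)"
    using quasi_iso_inj[OF s e] by blast
  then obtain q' where q': "q' \<in> gr P (b + 2 + 1)" "e = dif P (b + 2 + 1) q'"
    by (rule boundariesE[OF P])
  then show ?thesis
    using p' unfolding e_def r_def by (intro exI[of _ p'] exI[of _ q']) (simp add: algebra_simps)
qed

lemma kproj_barmod:
  assumes "finite J" "\<forall>j\<in>J. a j \<le> b j"
  shows "kproj (barmod J a b)"
  unfolding kproj_def
proof (intro conjI allI impI)
  let ?K = "barmod J a b"
  note K = dg_module_barmod[OF assms]
  show "dg_module ?K" by (rule K)
  have ab: "a j \<le> b j" if "j \<in> J" for j
    using assms(2) that by blast
  have dif_u: "dif ?K (b j + 2) (ugen j) = sg (b j) (vgen j)" if "j \<in> J" for j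
    using dif_ugen[OF assms that] sg_cong[of "b j + 2" "b j"] by simp
  have vg: "vgen j \<in> cycles ?K (a j)" and ug: "ugen j \<in> gr ?K (b j + 2)" and vg': "vgen j \<in> gr ?K (a j)" if "j \<in> J" for j
    using vgen_cycle[OF assms that] ugen_gr[OF assms that] vgen_gr[OF assms that] by simp_all
  have vg'': "vgen j \<in> gr ?K (b j + 1)" if "j \<in> J" for j
    by (rule vgen_gr[OF assms that]) (use ab[OF that] in simp_all)
  have dw: "dif N (b j + 2) (f (b j + 2) (ugen j)) = sg (b j) (tpow N (nat (b j + 1 - a j)) (a j) (f (a j) (vgen j)))"
    if "chain_map ?K N f" "j \<in> J" for N f j
    using dif_chain_map_ugen[OF assms that] .
  fix P N s assume P: "dg_module P" and N: "dg_module N" and s: "quasi_iso P N s"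
  note s' = quasi_iso_chain[OF s]
  {
    fix f assume f: "chain_map ?K N f"
    have "\<forall>j\<in>J. \<exists>z' w' p q. z' \<in> cycles P (a j) \<and> w' \<in> gr P (b j + 2) \<and> p \<in> gr N (a j + 1) \<and> q \<in> gr N (b j + 3) \<and>
      dif P (b j + 2) w' = sg (b j) (tpow P (nat (b j + 1 - a j)) (a j) z') \<and>
      s (a j) z' - f (a j) (vgen j) = dif N (a j + 1) p \<and>
      s (b j + 2) w' - f (b j + 2) (ugen j) = dif N (b j + 3) q + sg (a j + 1) (tpow N (nat (b j + 1 - a j)) (a j + 1) p)"
      using cell_lift[OF P N s ab] chain_map_cycle[OF K f vg] chain_map_in[OF f ug] dw[OF f] by blast
    then obtain z' w' p q where h: "\<And>j. j \<in> J \<Longrightarrow> z' j \<in> cycles P (a j) \<and> w' j \<in> gr P (b j + 2) \<and> p j \<in> gr N (a j + 1) \<and> q j \<in> gr N (b j + 3) \<and>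
      dif P (b j + 2) (w' j) = sg (b j) (tpow P (nat (b j + 1 - a j)) (a j) (z' j)) \<and>
      s (a j) (z' j) - f (a j) (vgen j) = dif N (a j + 1) (p j) \<and>
      s (b j + 2) (w' j) - f (b j + 2) (ugen j) = dif N (b j + 3) (q j) + sg (a j + 1) (tpow N (nat (b j + 1 - a j)) (a j + 1) (p j))"
      by metis
    define g where "g = bar_map J a b P 0 z' w'"
    have g: "chain_map ?K P g"
      unfolding g_def by (rule chain_map_bar_map[OF assms P]) (use h in auto)
    have gv: "g (a j) (vgen j) = z' j" if "j \<in> J" for j
      unfolding g_def by (rule bar_map_vgen[OF assms P that]) (use h[OF that] cycle_gr[OF P] in auto)
    have gu: "g (b j + 2) (ugen j) = w' j" if "j \<in> J" for j
      unfolding g_def by (rule bar_map_ugen[OF assms P that]) (use h[OF that] in auto)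
    have "homotopic ?K N (s \<odot> g) f"
      by (rule homotopic_barI[OF assms N chain_map_comp[OF g s'] f, of p q])
        (use h in \<open>simp_all add: gcomp_def gv gu\<close>)
    then show "\<exists>g. chain_map ?K P g \<and> homotopic ?K N (s \<odot> g) f"
      using g by blast
  next
    fix g g' assume g: "chain_map ?K P g" and g': "chain_map ?K P g'" and hom: "homotopic ?K N (s \<odot> g) (s \<odot> g')"
    define h where "h = (\<lambda>i x. g i x - g' i x)"
    have h: "chain_map ?K P h"
      unfolding h_def by (rule chain_map_minus[OF P g g'])
    obtain t where t: "\<And>i. additive_on (gr ?K i) (t i)"
      and t': "\<And>i x. x \<in> gr ?K i \<Longrightarrow> t i x \<in> gr N (i + 1) \<and>
          (\<forall>n. \<forall>p\<in>kT n. t (i + int n) (act ?K p i x) = koszul n (act N p (i + 1) (t i x))) \<and>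
          (s \<odot> g) i x - (s \<odot> g') i x = dif N (i + 1) (t i x) + t (i - 1) (dif ?K i x)"
      using hom unfolding homotopic_def by blast
    have t0: "t i 0 = 0" for i
    proof -
      have "t i (0 + 0) = t i 0 + t i 0"
        using t[of i] gr_0[OF K] unfolding additive_on_def by blast
      then show ?thesis by simp
    qed
    have tneg: "t i (- x) = - t i x" if "x \<in> gr ?K i" for i x
    proof -
      have "t i (x + - x) = t i x + t i (- x)"
        using t[of i] gr_neg[OF K that] that unfolding additive_on_def by blast
      then show ?thesis using t0 by (simp add: add_eq_0_iff)
    qed
    have sh: "s i (h i x) = dif N (i + 1) (t i x) + t (i - 1) (dif ?K i x)" if "x \<in> gr ?K i" for i x
      using t'[OF that] by (simp add: h_def gcomp_def chain_map_diff[OF P s'] chain_map_in[OF g that] chain_map_in[OF g' that])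
    have "\<exists>p' q'. p' \<in> gr P (a j + 1) \<and> q' \<in> gr P (b j + 3) \<and> h (a j) (vgen j) = dif P (a j + 1) p' \<and>
      h (b j + 2) (ugen j) = dif P (b j + 3) q' + sg (a j + 1) (tpow P (nat (b j + 1 - a j)) (a j + 1) p')" if j: "j \<in> J" for j
    proof (rule cell_null[OF P N s ab[OF j] chain_map_cycle[OF K h vg[OF j]] chain_map_in[OF h ug[OF j]] dw[OF h j]])
      show "t (a j) (vgen j) \<in> gr N (a j + 1)" "t (b j + 2) (ugen j) \<in> gr N (b j + 3)"
        using t'[OF vg'[OF j]] t'[OF ug[OF j]] by (simp_all add: add.assoc)
      show "s (a j) (h (a j) (vgen j)) = dif N (a j + 1) (t (a j) (vgen j))"
        using sh[OF vg'[OF j]] by (simp add: dif_vgen[OF assms] t0)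
      \<comment> \<open>As \<open>T\<close> acts on a bar module by inclusion, \<open>vgen j\<close>
        in degree \<open>b j + 1\<close> is a power of \<open>T\<close> times the generator in
        degree \<open>a j\<close>, so linearity of the homotopy determines its value.\<close>
      have "t (b j + 1) (vgen j) = sg (b j + 1 - a j) (tpow N (nat (b j + 1 - a j)) (a j + 1) (t (a j) (vgen j)))"
      proof -
        let ?n = "nat (b j + 1 - a j)"
        have "t (a j + int ?n) (act ?K (monom 1 ?n) (a j) (vgen j)) = koszul ?n (act N (monom 1 ?n) (a j + 1) (t (a j) (vgen j)))"
          using t'[OF vg'[OF j]] monom_in_kT by blast
        then show ?thesis
          using ab[OF j] by (simp add: barmod_act_monom[OF assms] koszul_def sg_def tpow_def even_nat_iff)
      qed
      then have "t (b j + 1) (sg (b j) (vgen j)) = sg (a j + 1) (tpow N (nat (b j + 1 - a j)) (a j + 1) (t (a j) (vgen j)))"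
        using tneg[OF vg''[OF j]] ab[OF j] by (auto simp: sg_def)
      then show "s (b j + 2) (h (b j + 2) (ugen j)) = dif N (b j + 3) (t (b j + 2) (ugen j)) +
          sg (a j + 1) (tpow N (nat (b j + 1 - a j)) (a j + 1) (t (a j) (vgen j)))"
        using sh[OF ug[OF j]] dif_u[OF j] by (simp add: add.assoc algebra_simps)
    qed
    then obtain p' q' where pq: "\<And>j. j \<in> J \<Longrightarrow> p' j \<in> gr P (a j + 1) \<and> q' j \<in> gr P (b j + 3) \<and> h (a j) (vgen j) = dif P (a j + 1) (p' j) \<and>
      h (b j + 2) (ugen j) = dif P (b j + 3) (q' j) + sg (a j + 1) (tpow P (nat (b j + 1 - a j)) (a j + 1) (p' j))"
      by metis
    show "homotopic ?K P g g'"
      by (rule homotopic_barI[OF assms P g g', of p' q']) (use pq in \<open>auto simp: h_def\<close>)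
  }
qed

section \<open>Every object is a finite direct sum of bars\<close>

text \<open>The functional is the coordinate at \<open>x\<close> in a basis that extends
  \<open>x\<close> together with a basis of \<open>S\<close>.\<close>

lemma separating_functional:
  assumes "subspace S" "x \<notin> S"
  obtains h :: "'v \<Rightarrow> 'k" where "\<And>u v. h (u + v) = h u + h v" "\<And>c u. h (scale c u) = c * h u"
    "\<And>s. s \<in> S \<Longrightarrow> h s = 0" "h x = 1"
proof -
  obtain B where B: "B \<subseteq> S" "independent B" "S \<subseteq> span B"
    using maximal_independent_subset by blast
  have S: "span B = S"
    using B assms(1) by (simp add: span_subspace)
  then have ins: "independent (insert x B)"
    using B assms(2) by (simp add: independent_insertI)
  define B' where "B' = extend_basis (insert x B)"
  have B': "insert x B \<subseteq> B'" "independent B'" "span B' = UNIV"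
    using extend_basis_superset[OF ins] independent_extend_basis[OF ins] span_extend_basis[OF ins]
    by (simp_all add: B'_def)
  show thesis
  proof (rule that[of "\<lambda>y. representation B' y x"])
    show "representation B' (u + v) x = representation B' u x + representation B' v x" for u v
      using B' by (simp add: representation_add)
    show "representation B' (scale c u) x = c * representation B' u x" for c u
      using B' by (simp add: representation_scale)
    show "representation B' x x = 1"
      using B' by (simp add: representation_basis)
    show "representation B' s x = 0" if "s \<in> S" for s
    proof -
      have "representation B' s = representation B s"
        using representation_extend[of B' s B] B' that S by blast
      moreover have "x \<notin> B"
        using B(1) assms(2) by blast
      ultimately show ?thesis
        using representation_ne_zero[of B s x] by metis
    qed
  qed
qed

text \<open>This makes the induction measure of \<open>ex_bar_basis\<close> decrease: cutting down
  to the kernel of a functional saves one spanning vector. The projection \<open>r\<close> onto the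
  kernel kills \<open>s0\<close>, on which \<open>h\<close> is nonzero, and fixes
  \<open>B\<close>.\<close>

lemma span_kernel_card:
  fixes h :: "'v \<Rightarrow> 'k"
  assumes h: "\<And>u v. h (u + v) = h u + h v" "\<And>c u. h (scale c u) = c * h u"
    and B: "\<And>s. s \<in> B \<Longrightarrow> h s = 0" and S: "finite S" and x: "x \<in> span (S \<union> B)" "h x \<noteq> 0"
  obtains S' where "finite S'" "card S' < card S" "{y \<in> span (S \<union> B). h y = 0} \<subseteq> span (S' \<union> B)"
proof -
  have h0: "h 0 = 0"
    using h(2)[of 0 0] by simp
  obtain s0 where s0: "s0 \<in> S" "h s0 \<noteq> 0"
  proof (rule ccontr)
    assume "\<not> thesis"
    then have "\<forall>s\<in>S \<union> B. h s = 0"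
      using that B by blast
    then have "h x = 0"
      by (intro span_induct[OF x(1), of "\<lambda>x. h x = 0"]) (auto simp: subspace_def h h0)
    then show False
      using x(2) by simp
  qed
  define r where "r = (\<lambda>y. y - scale (h y / h s0) s0)"
  define S' where "S' = r ` (S - {s0})"
  have r: "r (u + v) = r u + r v" "r (scale c u) = scale c (r u)" "r 0 = 0" for u v c
    by (simp_all add: r_def h h0 add_divide_distrib scale_left_distrib scale_right_diff_distrib algebra_simps)
  have "r y \<in> span (S' \<union> B)" if "y \<in> span (S \<union> B)" for y
  proof (rule span_induct[OF that, of "\<lambda>y. r y \<in> span (S' \<union> B)"])
    show "subspace {y. r y \<in> span (S' \<union> B)}"
      by (auto simp: subspace_def r span_add span_scale span_zero)
    fix s assume "s \<in> S \<union> B"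
    then consider "s = s0" | "s \<in> S - {s0}" | "s \<in> B" by blast
    then show "r s \<in> span (S' \<union> B)"
    proof cases
      case 1
      then show ?thesis using s0 by (simp add: r_def span_zero)
    next
      case 2
      then show ?thesis by (simp add: S'_def span_base)
    next
      case 3
      then show ?thesis using B by (simp add: r_def span_base)
    qed
  qed
  moreover have "r y = y" if "h y = 0" for y
    using that by (simp add: r_def)
  ultimately have "{y \<in> span (S \<union> B). h y = 0} \<subseteq> span (S' \<union> B)"
    by force
  moreover have "card S' < card S"
    unfolding S'_def using card_image_le[of "S - {s0}" r] card_Diff1_less[OF S s0(1)] S by simp
  moreover have "finite S'"
    using S by (simp add: S'_def)
  ultimately show thesis
    using that by blast
qed

context
  fixes M :: "('k, 'v) dgmod"
  assumes M: "dg_module M"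
begin

text \<open>A graded submodule of the homology, given by its preimage in the cycles.\<close>

definition hsub :: "(int \<Rightarrow> 'v set) \<Rightarrow> bool" where
  "hsub W \<longleftrightarrow> (\<forall>i. subspace (W i) \<and> boundaries M i \<subseteq> W i \<and> W i \<subseteq> cycles M i \<and>
     (\<forall>x\<in>W i. tpow M 1 i x \<in> W (i + 1)))"

definition barsum :: "nat set \<Rightarrow> (nat \<Rightarrow> int) \<Rightarrow> (nat \<Rightarrow> int) \<Rightarrow> (nat \<Rightarrow> 'v) \<Rightarrow> (nat \<Rightarrow> 'k) \<Rightarrow> int \<Rightarrow> 'v" where
  "barsum J a b z c i = (\<Sum>j\<in>{j \<in> J. a j \<le> i \<and> i \<le> b j}. scale (c j) (tpow M (nat (i - a j)) (a j) (z j)))"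

text \<open>A decomposition of \<open>W\<close>, modulo boundaries, into truncated cyclic
  \<open>k[T]\<close>-modules: in degree \<open>i\<close> a basis is given by the multiples of those
  \<open>z j\<close> whose bar contains \<open>i\<close>. In particular no multiple of
  \<open>z j\<close> vanishes before degree \<open>b j + 1\<close>.\<close>

definition bar_basis :: "(int \<Rightarrow> 'v set) \<Rightarrow> nat set \<Rightarrow> (nat \<Rightarrow> int) \<Rightarrow> (nat \<Rightarrow> int) \<Rightarrow> (nat \<Rightarrow> 'v) \<Rightarrow> bool" where
  "bar_basis W J a b z \<longleftrightarrow> finite J \<and>
     (\<forall>j\<in>J. a j \<le> b j \<and> z j \<in> W (a j) \<and> tpow M (nat (b j + 1 - a j)) (a j) (z j) \<in> boundaries M (b j + 1)) \<and>
     (\<forall>i. \<forall>x\<in>W i. \<exists>c. x - barsum J a b z c i \<in> boundaries M i) \<and>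
     (\<forall>i c. barsum J a b z c i \<in> boundaries M i \<longrightarrow> (\<forall>j\<in>J. a j \<le> i \<and> i \<le> b j \<longrightarrow> c j = 0))"

lemma hsubD:
  assumes "hsub W"
  shows "subspace (W i)" "x \<in> boundaries M i \<Longrightarrow> x \<in> W i" "x \<in> W i \<Longrightarrow> x \<in> cycles M i" "x \<in> W i \<Longrightarrow> x \<in> gr M i"
    "x \<in> W i \<Longrightarrow> tpow M 1 i x \<in> W (i + 1)"
  using assms cycle_gr[OF M] unfolding hsub_def by blast+

lemma hsub_tpow: "hsub W \<Longrightarrow> x \<in> W i \<Longrightarrow> tpow M n i x \<in> W (i + int n)"
proof (induction n)
  case 0
  then show ?case by (simp add: tpow_zero_exp[OF M hsubD(4)])
next
  case (Suc n)
  then have "tpow M 1 (i + int n) (tpow M n i x) \<in> W (i + int n + 1)"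
    using hsubD(5) by blast
  then show ?case
    using tpow_tpow[OF M hsubD(4)[OF Suc.prems] refl, of 1 n] by (simp add: algebra_simps)
qed

text \<open>
  A cycle \<open>z\<close> of maximal order \<open>n + 1\<close> in homology generates a direct summand: if \<open>h\<close> is a functional
  vanishing on boundaries with \<open>h (T^n z) = 1\<close>, then the classes \<open>x\<close> with \<open>h (T^m x) = 0\<close>, for the power
  of \<open>T\<close> that moves \<open>x\<close> to the degree of \<open>T^n z\<close>, form a complement.
\<close>

lemma ex_bar_basis:
  assumes "hsub W" "finite I" "\<And>i. finite (S i)" "\<And>i. i \<notin> I \<Longrightarrow> S i = {}" "\<And>i. W i \<subseteq> span (S i \<union> boundaries M i)"
  shows "\<exists>J a b z. bar_basis W J a b z"
  using assms
proof (induction "\<Sum>i\<in>I. card (S i)" arbitrary: W S rule: less_induct)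
  case less
  note W = hsubD[OF less.prems(1)]
  note bs = boundaries_subspace[OF M]
  show ?case
  proof (cases "\<forall>i. W i = boundaries M i")
    case True
    then have "bar_basis W {} (\<lambda>j. 0) (\<lambda>j. 0) (\<lambda>j. 0)"
      by (simp add: bar_basis_def barsum_def)
    then show ?thesis by blast
  next
    case False
    \<comment> \<open>The exponents of powers of \<open>T\<close> that act nontrivially on
      \<open>W\<close> in homology. They are bounded because the homology of \<open>W\<close> is
      confined to the degrees in \<open>I\<close>; the maximum yields a longest bar.\<close>
    define L where "L = {n. \<exists>i z. z \<in> W i \<and> tpow M n i z \<notin> boundaries M (i + int n)}"
    have I: "i \<in> I" if "z \<in> W i" "z \<notin> boundaries M i" for z i
    proof (rule ccontr)
      assume "i \<notin> I"
      then have "W i \<subseteq> span (boundaries M i)"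
        using less.prems(4,5)[of i] by simp
      then show False
        using that bs[of i] by (metis span_eq_iff subsetD)
    qed
    have "0 \<in> L"
    proof -
      obtain i z where "z \<in> W i" "z \<notin> boundaries M i"
        using False W(2) by blast
      then show ?thesis
        unfolding L_def using tpow_zero_exp[OF M W(4)] by fastforce
    qed
    have L_bound: "n \<le> nat (Max I - Min I)" if nL: "n \<in> L" for n
    proof -
      obtain i z where z: "z \<in> W i" "tpow M n i z \<notin> boundaries M (i + int n)"
        using nL by (auto simp: L_def)
      have "i \<in> I" "i + int n \<in> I"
        using I[OF z(1)] I[OF hsub_tpow[OF less.prems(1) z(1)] z(2)] z tpow_boundary[OF M _ refl] by blast+
      then have "Min I \<le> i" "i + int n \<le> Max I"
        using less.prems(2) by simp_all
      then show ?thesis by linarith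
    qed
    have "finite L"
      using L_bound by (intro finite_subset[of L "{..nat (Max I - Min I)}"]) auto
    define n where "n = Max L"
    have "n \<in> L"
      unfolding n_def using \<open>finite L\<close> \<open>0 \<in> L\<close> by (intro Max_in) auto
    then obtain a0 z0 where z0: "z0 \<in> W a0" "tpow M n a0 z0 \<notin> boundaries M (a0 + int n)"
      unfolding L_def by blast
    define b0 where "b0 = a0 + int n"
    have n_max: "tpow M m i z \<in> boundaries M (i + int m)" if "m > n" "z \<in> W i" for m i z
    proof (rule ccontr)
      assume "tpow M m i z \<notin> boundaries M (i + int m)"
      then have "m \<in> L" using that by (auto simp: L_def)
      then show False
        using that Max_ge[OF \<open>finite L\<close>] by (fastforce simp: n_def)
    qed
    obtain h :: "'v \<Rightarrow> 'k" where h: "\<And>u v. h (u + v) = h u + h v" "\<And>c u. h (scale c u) = c * h u"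
      "\<And>s. s \<in> boundaries M b0 \<Longrightarrow> h s = 0" "h (tpow M n a0 z0) = 1"
      using separating_functional[OF bs z0(2)] unfolding b0_def by blast
    define k where "k = (\<lambda>i x. h (tpow M (nat (b0 - i)) i x))"
    have k_add: "k i (x + y) = k i x + k i y" if "x \<in> gr M i" "y \<in> gr M i" for i x y
      using that by (simp add: k_def tpow_add[OF M] h)
    have k_scale: "k i (scale c x) = c * k i x" if "x \<in> gr M i" for i x c
      using that by (simp add: k_def tpow_scale[OF M] h)
    have k_0: "k i 0 = 0" for i
      using h(2)[of 0 0] by (simp add: k_def tpow_0[OF M])
    have k_diff: "k i (x - y) = k i x - k i y" if "x \<in> gr M i" "y \<in> gr M i" for i x y
      using k_add[OF gr_diff[OF M that] that(2)] by simp
    have k_boundary: "k i x = 0" if "x \<in> boundaries M i" "i \<le> b0" for i x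
      using tpow_boundary[OF M that(1), of b0 "nat (b0 - i)"] that(2) h(3) by (simp add: k_def)
    \<comment> \<open>Only the degrees from \<open>a0\<close> to \<open>b0\<close> contain a
      multiple of \<open>z0\<close> that has to be split off, so the complement is cut out by
      \<open>k\<close> there and nowhere else.\<close>
    define W' where "W' = (\<lambda>i. if a0 \<le> i \<and> i \<le> b0 then {x \<in> W i. k i x = 0} else W i)"
    have W'_sub: "W' i \<subseteq> W i" for i
      by (simp add: W'_def)
    have k_z0: "k i (tpow M (nat (i - a0)) a0 z0) = 1" if "a0 \<le> i" "i \<le> b0" for i
    proof -
      have "nat (b0 - i) + nat (i - a0) = n"
        using that by (simp add: b0_def)
      then show ?thesis
        using tpow_tpow[OF M W(4)[OF z0(1)], of i "nat (i - a0)" "nat (b0 - i)"] that h(4) by (simp add: k_def)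
    qed
    have "hsub W'"
      unfolding hsub_def
    proof (intro allI conjI ballI)
      fix i
      show "subspace (W' i)"
      proof (cases "a0 \<le> i \<and> i \<le> b0")
        case True
        show ?thesis
          by (rule subspaceI) (use True W(1)[of i] in \<open>auto simp: W'_def k_0 k_add k_scale W(4) subspace_0 subspace_add subspace_scale\<close>)
      qed (auto simp: W'_def W(1))
      show "boundaries M i \<subseteq> W' i"
        using W(2)[of _ i] k_boundary[of _ i] by (auto simp: W'_def)
      show "W' i \<subseteq> cycles M i"
        using W(3)[of _ i] W'_sub by blast
      fix x assume x: "x \<in> W' i"
      then have x': "x \<in> W i" using W'_sub by blast
      have "k (i + 1) (tpow M 1 i x) = 0" if i: "a0 \<le> i + 1" "i + 1 \<le> b0"
      proof -
        have e: "nat (b0 - (i + 1)) + 1 = nat (b0 - i)"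
          using i by simp
        have "tpow M (nat (b0 - (i + 1))) (i + 1) (tpow M 1 i x) = tpow M (nat (b0 - i)) i x"
          using tpow_tpow[OF M W(4)[OF x'], of "i + 1" 1 "nat (b0 - (i + 1))"] unfolding e by simp
        then have "k (i + 1) (tpow M 1 i x) = k i x"
          by (simp add: k_def)
        \<comment> \<open>Closure under \<open>T\<close> is at risk only on entering the range, from
          degree \<open>a0 - 1\<close> to \<open>a0\<close>. There the power of \<open>T\<close>
          that reaches degree \<open>b0\<close> exceeds \<open>n\<close>, so it kills the class of
          \<open>x\<close> by maximality of \<open>n\<close>.\<close>
        moreover have "k i x = 0"
        proof (cases "a0 \<le> i")
          case True
          then show ?thesis using x i by (simp add: W'_def)
        next
          case False
          then have "n < nat (b0 - i)" "i + int (nat (b0 - i)) = b0"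
            using i by (simp_all add: b0_def)
          then show ?thesis
            using n_max[OF _ x', of "nat (b0 - i)"] h(3) by (simp add: k_def)
        qed
        ultimately show ?thesis by simp
      qed
      then show "tpow M 1 i x \<in> W' (i + 1)"
        using W(5)[OF x'] by (simp add: W'_def)
    qed
    note W' = hsubD[OF this]
    have t_in: "tpow M n a0 z0 \<in> span (S b0 \<union> boundaries M b0)"
      using hsub_tpow[OF less.prems(1) z0(1), of n] less.prems(5)[of b0] by (auto simp: b0_def)
    have t_ne: "h (tpow M n a0 z0) \<noteq> 0"
      using h(4) by simp
    obtain Sb where Sb: "finite Sb" "card Sb < card (S b0)"
      "{y \<in> span (S b0 \<union> boundaries M b0). h y = 0} \<subseteq> span (Sb \<union> boundaries M b0)"
      by (rule span_kernel_card[OF h(1,2,3) less.prems(3)[of b0] t_in t_ne]) (blast intro: that)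
    have "b0 \<in> I"
      using Sb(2) less.prems(4)[of b0] by (cases "b0 \<in> I") simp_all
    \<comment> \<open>Shrinking the spanning set in the single degree \<open>b0\<close> is enough
      for the measure to drop. In that degree \<open>k\<close> agrees with \<open>h\<close> on
      \<open>M\<close>.\<close>
    have IH: "\<exists>J a b z. bar_basis W' J a b z"
    proof (rule less.hyps[OF _ \<open>hsub W'\<close> less.prems(2), of "S(b0 := Sb)"])
      have "(\<Sum>i\<in>I. card ((S(b0 := Sb)) i)) = card Sb + (\<Sum>i\<in>I - {b0}. card (S i))"
        using \<open>b0 \<in> I\<close> less.prems(2) by (simp add: sum.remove)
      also have "\<dots> < (\<Sum>i\<in>I. card (S i))"
        using \<open>b0 \<in> I\<close> less.prems(2) Sb(2) by (simp add: sum.remove)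
      finally show "(\<Sum>i\<in>I. card ((S(b0 := Sb)) i)) < (\<Sum>i\<in>I. card (S i))" .
      show "finite ((S(b0 := Sb)) i)" for i
        using less.prems(3) Sb(1) by simp
      show "(S(b0 := Sb)) i = {}" if "i \<notin> I" for i
        using that less.prems(4) \<open>b0 \<in> I\<close> by auto
      show "W' i \<subseteq> span ((S(b0 := Sb)) i \<union> boundaries M i)" for i
      proof (cases "i = b0")
        case True
        have "h x = 0" if "x \<in> W' b0" for x
          using that tpow_zero_exp[OF M W'(4)[OF that]] by (simp add: W'_def k_def b0_def)
        then show ?thesis
          using Sb(3) W'_sub[of b0] less.prems(5)[of b0] True by auto
      next
        case False
        then show ?thesis
          using W'_sub[of i] less.prems(5)[of i] by auto
      qed
    qed
    then obtain J a b z where J: "bar_basis W' J a b z"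
      by blast
    have fin: "finite J" and
      bars: "\<And>j. j \<in> J \<Longrightarrow> a j \<le> b j \<and> z j \<in> W' (a j) \<and> tpow M (nat (b j + 1 - a j)) (a j) (z j) \<in> boundaries M (b j + 1)" and
      gens: "\<And>i x. x \<in> W' i \<Longrightarrow> \<exists>c. x - barsum J a b z c i \<in> boundaries M i" and
      indep: "\<And>i c j. barsum J a b z c i \<in> boundaries M i \<Longrightarrow> j \<in> J \<Longrightarrow> a j \<le> i \<Longrightarrow> i \<le> b j \<Longrightarrow> c j = 0"
      using J unfolding bar_basis_def by blast+
    obtain j0 where j0: "j0 \<notin> J"
      using ex_new_if_finite[OF infinite_UNIV_nat fin] by blast
    define J' a' b' z' where def': "J' = insert j0 J" "a' = a(j0 := a0)" "b' = b(j0 := b0)" "z' = z(j0 := z0)"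
    have sum_in: "barsum J' a' b' z' c i = scale (c j0) (tpow M (nat (i - a0)) a0 z0) + barsum J a b z c i"
      if "a0 \<le> i" "i \<le> b0" for c i
    proof -
      have "{j \<in> J'. a' j \<le> i \<and> i \<le> b' j} = insert j0 {j \<in> J. a j \<le> i \<and> i \<le> b j}"
        using that j0 by (auto simp: def')
      moreover have "(\<Sum>j\<in>{j \<in> J. a j \<le> i \<and> i \<le> b j}. scale (c j) (tpow M (nat (i - a' j)) (a' j) (z' j))) = barsum J a b z c i"
        unfolding barsum_def using j0 by (intro sum.cong) (auto simp: def')
      ultimately show ?thesis
        using fin j0 unfolding barsum_def[of J'] by (simp add: def')
    qed
    have sum_out: "barsum J' a' b' z' c i = barsum J a b z c i" if "\<not> (a0 \<le> i \<and> i \<le> b0)" for c i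
    proof -
      have "{j \<in> J'. a' j \<le> i \<and> i \<le> b' j} = {j \<in> J. a j \<le> i \<and> i \<le> b j}"
        using that j0 by (auto simp: def')
      then show ?thesis
        unfolding barsum_def using j0 by (intro sum.cong) (auto simp: def')
    qed
    have barsum_W': "barsum J a b z c i \<in> W' i" for c i
      unfolding barsum_def
    proof (intro subspace_sum[OF W'(1)] subspace_scale[OF W'(1)])
      fix j assume "j \<in> {j \<in> J. a j \<le> i \<and> i \<le> b j}"
      then show "tpow M (nat (i - a j)) (a j) (z j) \<in> W' i"
        using hsub_tpow[OF \<open>hsub W'\<close>, of "z j" "a j" "nat (i - a j)"] bars by simp
    qed
    have tz0: "tpow M (nat (i - a0)) a0 z0 \<in> W i" if "a0 \<le> i" for i
      using hsub_tpow[OF less.prems(1) z0(1), of "nat (i - a0)"] that by simp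
    have "bar_basis W J' a' b' z'"
      unfolding bar_basis_def
    proof (intro conjI allI ballI impI)
      show "finite J'"
        using fin by (simp add: def')
      show "a' j \<le> b' j" if "j \<in> J'" for j
        using that bars by (auto simp: def' b0_def)
      show "z' j \<in> W (a' j)" if "j \<in> J'" for j
        using that bars W'_sub z0(1) by (auto simp: def')
      show "tpow M (nat (b' j + 1 - a' j)) (a' j) (z' j) \<in> boundaries M (b' j + 1)" if "j \<in> J'" for j
      proof (cases "j = j0")
        case True
        have "nat (b0 + 1 - a0) = n + 1"
          by (simp add: b0_def)
        then show ?thesis
          using True n_max[OF _ z0(1), of "n + 1"] by (simp add: def' b0_def algebra_simps)
      next
        case False
        then show ?thesis using that bars by (simp add: def')
      qed
      show "\<exists>c. x - barsum J' a' b' z' c i \<in> boundaries M i" if x: "x \<in> W i" for i x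
      proof (cases "a0 \<le> i \<and> i \<le> b0")
        case True
        \<comment> \<open>\<open>k i\<close> takes the value 1 on the multiple of \<open>z0\<close>
          in degree \<open>i\<close>, so this is the projection of \<open>x\<close> to the
          complement.\<close>
        define y where "y = x - scale (k i x) (tpow M (nat (i - a0)) a0 z0)"
        have "y \<in> W i"
          unfolding y_def using x tz0 True W(1) subspace_diff subspace_scale by blast
        moreover have "k i y = 0"
          unfolding y_def using x tz0[of i] True k_z0[of i] by (simp add: k_diff k_scale W(4) gr_scale[OF M])
        ultimately have "y \<in> W' i"
          using True by (simp add: W'_def)
        then obtain c where c: "y - barsum J a b z c i \<in> boundaries M i"
          using gens by blast
        have "barsum J a b z (c(j0 := k i x)) i = barsum J a b z c i"
          unfolding barsum_def using j0 by (intro sum.cong) auto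
        then have "x - barsum J' a' b' z' (c(j0 := k i x)) i = y - barsum J a b z c i"
          using True by (simp add: sum_in y_def)
        then show ?thesis
          using c by metis
      next
        case False
        then show ?thesis
          using gens[of x i] x by (auto simp: sum_out W'_def)
      qed
      show "c j = 0" if s: "barsum J' a' b' z' c i \<in> boundaries M i" and j: "j \<in> J'" and ij: "a' j \<le> i \<and> i \<le> b' j" for i c j
      proof (cases "a0 \<le> i \<and> i \<le> b0")
        case True
        have "k i (barsum J' a' b' z' c i) = 0"
          using k_boundary[OF s] True by blast
        moreover have "k i (barsum J a b z c i) = 0"
          using barsum_W'[of c i] True by (simp add: W'_def)
        ultimately have c0: "c j0 = 0"
          using True k_z0[of i] tz0[of i] W'(4)[OF barsum_W']
          by (simp add: sum_in k_add k_scale W(4) gr_scale[OF M])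
        then have "barsum J a b z c i \<in> boundaries M i"
          using s True by (simp add: sum_in)
        then show ?thesis
          using c0 j ij indep by (cases "j = j0") (auto simp: def')
      next
        case False
        have "barsum J a b z c i \<in> boundaries M i"
          using s unfolding sum_out[OF False] .
        then show ?thesis
          using j ij indep False by (cases "j = j0") (auto simp: def')
      qed
    qed
    then show ?thesis by blast
  qed
qed

text \<open>The chain map sends \<open>vgen j\<close> to \<open>z j\<close> and
  \<open>ugen j\<close> to a chain bounding the multiple of \<open>z j\<close> in degree
  \<open>b j + 1\<close>. In homology it takes the standard basis of the bar module to the given
  one.\<close>

lemma bar_basis_quasi_iso:
  assumes B: "bar_basis (cycles M) J a b z"
  obtains f where "quasi_iso (barmod J a b) M f"
proof -
  have J: "finite J" and ab: "\<forall>j\<in>J. a j \<le> b j" and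
      bars: "\<And>j. j \<in> J \<Longrightarrow> z j \<in> cycles M (a j) \<and> tpow M (nat (b j + 1 - a j)) (a j) (z j) \<in> boundaries M (b j + 1)" and
      gens: "\<And>i x. x \<in> cycles M i \<Longrightarrow> \<exists>c. x - barsum J a b z c i \<in> boundaries M i" and
      indep: "\<And>i c j. barsum J a b z c i \<in> boundaries M i \<Longrightarrow> j \<in> J \<Longrightarrow> a j \<le> i \<Longrightarrow> i \<le> b j \<Longrightarrow> c j = 0"
    using B unfolding bar_basis_def by blast+
  have "\<exists>w. w \<in> gr M (b j + 2) \<and> dif M (b j + 2) w = sg (b j) (tpow M (nat (b j + 1 - a j)) (a j) (z j))" if "j \<in> J" for j
  proof -
    have "sg (b j) (tpow M (nat (b j + 1 - a j)) (a j) (z j)) \<in> boundaries M (b j + 1)"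
      using boundary_sg[OF M] bars[OF that] by blast
    then show ?thesis
      by (rule boundariesE[OF M]) (auto simp: add.assoc)
  qed
  then obtain w where w: "\<And>j. j \<in> J \<Longrightarrow> w j \<in> gr M (b j + 2)"
    "\<And>j. j \<in> J \<Longrightarrow> dif M (b j + 2) (w j) = sg (b j) (tpow M (nat (b j + 1 - a j)) (a j) (z j))"
    by metis
  define f where "f = bar_map J a b M 0 z w"
  let ?K = "barmod J a b"
  have f: "chain_map ?K M f"
    unfolding f_def by (rule chain_map_bar_map[OF J ab M]) (use bars w in auto)
  have eq: "f i x - barsum J a b z (\<lambda>j. vc j x) i \<in> boundaries M i" if "x \<in> cycles ?K i" for i x
  proof -
    have x: "x \<in> gr ?K i" "\<And>j. j \<in> J \<Longrightarrow> uc j x = 0"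
      using that barmod_cycles[OF J ab] by auto
    let ?A = "{j \<in> J. a j \<le> i \<and> i \<le> b j}"
    let ?t = "\<lambda>j. scale (vc j x) (tpow M (nat (i - a j)) (a j) (z j))"
    have "f i x = (\<Sum>j\<in>J. ?t j)"
      unfolding f_def bar_map_def[OF J ab] using x by simp
    also have "\<dots> = (\<Sum>j\<in>J - ?A. ?t j) + (\<Sum>j\<in>?A. ?t j)"
      by (rule sum.subset_diff) (use J in auto)
    finally have "f i x - barsum J a b z (\<lambda>j. vc j x) i = (\<Sum>j\<in>J - ?A. ?t j)"
      by (simp add: barsum_def)
    also have "\<dots> \<in> boundaries M i"
    proof (rule boundary_sum[OF M])
      fix j assume j: "j \<in> J - ?A"
      show "?t j \<in> boundaries M i"
      proof (cases "vc j x = 0")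
        case True
        then show ?thesis using boundary_0[OF M] by simp
      next
        case False
        then have "a j \<le> i"
          using x(1) j barmod_gr[OF J ab] by blast
        then have "b j < i" using j by auto
        then have "nat (i - a j) = nat (i - b j - 1) + nat (b j + 1 - a j)"
          using ab j by auto
        then have "tpow M (nat (i - a j)) (a j) (z j) =
            tpow M (nat (i - b j - 1)) (b j + 1) (tpow M (nat (b j + 1 - a j)) (a j) (z j))"
          using tpow_tpow[OF M cycle_gr[OF M], of "z j" "a j" "b j + 1" "nat (b j + 1 - a j)" "nat (i - b j - 1)"] bars j ab by auto
        then show ?thesis
          using boundary_scale[OF M tpow_boundary[OF M, of _ "b j + 1" i "nat (i - b j - 1)"]] bars j \<open>b j < i\<close> by simp
      qed
    qed
    finally show ?thesis .
  qed
  have "quasi_iso ?K M f"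
    unfolding quasi_iso_def
  proof (intro conjI allI ballI impI)
    show "chain_map ?K M f" by (rule f)
    fix i
    show "x \<in> boundaries ?K i" if x: "x \<in> cycles ?K i" "f i x \<in> boundaries M i" for x
    proof -
      have "barsum J a b z (\<lambda>j. vc j x) i \<in> boundaries M i"
        using boundary_cong[OF M eq[OF x(1)]] x(2) by blast
      then have "\<forall>j\<in>J. a j \<le> i \<and> i \<le> b j \<longrightarrow> vc j x = 0"
        using indep[of "\<lambda>j. vc j x"] by blast
      then show ?thesis
        using x(1) unfolding barmod_boundaries[OF J ab] barmod_cycles[OF J ab] barmod_gr[OF J ab]
        by (meson not_le)
    qed
    show "\<exists>x\<in>cycles ?K i. y - f i x \<in> boundaries M i" if y: "y \<in> cycles M i" for y
    proof -
      obtain c where c: "y - barsum J a b z c i \<in> boundaries M i"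
        using gens[OF y] by blast
      define x where "x = comb J (\<lambda>j. if a j \<le> i \<and> i \<le> b j then c j else 0) (\<lambda>j. 0)"
      have x: "x \<in> cycles ?K i"
        unfolding barmod_cycles[OF J ab] x_def using comb_gr[OF J ab] comb_uc[OF J ab] by auto
      have "barsum J a b z (\<lambda>j. vc j x) i = barsum J a b z c i"
        unfolding barsum_def x_def using comb_vc[OF J ab] by (intro sum.cong) auto
      then have "barsum J a b z c i - f i x \<in> boundaries M i"
        using boundary_sym[OF M eq[OF x]] by simp
      then show ?thesis
        using x boundary_trans[OF M c] by blast
    qed
  qed
  then show thesis
    by (rule that)
qed

end

lemma Df_dg: "M \<in> Df \<Longrightarrow> dg_module M"
  by (simp add: Df_def)

lemma Df_resolution:
  assumes "M \<in> Df"
  obtains J a b f where "finite J" "\<forall>j\<in>J. a j \<le> b j" "quasi_iso (barmod J a b) M f" "resolution (barmod J a b) f M"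
proof -
  note M = Df_dg[OF assms]
  have fin: "finite {i. cycles M i \<noteq> boundaries M i}" and
    "\<forall>i. \<exists>B. finite B \<and> cycles M i \<subseteq> span (B \<union> boundaries M i)"
    using assms by (auto simp: Df_def finite_homology_def)
  then obtain S0 where S0: "\<And>i. finite (S0 i)" "\<And>i. cycles M i \<subseteq> span (S0 i \<union> boundaries M i)"
    by metis
  define S where "S = (\<lambda>i. if cycles M i = boundaries M i then {} else S0 i)"
  have "hsub M (cycles M)"
    unfolding hsub_def[OF M] using cycles_subspace[OF M] boundary_cycle[OF M] tpow_cycle[OF M, of _ _ _ 1] by auto
  then have "\<exists>J a b z. bar_basis M (cycles M) J a b z"
    by (rule ex_bar_basis[OF M _ fin, of _ S]) (use S0 span_superset in \<open>auto simp: S_def\<close>)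
  then obtain J a b z where B: "bar_basis M (cycles M) J a b z"
    by blast
  obtain f where f: "quasi_iso (barmod J a b) M f"
    using bar_basis_quasi_iso[OF M B] .
  have J: "finite J" "\<forall>j\<in>J. a j \<le> b j"
    using B unfolding bar_basis_def[OF M] by auto
  show thesis
    using that[OF J f] kproj_barmod[OF J] f M by (simp add: resolution_def)
qed

section \<open>Indecomposable objects and irreducible morphisms\<close>

lemma resolution_barmod:
  "finite J \<Longrightarrow> \<forall>j\<in>J. a j \<le> b j \<Longrightarrow> dg_module M \<Longrightarrow> quasi_iso (barmod J a b) M f \<Longrightarrow> resolution (barmod J a b) f M"
  by (simp add: resolution_def kproj_barmod)

lemma resolution_gid: "kproj K \<Longrightarrow> resolution K gid K"
  by (simp add: resolution_def kproj_dg quasi_iso_gid)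

definition bar_proj :: "nat set \<Rightarrow> int \<Rightarrow> 'v \<Rightarrow> 'v" where
  "bar_proj J i x = comb J (\<lambda>j. vc j x) (\<lambda>j. uc j x)"

lemma comb_extend:
  assumes "finite J" "J' \<subseteq> J" "\<And>j. j \<in> J - J' \<Longrightarrow> c j = 0 \<and> d j = 0"
  shows "comb J c d = comb J' c d"
  unfolding comb_def using assms by (intro sum.mono_neutral_right) auto

context
  fixes J J' :: "nat set" and a b :: "nat \<Rightarrow> int"
  assumes J: "finite J" and ab: "\<forall>j\<in>J. a j \<le> b j" and J': "J' \<subseteq> J"
begin

lemma sub_bars: "finite J'" "\<forall>j\<in>J'. a j \<le> b j"
  using J ab J' finite_subset by auto

lemma vc_outside:
  assumes "x \<in> gr (barmod J' a b) i" "j \<notin> J'"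
  shows "vc j x = 0" "uc j x = 0"
proof -
  have "x = comb J' (\<lambda>j. vc j x) (\<lambda>j. uc j x)"
    using assms(1) barmod_gr[OF sub_bars] by blast
  then show "vc j x = 0" "uc j x = 0"
    using comb_vc[OF sub_bars] comb_uc[OF sub_bars] assms(2) by metis+
qed

lemma chain_map_bar_incl: "chain_map (barmod J' a b) (barmod J a b) gid"
proof -
  have "x \<in> gr (barmod J a b) i \<and> dif (barmod J' a b) i x = dif (barmod J a b) i x"
    if x: "x \<in> gr (barmod J' a b) i" for x i
  proof -
    note o = vc_outside[OF x]
    have "x = comb J (\<lambda>j. vc j x) (\<lambda>j. uc j x)"
      using comb_extend[OF J J', of "\<lambda>j. vc j x" "\<lambda>j. uc j x"] o x by (simp add: barmod_gr[OF sub_bars])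
    moreover have "(vc j x \<noteq> 0 \<longrightarrow> a j \<le> i) \<and> (uc j x \<noteq> 0 \<longrightarrow> b j + 2 \<le> i)" for j
      using o x by (cases "j \<in> J'") (auto simp: barmod_gr[OF sub_bars])
    ultimately have "x \<in> gr (barmod J a b) i"
      unfolding barmod_gr[OF J ab] by blast
    moreover have "comb J (\<lambda>j. uc j x) (\<lambda>j. 0) = comb J' (\<lambda>j. uc j x) (\<lambda>j. 0)"
      by (rule comb_extend[OF J J']) (use o in auto)
    ultimately show ?thesis
      by (simp add: barmod_dif[OF J ab] barmod_dif[OF sub_bars])
  qed
  then show ?thesis
    by (auto simp: chain_map_def additive_on_def gid_def barmod_act[OF J ab] barmod_act[OF sub_bars])
qed

lemma chain_map_bar_proj: "chain_map (barmod J a b) (barmod J' a b) (bar_proj J')"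
  unfolding chain_map_def
proof (intro allI conjI ballI)
  fix i
  show "additive_on (gr (barmod J a b) i) (bar_proj J' i)"
    by (simp add: additive_on_def bar_proj_def comb_add)
  fix x assume x: "x \<in> gr (barmod J a b) i"
  show p: "bar_proj J' i x \<in> gr (barmod J' a b) i"
    unfolding bar_proj_def using x J' by (intro comb_gr[OF sub_bars]) (auto simp: barmod_gr[OF J ab])
  have "bar_proj J' (i - 1) (dif (barmod J a b) i x) \<in> gr (barmod J' a b) (i - 1)"
    unfolding bar_proj_def using barmod_dif_in[OF J ab x] J' by (intro comb_gr[OF sub_bars]) (auto simp: barmod_gr[OF J ab])
  moreover have "j \<in> J' \<Longrightarrow> j \<in> J" for j
    using J' by blast
  ultimately show "bar_proj J' (i - 1) (dif (barmod J a b) i x) = dif (barmod J' a b) i (bar_proj J' i x)"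
    using barmod_dif_in[OF sub_bars p] by (intro barmod_ext[OF sub_bars])
      (auto simp: bar_proj_def barmod_dif_coef[OF sub_bars] barmod_dif_coef[OF J ab] comb_vc[OF sub_bars] comb_uc[OF sub_bars])
  fix n and q :: "'k poly"
  show "bar_proj J' (i + int n) (act (barmod J a b) q i x) = act (barmod J' a b) q i (bar_proj J' i x)"
    by (simp add: barmod_act[OF J ab] barmod_act[OF sub_bars] bar_proj_def comb_scale)
qed

end

text \<open>All structure maps come from chain maps on bar modules, so the identities in
  \<open>direct_sum\<close> reduce to those between inclusions and coordinate projections.\<close>

lemma direct_sum_bars:
  assumes J: "finite J" "\<forall>j\<in>J. a j \<le> b j" and J12: "J = J1 \<union> J2" "J1 \<inter> J2 = {}"
    and res: "resolution (barmod J a b) k M"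
  shows "direct_sum (barmod J1 a b) (barmod J2 a b) M"
proof -
  note M = resolutionD[OF res]
  let ?K = "barmod J a b" let ?K' = "\<lambda>J'. barmod J' a b"
  let ?i = "\<lambda>J'. hclass (?K' J') gid (?K' J') M k" let ?p = "\<lambda>J'. hclass ?K k M (?K' J') (bar_proj J')"
  have sub: "resolution (?K' J') gid (?K' J')" "dg_module (?K' J')" if "J' \<subseteq> J" for J'
    using resolution_gid[OF kproj_barmod] sub_bars[OF J that] dg_module_barmod by blast+
  have k: "chain_map (?K' J') M k" if "J' \<subseteq> J" for J'
    using chain_map_comp[OF chain_map_bar_incl[OF J that] M(5)] by simp
  note p = chain_map_bar_proj[OF J]
  have ip: "?i J' \<in> dHom (?K' J') M" "?p J' \<in> dHom M (?K' J')" if "J' \<subseteq> J" for J'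
    using hclass_in_dHom[OF sub(1) M(3) k] hclass_in_dHom[OF res sub(2) p] that by blast+
  have pi: "dcomp (?K' J') M (?K' J'') (?p J'') (?i J') = hclass (?K' J') gid (?K' J') (?K' J'') (bar_proj J'')"
    if "J' \<subseteq> J" "J'' \<subseteq> J" for J' J''
    using dcomp_hclass[OF sub(1)[OF that(1)] res sub(2)[OF that(2)] k[OF that(1)] p[OF that(2)] chain_map_bar_incl[OF J that(1)]]
    by (simp add: homotopic_refl M)
  have pi1: "dcomp (?K' J') M (?K' J') (?p J') (?i J') = did (?K' J')" if "J' \<subseteq> J" for J'
  proof -
    have "homotopic (?K' J') (?K' J') (bar_proj J') gid"
      by (rule homotopic_of_eq[OF sub(2)[OF that]])
        (use barmod_gr[OF sub_bars[OF J that]] in \<open>auto simp: bar_proj_def gid_def\<close>)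
    then show ?thesis
      using hclass_homotopic[OF _ sub(2)] pi that did_eq_hclass[OF sub(1)] by simp
  qed
  have pi0: "dcomp (?K' J') M (?K' J'') (?p J'') (?i J') = dzero (?K' J') (?K' J'')"
    if "J' \<subseteq> J" "J'' \<subseteq> J" "J' \<inter> J'' = {}" for J' J''
  proof -
    have "bar_proj J'' i x = 0" if "x \<in> gr (?K' J') i" for i x
    proof -
      have "vc j x = 0 \<and> uc j x = 0" if "j \<in> J''" for j
        using vc_outside[OF J \<open>J' \<subseteq> J\<close> \<open>x \<in> gr (?K' J') i\<close>] that \<open>J' \<inter> J'' = {}\<close> by blast
      then show ?thesis
        by (simp add: bar_proj_def comb_def)
    qed
    then have "homotopic (?K' J') (?K' J'') (bar_proj J'') (\<lambda>i x. 0)"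
      by (intro homotopic_of_eq[OF sub(2)[OF that(2)]])
    then show ?thesis
      using hclass_homotopic[OF _ sub(2)] pi that dzero_eq_hclass[OF sub(1) sub(2)] by simp
  qed
  have kp: "dcomp M (?K' J') M (?i J') (?p J') = hclass ?K k M M (k \<odot> bar_proj J')" if "J' \<subseteq> J" for J'
    using dcomp_hclass[OF res sub(1)[OF that] M(3) p[OF that] k[OF that] p[OF that]]
    by (simp add: homotopic_refl sub that)
  have J1: "J1 \<subseteq> J" and J2: "J2 \<subseteq> J"
    using J12 by auto
  have kp': "chain_map ?K M (k \<odot> bar_proj J')" if "J' \<subseteq> J" for J'
    using chain_map_comp[OF p k] that by blast
  have "homotopic ?K M (\<lambda>i x. (k \<odot> bar_proj J1) i x + (k \<odot> bar_proj J2) i x) k"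
  proof (rule homotopic_of_eq[OF M(3)])
    fix i x assume x: "x \<in> gr ?K i"
    have "bar_proj J1 i x \<in> gr ?K i" "bar_proj J2 i x \<in> gr ?K i"
      using chain_map_in[OF chain_map_bar_incl[OF J] chain_map_in[OF p x]] J1 J2 by (auto simp: gid_def)
    then have "(k \<odot> bar_proj J1) i x + (k \<odot> bar_proj J2) i x = k i (bar_proj J1 i x + bar_proj J2 i x)"
      by (simp add: gcomp_def chain_map_add[OF M(5)])
    also have "bar_proj J1 i x + bar_proj J2 i x = comb J (\<lambda>j. vc j x) (\<lambda>j. uc j x)"
      unfolding bar_proj_def comb_def J12(1) using J(1) J12 by (intro sum.union_disjoint[symmetric]) auto
    also have "\<dots> = x"
      using x barmod_gr[OF J] by metis
    finally show "(k \<odot> bar_proj J1) i x + (k \<odot> bar_proj J2) i x = k i x" .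
  qed
  then have "dadd M M (dcomp M (?K' J1) M (?i J1) (?p J1)) (dcomp M (?K' J2) M (?i J2) (?p J2)) = did M"
    using dadd_hclass[OF res M(3) kp'[OF J1] kp'[OF J2]] hclass_homotopic[OF _ M(3)] did_eq_hclass[OF res]
    by (simp add: kp J1 J2)
  moreover have "J2 \<inter> J1 = {}"
    using J12(2) by blast
  ultimately show ?thesis
    unfolding direct_sum_def using ip[OF J1] ip[OF J2] pi1[OF J1] pi1[OF J2] pi0[OF J1 J2 J12(2)] pi0[OF J2 J1]
    by blast
qed

section \<open>Single bars and indecomposable objects\<close>

definition bar :: "int \<Rightarrow> int \<Rightarrow> ('k, 'v) dgmod" where
  "bar a b = barmod {0} (\<lambda>j. a) (\<lambda>j. b)"

text \<open>Stated by a quasi-isomorphism out of the bar, rather than an isomorphism in the derived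
  category, so that it provides a K-projective resolution at once.\<close>

definition is_bar :: "('k, 'v) dgmod \<Rightarrow> int \<Rightarrow> int \<Rightarrow> bool" where
  "is_bar M a b \<longleftrightarrow> M \<in> Df \<and> a \<le> b \<and> (\<exists>f. quasi_iso (bar a b) M f)"

lemma is_barE:
  assumes "is_bar M a b"
  obtains f where "resolution (bar a b) f M" "a \<le> b"
  using assms resolution_barmod[of "{0}" "\<lambda>j. a" "\<lambda>j. b" M] by (auto simp: is_bar_def Df_dg bar_def)

lemma bar_dg: "a \<le> b \<Longrightarrow> dg_module (bar a b)"
  and bar_Df: "a \<le> b \<Longrightarrow> bar a b \<in> Df"
  and bar_resolution: "a \<le> b \<Longrightarrow> resolution (bar a b) gid (bar a b)"
  by (simp_all add: bar_def dg_module_barmod barmod_Df resolution_gid kproj_barmod)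

lemma bar_vgen: "a \<le> b \<Longrightarrow> a \<le> i \<Longrightarrow> vgen 0 \<in> cycles (bar a b) i"
  and bar_vgen_boundary: "a \<le> b \<Longrightarrow> a \<le> i \<Longrightarrow> vgen 0 \<in> boundaries (bar a b) i \<longleftrightarrow> b < i"
  unfolding bar_def by (simp_all add: vgen_cycle vgen_boundary)

lemma bar_acyclic: "a \<le> b \<Longrightarrow> acyclic_at (bar a b) i \<longleftrightarrow> \<not> (a \<le> i \<and> i \<le> b)"
  unfolding bar_def by (simp add: barmod_acyclic_at)

lemma is_bar_acyclic:
  assumes "is_bar M a b"
  shows "acyclic_at M i \<longleftrightarrow> \<not> (a \<le> i \<and> i \<le> b)"
  using assms quasi_iso_acyclic[OF bar_dg, of a b M] bar_acyclic[of a b i] by (auto simp: is_bar_def Df_dg)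

lemma bar_cycle:
  assumes "a \<le> b" "x \<in> cycles (bar a b) i"
  obtains c where "x = scale c (vgen 0)" "c \<noteq> 0 \<longrightarrow> a \<le> i"
proof -
  have J: "finite {0::nat}" "\<forall>j\<in>{0::nat}. a \<le> b" using assms by auto
  have "x = comb {0} (\<lambda>j. vc j x) (\<lambda>j. uc j x)" "uc 0 x = 0" "vc 0 x \<noteq> 0 \<longrightarrow> a \<le> i"
    using assms(2) unfolding bar_def barmod_cycles[OF J] barmod_gr[OF J] by auto
  then show thesis
    using that[of "vc 0 x"] by (simp add: comb_def)
qed

lemma isomorphic_of_is_bar: "is_bar M a b \<Longrightarrow> is_bar N a b \<Longrightarrow> isomorphic M N"
  by (metis is_barE d_iso_of_resolutions isomorphic_def)

text \<open>The bar with index \<open>j\<close> in a sum uses the basis vectors with index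
  \<open>j\<close>, whereas \<open>bar\<close> always uses index 0; this moves between the
  two.\<close>

lemma quasi_iso_bar_singleton:
  assumes "a j \<le> b j"
  obtains f where "quasi_iso (bar (a j) (b j)) (barmod {j} a b) f"
proof -
  let ?N = "barmod {j} a b" let ?K = "bar (a j) (b j)"
  have J: "finite {j}" "\<forall>j\<in>{j}. a j \<le> b j" and J0: "finite {0::nat}" "\<forall>l\<in>{0::nat}. a j \<le> b j"
    using assms by auto
  note N = dg_module_barmod[OF J]
  define f where "f = bar_map {0} (\<lambda>l. a j) (\<lambda>l. b j) ?N 0 (\<lambda>l. vgen j) (\<lambda>l. ugen j)"
  have f: "chain_map ?K ?N f"
    unfolding f_def bar_def
    by (rule chain_map_bar_map[OF J0 N]) (use vgen_cycle[OF J] ugen_gr[OF J] dif_ugen[OF J] sg_cong[of "b j + 2" "b j"] in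
      \<open>simp_all add: barmod_tpow[OF J]\<close>)
  have f_eq: "f i x = scale (vc 0 x) (vgen j) + scale (uc 0 x) (ugen j)" for i x
    by (simp add: f_def bar_map_def[OF J0] barmod_tpow[OF J])
  have "quasi_iso ?K ?N f"
    unfolding quasi_iso_def
  proof (intro conjI allI ballI impI)
    show "chain_map ?K ?N f" by (rule f)
    fix i
    show "x \<in> boundaries ?K i" if "x \<in> cycles ?K i" "f i x \<in> boundaries ?N i" for x
      using that unfolding bar_def barmod_boundaries[OF J] barmod_boundaries[OF J0] barmod_cycles[OF J0]
      by (auto simp: f_eq)
    show "\<exists>x\<in>cycles ?K i. y - f i x \<in> boundaries ?N i" if y: "y \<in> cycles ?N i" for y
    proof
      let ?x = "scale (vc j y) (vgen 0)"
      have y': "y = scale (vc j y) (vgen j)" "vc j y \<noteq> 0 \<longrightarrow> a j \<le> i"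
        using y barmod_cycles[OF J] barmod_gr[OF J] by (auto simp: comb_def)
      then have "y - f i ?x = 0"
        by (simp add: f_eq)
      then show "y - f i ?x \<in> boundaries ?N i"
        using boundary_0[OF N] by simp
      show "?x \<in> cycles ?K i"
        using y'(2) bar_vgen[OF assms] cycle_scale[OF bar_dg[OF assms]] cycle_0[OF bar_dg[OF assms]]
        by (cases "vc j y = 0") auto
    qed
  qed
  then show thesis by (rule that)
qed

text \<open>If one bar of a decomposition is split off, indecomposability makes the rest a zero
  object, and a nonempty family of bars has homology.\<close>

lemma indecomposable_is_bar:
  assumes "indecomposable M"
  obtains a b where "is_bar M a b"
proof -
  have M: "M \<in> Df" "\<not> zero_object M" and
    ind: "\<And>A B. A \<in> Df \<Longrightarrow> B \<in> Df \<Longrightarrow> direct_sum A B M \<Longrightarrow> zero_object A \<or> zero_object B"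
    using assms by (auto simp: indecomposable_def)
  obtain J a b k where J: "finite J" "\<forall>j\<in>J. a j \<le> b j" and k: "quasi_iso (barmod J a b) M k" and res: "resolution (barmod J a b) k M"
    using Df_resolution[OF M(1)] .
  note K = dg_module_barmod[OF J]
  obtain i where "\<not> acyclic_at M i"
    using M zero_object_iff Df_dg by blast
  then have "\<not> acyclic_at (barmod J a b) i"
    using quasi_iso_acyclic[OF K Df_dg[OF M(1)] k] by blast
  then obtain j where j: "j \<in> J"
    using barmod_acyclic_at[OF J] by blast
  have *: "barmod J' a b \<in> Df" "zero_object (barmod J' a b) \<longleftrightarrow> J' = {}" if "J' \<subseteq> J" for J'
  proof -
    note J' = sub_bars[OF J that]
    show "barmod J' a b \<in> Df"
      by (rule barmod_Df[OF J'])
    show "zero_object (barmod J' a b) \<longleftrightarrow> J' = {}"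
      unfolding zero_object_iff[OF dg_module_barmod[OF J']] barmod_acyclic_at[OF J'] using J'(2) by auto
  qed
  have "direct_sum (barmod {j} a b) (barmod (J - {j}) a b) M"
    by (rule direct_sum_bars[OF J _ _ res]) (use j in auto)
  then have "J - {j} = {}"
    using ind[of "barmod {j} a b" "barmod (J - {j}) a b"] *[of "{j}"] *[of "J - {j}"] j by auto
  then have Jj: "J = {j}" using j by auto
  have abj: "a j \<le> b j" using J j by blast
  obtain f where "quasi_iso (bar (a j) (b j)) (barmod {j} a b) f"
    using quasi_iso_bar_singleton[of a j b, OF abj] .
  then have "quasi_iso (bar (a j) (b j)) M (k \<odot> f)"
    using quasi_iso_comp[OF bar_dg[OF abj] K Df_dg[OF M(1)] _ k] Jj by blast
  then show thesis
    using that abj M(1) by (auto simp: is_bar_def)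
qed

text \<open>The homology of a bar is at most one-dimensional in each degree.\<close>

lemma is_bar_cycle:
  assumes "resolution (bar c d) g N" "c \<le> d" "y \<in> cycles N i"
  obtains r where "y - scale r (g i (vgen 0)) \<in> boundaries N i" "r \<noteq> 0 \<longrightarrow> c \<le> i"
proof -
  note N = resolutionD[OF assms(1)]
  obtain x where x: "x \<in> cycles (bar c d) i" "y - g i x \<in> boundaries N i"
    using quasi_iso_surj[OF N(4) assms(3)] .
  obtain r where r: "x = scale r (vgen 0)" "r \<noteq> 0 \<longrightarrow> c \<le> i"
    using bar_cycle[OF assms(2) x(1)] .
  have "g i x = scale r (g i (vgen 0))"
  proof (cases "r = 0")
    case True
    then show ?thesis using r chain_map_0[OF N(2,5)] by simp
  next
    case False
    then show ?thesis
      using r chain_map_scale[OF N(2,3,5) cycle_gr[OF N(2) bar_vgen[OF assms(2)]]] by simp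
  qed
  then show thesis
    using that x r by metis
qed

lemma bar_tpow: "a \<le> b \<Longrightarrow> tpow (bar a b) n i x = x"
  by (simp add: bar_def barmod_tpow)

lemma chain_map_vgen:
  assumes "a \<le> b" "chain_map (bar a b) N f" "a \<le> i" "j = i + int n"
  shows "f j (vgen 0) = tpow N n i (f i (vgen 0))"
  using chain_map_tpow[OF assms(2) cycle_gr[OF bar_dg bar_vgen] assms(4)] assms by (simp add: bar_tpow)

section \<open>Irreducible morphisms between bars\<close>

text \<open>
  The inclusion \<open>bar a b \<rightarrow> bar (a - 1) b\<close>, the identity on underlying vectors, sends the generator to \<open>T\<close>
  times the generator. So a map extends along it if the class of the image of the generator is
  divisible by \<open>T\<close>.
\<close>

lemma extend_bar_map:
  assumes ab: "a \<le> b" and N: "dg_module N" and f: "chain_map (bar a b) N f"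
    and z': "z' \<in> cycles N (a - 1)" "f a (vgen 0) - tpow N 1 (a - 1) z' \<in> boundaries N a"
  obtains g where "chain_map (bar (a - 1) b) N g" "homotopic (bar a b) N g f" "chain_map (bar a b) (bar (a - 1) b) gid"
    "g (a - 1) (vgen 0) = z'"
proof -
  let ?z = "f a (vgen 0)" let ?w = "f (b + 2) (ugen 0)"
  define r where "r = nat (b + 1 - a)"
  have r: "b + 1 = a + int r" "b + 2 = a + 1 + int r" "nat (b + 1 - (a - 1)) = r + 1"
    using ab by (simp_all add: r_def)
  have J: "finite {0::nat}" "\<forall>j\<in>{0::nat}. a \<le> b" "\<forall>j\<in>{0::nat}. a - 1 \<le> b"
    using ab by auto
  have z: "?z \<in> cycles N a"
    using chain_map_cycle[OF bar_dg[OF ab] f bar_vgen[OF ab]] by simp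
  have w: "?w \<in> gr N (b + 2)" "dif N (b + 2) ?w = sg b (tpow N r a ?z)"
    using chain_map_in[OF f[unfolded bar_def] ugen_gr[OF J(1,2)]] dif_chain_map_ugen[OF J(1,2) f[unfolded bar_def]]
    by (simp_all add: r_def)
  obtain p where p: "p \<in> gr N (a + 1)" "?z - tpow N 1 (a - 1) z' = dif N (a + 1) p"
    using z'(2) by (rule boundariesE[OF N])
  have Tp: "tpow N r (a + 1) p \<in> gr N (b + 2)"
    using tpow_in'[OF N p(1) r(2)] .
  \<comment> \<open>Up to sign, \<open>?w\<close> bounds \<open>T^r\<close> times \<open>?z\<close>,
    while the longer bar needs a chain bounding \<open>T^r\<close> times \<open>T z'\<close>. The
    two multiples differ by \<open>T^r\<close> times the boundary of \<open>p\<close>, which gives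
    the correction.\<close>
  define w' where "w' = ?w - sg (a + 1) (tpow N r (a + 1) p)"
  have w'_in: "w' \<in> gr N (b + 2)"
    by (simp add: w'_def gr_diff[OF N] w gr_sg[OF N Tp])
  have Tz'_in: "tpow N 1 (a - 1) z' \<in> gr N a"
    by (rule tpow_in'[OF N cycle_gr[OF N z'(1)]]) simp
  have "dif N (b + 2) (sg (a + 1) (tpow N r (a + 1) p)) = sg b (tpow N r a (dif N (a + 1) p))"
  proof -
    have "sg (a + 1 + int r) y = sg b y" for y
      using ab by (intro sg_cong) (simp add: r_def)
    then show ?thesis
      using dif_tpow[OF N p(1) r(2)] by (simp add: dif_sg[OF N Tp])
  qed
  then have "dif N (b + 2) w' = sg b (tpow N r a ?z) - sg b (tpow N r a (dif N (a + 1) p))"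
    by (simp add: w'_def dif_diff[OF N w(1) gr_sg[OF N Tp]] w(2))
  also have "\<dots> = sg b (tpow N r a (tpow N 1 (a - 1) z'))"
    unfolding p(2)[symmetric] tpow_diff[OF N cycle_gr[OF N z] Tz'_in] by simp
  also have "\<dots> = sg b (tpow N (r + 1) (a - 1) z')"
    using tpow_tpow[OF N cycle_gr[OF N z'(1)], of a 1 r] by simp
  finally have dw': "dif N (b + 2) w' = sg b (tpow N (nat (b + 1 - (a - 1))) (a - 1) z')"
    by (simp only: r(3))
  define g where "g = bar_map {0} (\<lambda>j. a - 1) (\<lambda>j. b) N 0 (\<lambda>j. z') (\<lambda>j. w')"
  have g: "chain_map (bar (a - 1) b) N g"
    unfolding g_def bar_def by (rule chain_map_bar_map[OF J(1,3) N]) (use z' w'_in dw' in auto)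
  have ab': "a - 1 \<le> b" using ab by simp
  have incl: "chain_map (bar a b) (bar (a - 1) b) gid"
    unfolding bar_def chain_map_def additive_on_def gid_def
    by (auto simp: barmod_gr[OF J(1,2)] barmod_gr[OF J(1,3)] barmod_dif[OF J(1,2)] barmod_dif[OF J(1,3)]
        barmod_act[OF J(1,2)] barmod_act[OF J(1,3)])
  have gz: "g (a - 1) (vgen 0) = z'"
    unfolding g_def using bar_map_vgen[OF J(1,3) N, of 0] cycle_gr[OF N z'(1)] by simp
  then have gv: "g a (vgen 0) = tpow N 1 (a - 1) z'"
    using chain_map_vgen[OF ab' g, of "a - 1" a 1] by simp
  have gu: "g (b + 2) (ugen 0) = w'"
    unfolding g_def using bar_map_ugen[OF J(1,3) N, of 0] w'_in by simp
  have g': "chain_map (bar a b) N g"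
    using chain_map_comp[OF incl g] by simp
  have "homotopic (bar a b) N f g"
    unfolding bar_def
    by (rule homotopic_barI[OF J(1,2) N f[unfolded bar_def] g'[unfolded bar_def], of "\<lambda>j. p" "\<lambda>j. 0"])
      (use p in \<open>simp_all add: gv gu w'_def gr_0[OF N] dif_0[OF N] r_def\<close>)
  then show thesis
    using that g incl gz homotopic_sym[OF N] by blast
qed

text \<open>\<open>F\<close> factors through \<open>bar (a - 1) b\<close> as \<open>H\<close>
  followed by \<open>G\<close>. Since \<open>H\<close> is not a split monomorphism, irreducibility
  makes \<open>G\<close> a split epimorphism. Then \<open>N\<close> is a retract of
  \<open>bar (a - 1) b\<close>, and comparing the degrees where the generators begin and die gives
  the two equations.\<close>

lemma irreducible_bar_divisible:
  assumes M: "is_bar M a b" and N: "is_bar N c d" and F: "irreducible_mor M N F"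
    and k: "resolution (bar a b) k M" and f: "chain_map (bar a b) N f" "F = hclass (bar a b) k M N f"
    and z': "z' \<in> cycles N (a - 1)" "f a (vgen 0) - tpow N 1 (a - 1) z' \<in> boundaries N a"
  shows "c = a - 1 \<and> d = b"
proof -
  obtain g where g: "resolution (bar c d) g N" and cd: "c \<le> d"
    using N by (rule is_barE)
  have ab: "a \<le> b" "a - 1 \<le> b" using M by (auto simp: is_bar_def)
  note dgM = resolutionD[OF k] and dgN = resolutionD[OF g]
  let ?L = "bar (a - 1) b"
  note L = bar_dg[OF ab(2)] and Lr = bar_resolution[OF ab(2)]
  obtain e where e: "chain_map ?L N e" "homotopic (bar a b) N e f" "chain_map (bar a b) ?L gid" "e (a - 1) (vgen 0) = z'"
    using extend_bar_map[OF ab(1) dgN(3) f(1) z'] by blast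
  define H where "H = hclass (bar a b) k M ?L gid"
  define G where "G = dmap ?L N e"
  have H: "H \<in> dHom M ?L"
    unfolding H_def by (rule hclass_in_dHom[OF k L e(3)])
  have G: "G \<in> dHom ?L N"
    unfolding G_def by (rule dmap_in_dHom[OF L e(1)])
  have "homotopic (bar a b) ?L (gid \<odot> gid) gid"
    by (simp add: homotopic_refl[OF L])
  then have "dcomp M ?L N G H = hclass (bar a b) k M N e"
    using dcomp_hclass[OF k Lr dgN(3) e(3,1,3)]
    by (simp add: G_def H_def dmap_eq_hclass[OF Lr dgN(3) e(1)])
  also have "\<dots> = F"
    using hclass_homotopic[OF e(2) dgN(3)] f(2) by simp
  finally have GH: "dcomp M ?L N G H = F" .
  \<comment> \<open>Under \<open>H\<close> the bottom class of \<open>M\<close> becomes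
    \<open>T\<close> times a class of degree \<open>a - 1\<close>. A retraction would carry it to
    \<open>T\<close> times a class of \<open>M\<close> in degree \<open>a - 1\<close>, where
    \<open>M\<close> has no homology, although it has to return a nonzero class.\<close>
  have "\<not> split_mono M ?L H"
  proof
    assume "split_mono M ?L H"
    then obtain G' where G': "G' \<in> dHom ?L M" "dcomp M ?L M G' H = did M"
      by (auto simp: split_mono_def)
    have v: "vgen 0 \<in> cycles ?L (a - 1)" "vgen 0 \<in> cycles (bar a b) a"
      using bar_vgen ab by simp_all
    obtain y where y: "(vgen 0, y) \<in> hgraph ?L M G' (a - 1)"
      using hgraph_total[OF L dgM(3) G'(1) v(1)] .
    then have yB: "y \<in> boundaries M (a - 1)"
      using hgraph_cycles[OF L dgM(3) G'(1)] is_bar_acyclic[OF M, of "a - 1"] by (auto simp: acyclic_at_def)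
    have "(vgen 0, tpow M 1 (a - 1) y) \<in> hgraph ?L M G' a"
      using hgraph_tpow[OF L dgM(3) G'(1) y, of a 1] by (simp add: bar_tpow[OF ab(2)])
    moreover have "(k a (vgen 0), vgen 0) \<in> hgraph M ?L H a"
      using hgraph_hclass[OF k L e(3) v(2)] by (simp add: H_def gid_def)
    ultimately have "(k a (vgen 0), tpow M 1 (a - 1) y) \<in> hgraph M M (did M) a"
      using hgraph_dcomp[OF dgM(3) L dgM(3) H G'(1) did_in_dHom[OF dgM(3)] G'(2)] by blast
    then have "tpow M 1 (a - 1) y - k a (vgen 0) \<in> boundaries M a"
      using hgraph_did[OF dgM(3)] by blast
    then have "k a (vgen 0) \<in> boundaries M a"
      using boundary_cong[OF dgM(3)] tpow_boundary[OF dgM(3) yB, of a 1] by simp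
    then show False
      using quasi_iso_inj[OF dgM(4) v(2)] bar_vgen_boundary[OF ab(1), of a] ab by simp
  qed
  moreover have "?L \<in> Df"
    by (rule bar_Df[OF ab(2)])
  ultimately have "split_epi ?L N G"
    using F H G GH unfolding irreducible_mor_def by blast
  then obtain G' where G': "G' \<in> dHom N ?L" "dcomp N ?L N G G' = did N"
    by (auto simp: split_epi_def)
  define n where "n = (\<lambda>i. g i (vgen 0))"
  have v: "vgen 0 \<in> cycles (bar c d) i" if "c \<le> i" for i
    using bar_vgen cd that by simp
  have nc: "n i \<in> cycles N i" "n i \<in> boundaries N i \<longleftrightarrow> d < i" if "c \<le> i" for i
  proof -
    show "n i \<in> cycles N i"
      using chain_map_cycle[OF dgN(2,5) v[OF that]] by (simp add: n_def)
    show "n i \<in> boundaries N i \<longleftrightarrow> d < i"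
      using bar_vgen_boundary[OF cd that] quasi_iso_inj[OF dgN(4) v[OF that]] chain_map_boundary[OF dgN(5)]
      by (auto simp: n_def)
  qed
  obtain l where l: "(n c, l) \<in> hgraph N ?L G' c"
    using hgraph_total[OF dgN(3) L G'(1) nc(1)[OF order_refl]] .
  have lc: "l \<in> cycles ?L c"
    using hgraph_cycles[OF dgN(3) L G'(1) l] by blast
  obtain r where r: "l = scale r (vgen 0)" "r \<noteq> 0 \<longrightarrow> a - 1 \<le> c"
    using bar_cycle[OF ab(2) lc] .
  have l_i: "(n i, l) \<in> hgraph N ?L G' i" if "c \<le> i" for i
    using hgraph_tpow[OF dgN(3) L G'(1) l, of i "nat (i - c)"] that chain_map_vgen[OF cd dgN(5), of c i "nat (i - c)"]
    by (simp add: bar_tpow[OF ab(2)] n_def)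
  have l_cyc: "l \<in> cycles ?L i" if "c \<le> i" for i
    using hgraph_cycles[OF dgN(3) L G'(1) l_i[OF that]] by blast
  have e_l: "e i l - n i \<in> boundaries N i" if "c \<le> i" for i
  proof -
    have "(l, e i l) \<in> hgraph ?L N G i"
      unfolding G_def hgraph_dmap[OF L dgN(3) e(1)]
      using l_cyc[OF that] chain_map_cycle[OF L e(1) l_cyc[OF that]] boundary_0[OF dgN(3)] by simp
    then have "(n i, e i l) \<in> hgraph N N (did N) i"
      using hgraph_dcomp[OF dgN(3) L dgN(3) G'(1) G did_in_dHom[OF dgN(3)] G'(2) l_i[OF that]] by blast
    then show ?thesis
      using hgraph_did[OF dgN(3)] by blast
  qed
  \<comment> \<open>The section \<open>G'\<close> takes the class of \<open>n i\<close> to that of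
    \<open>l\<close>, and \<open>G\<close> takes it back, so both vanish in the same degrees. As
    \<open>l\<close> turns out to be a nonzero multiple of the generator of \<open>?L\<close>, the
    upper ends \<open>d\<close> and \<open>b\<close> coincide.\<close>
  have l_bound: "l \<in> boundaries ?L i \<longleftrightarrow> d < i" if "c \<le> i" for i
  proof
    assume "l \<in> boundaries ?L i"
    then have "e i l \<in> boundaries N i"
      by (rule chain_map_boundary[OF e(1)])
    then show "d < i"
      using boundary_cong[OF dgN(3) e_l[OF that]] nc(2)[OF that] by blast
  next
    assume "d < i"
    then have "n i - 0 \<in> boundaries N i"
      using nc(2)[OF that] by simp
    then have "l - 0 \<in> boundaries ?L i"
      using hgraph_functional[OF dgN(3) L G'(1) l_i[OF that] hgraph_0[OF dgN(3) L G'(1)]] by blast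
    then show "l \<in> boundaries ?L i" by simp
  qed
  have "r \<noteq> 0"
    using l_bound[of c] cd boundary_0[OF L] r(1) by auto
  then have ac: "a - 1 \<le> c"
    using r(2) by blast
  have l_bound': "l \<in> boundaries ?L i \<longleftrightarrow> b < i" if "c \<le> i" for i
  proof -
    have "vgen 0 = scale (1 / r) l"
      using \<open>r \<noteq> 0\<close> r(1) by simp
    then have "l \<in> boundaries ?L i \<longleftrightarrow> vgen 0 \<in> boundaries ?L i"
      using boundary_scale[OF L] r(1) by metis
    then show ?thesis
      using bar_vgen_boundary[OF ab(2)] that ac by simp
  qed
  have "d = b"
  proof (rule antisym)
    show "d \<le> b"
      using l_bound[of d] l_bound'[of d] cd by (meson not_le order_refl less_irrefl)
    have "c \<le> b"
      using l_bound[of c] l_bound'[of c] cd by auto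
    then show "b \<le> d"
      using l_bound[of b] l_bound'[of b] by (meson not_le order_refl less_irrefl)
  qed
  \<comment> \<open>If \<open>N\<close> started later, \<open>z'\<close> would be a boundary, and so
    would the image of \<open>l\<close> under \<open>e\<close> in degree \<open>c\<close>; but this
    image represents the bottom class of \<open>N\<close>.\<close>
  moreover have "c = a - 1"
  proof (rule ccontr)
    assume "c \<noteq> a - 1"
    then have ac': "a - 1 < c" using ac by simp
    then have "z' \<in> boundaries N (a - 1)"
      using z'(1) is_bar_acyclic[OF N, of "a - 1"] by (auto simp: acyclic_at_def)
    then have "tpow N (nat (c - (a - 1))) (a - 1) z' \<in> boundaries N c"
      by (rule tpow_boundary[OF dgN(3)]) (use ac' in simp)
    then have "e c (vgen 0) \<in> boundaries N c"
      using chain_map_vgen[OF ab(2) e(1), of "a - 1" c "nat (c - (a - 1))"] ac' e(4) by simp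
    then have "e c l \<in> boundaries N c"
      using boundary_scale[OF dgN(3)] chain_map_scale[OF L dgN(3) e(1) cycle_gr[OF L bar_vgen[OF ab(2) ac]]] r(1) by simp
    then show False
      using boundary_cong[OF dgN(3) e_l[of c]] nc(2)[of c] cd by simp
  qed
  ultimately show ?thesis by blast
qed

text \<open>The image of the bottom class is nonzero, so it is a nonzero multiple, by
  \<open>r\<close>, of the class of \<open>N\<close> in degree \<open>a\<close>, and
  \<open>c < a\<close> would make it divisible. Hence \<open>f\<close> acts on homology like
  \<open>r\<close> times the resolution of \<open>N\<close>. The relation at \<open>ugen 0\<close>
  then gives \<open>d \<le> b\<close>, and equality would make \<open>F\<close> an isomorphism,
  which no irreducible morphism is.\<close>

lemma irreducible_bar_indivisible:
  assumes M: "is_bar M a b" and N: "is_bar N c d" and F: "irreducible_mor M N F"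
    and k: "resolution (bar a b) k M" and f: "chain_map (bar a b) N f" "F = hclass (bar a b) k M N f"
    and z': "\<And>z'. z' \<in> cycles N (a - 1) \<Longrightarrow> f a (vgen 0) - tpow N 1 (a - 1) z' \<notin> boundaries N a"
  shows "c = a \<and> d < b"
proof -
  obtain g where g: "resolution (bar c d) g N" and cd: "c \<le> d"
    using N by (rule is_barE)
  have ab: "a \<le> b" using M by (auto simp: is_bar_def)
  note dgM = resolutionD[OF k] and dgN = resolutionD[OF g]
  have va: "vgen 0 \<in> cycles (bar a b) i" if "a \<le> i" for i
    using bar_vgen ab that by simp
  have vc: "vgen 0 \<in> cycles (bar c d) i" if "c \<le> i" for i
    using bar_vgen cd that by simp
  note ng = cycle_gr[OF dgN(3) chain_map_cycle[OF dgN(2,5) vc]]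
  define z where "z = f a (vgen 0)"
  have z: "z \<in> cycles N a"
    unfolding z_def by (rule chain_map_cycle[OF dgM(2) f(1) va]) simp
  have zB: "z \<notin> boundaries N a"
    using z'[OF cycle_0[OF dgN(3)]] by (simp add: tpow_0[OF dgN(3)] z_def)
  obtain r where r: "z - scale r (g a (vgen 0)) \<in> boundaries N a" "r \<noteq> 0 \<longrightarrow> c \<le> a"
    using is_bar_cycle[OF g cd z] .
  have "r \<noteq> 0"
    using r(1) zB by auto
  then have ca: "c \<le> a" using r by blast
  have "c = a"
  proof (rule ccontr)
    assume "c \<noteq> a"
    then have ca': "c \<le> a - 1" using ca by simp
    have "tpow N 1 (a - 1) (scale r (g (a - 1) (vgen 0))) = scale r (g a (vgen 0))"
      using chain_map_vgen[OF cd dgN(5) ca', of a 1] by (simp add: tpow_scale[OF dgN(3) ng[OF ca']])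
    moreover have "scale r (g (a - 1) (vgen 0)) \<in> cycles N (a - 1)"
      using cycle_scale[OF dgN(3) chain_map_cycle[OF dgN(2,5) vc[OF ca']]] .
    ultimately show False
      using z' r(1) z_def by metis
  qed
  have fg: "f i x - scale r (g i x) \<in> boundaries N i" if x: "x \<in> cycles (bar a b) i" for x i
  proof -
    obtain q where q: "x = scale q (vgen 0)" "q \<noteq> 0 \<longrightarrow> a \<le> i"
      using bar_cycle[OF ab x] .
    show ?thesis
    proof (cases "q = 0")
      case True
      then show ?thesis
        using q boundary_0[OF dgN(3)] chain_map_0[OF dgN(2,5)] chain_map_0[OF dgM(2) f(1)] by simp
    next
      case False
      then have ai: "a \<le> i" using q by blast
      then have ci: "c \<le> i" using ca by simp
      have "f i (vgen 0) - scale r (g i (vgen 0)) = tpow N (nat (i - a)) a (z - scale r (g a (vgen 0)))"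
        using chain_map_vgen[OF ab f(1), of a i "nat (i - a)"] chain_map_vgen[OF cd dgN(5) ca, of i "nat (i - a)"] ai
        by (simp add: z_def[symmetric] tpow_diff[OF dgN(3) cycle_gr[OF dgN(3) z] gr_scale[OF dgN(3) ng[OF ca]]] tpow_scale[OF dgN(3) ng[OF ca]])
      then have "f i (vgen 0) - scale r (g i (vgen 0)) \<in> boundaries N i"
        using tpow_boundary[OF dgN(3) r(1), of i "nat (i - a)"] ai by simp
      then have "scale q (f i (vgen 0) - scale r (g i (vgen 0))) \<in> boundaries N i"
        by (rule boundary_scale[OF dgN(3)])
      moreover have "f i x = scale q (f i (vgen 0))" "g i x = scale q (g i (vgen 0))"
        using chain_map_scale[OF dgM(2) dgN(3) f(1) cycle_gr[OF dgM(2) va[OF ai]]]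
          chain_map_scale[OF dgN(2,3,5) cycle_gr[OF dgN(2) vc[OF ci]]] q(1) by simp_all
      ultimately show ?thesis
        by (simp add: scale_right_diff_distrib mult.commute)
    qed
  qed
  have gB: "g i y \<in> boundaries N i" if "scale r (g i y) \<in> boundaries N i" for i y
    using boundary_scale[OF dgN(3) that, of "1 / r"] \<open>r \<noteq> 0\<close> by simp
  have "d \<le> b"
  proof (rule ccontr)
    assume "\<not> d \<le> b"
    then have bd: "b + 1 \<le> d" by simp
    have J: "finite {0::nat}" "\<forall>j\<in>{0::nat}. a \<le> b" using ab by auto
    have w: "f (b + 2) (ugen 0) \<in> gr N (b + 1 + 1)"
      using chain_map_in[OF f(1)[unfolded bar_def] ugen_gr[OF J]] by (simp add: add.assoc)
    have "dif N (b + 2) (f (b + 2) (ugen 0)) = sg b (f (b + 1) (vgen 0))"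
      using dif_chain_map_ugen[OF J f(1)[unfolded bar_def], of 0] chain_map_vgen[OF ab f(1), of a "b + 1" "nat (b + 1 - a)"] ab
      by simp
    then have "sg b (f (b + 1) (vgen 0)) \<in> boundaries N (b + 1)"
      using boundariesI[OF dgN(3) w] by (simp add: add.assoc)
    then have "f (b + 1) (vgen 0) \<in> boundaries N (b + 1)"
      using boundary_neg[OF dgN(3), of "- f (b + 1) (vgen 0)"] by (auto simp: sg_def split: if_splits)
    then have "scale r (g (b + 1) (vgen 0)) \<in> boundaries N (b + 1)"
      using boundary_cong[OF dgN(3) fg[OF va]] ab by simp
    then have "vgen 0 \<in> boundaries (bar c d) (b + 1)"
      using gB quasi_iso_inj[OF dgN(4) vc[of "b + 1"]] ca ab by simp
    then show False
      using bar_vgen_boundary[OF cd, of "b + 1"] bd ca ab by simp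
  qed
  moreover have "d \<noteq> b"
  proof
    assume "d = b"
    then have eq: "bar c d = bar a b" using \<open>c = a\<close> by simp
    have "quasi_iso (bar a b) N f"
      unfolding quasi_iso_def
    proof (intro conjI allI ballI impI)
      show "chain_map (bar a b) N f" by (rule f(1))
      fix i
      show "x \<in> boundaries (bar a b) i" if x: "x \<in> cycles (bar a b) i" "f i x \<in> boundaries N i" for x
        using gB boundary_cong[OF dgN(3) fg[OF x(1)]] x quasi_iso_inj[OF dgN(4)] unfolding eq by blast
      show "\<exists>x\<in>cycles (bar a b) i. y - f i x \<in> boundaries N i" if y: "y \<in> cycles N i" for y
      proof -
        obtain x where x: "x \<in> cycles (bar a b) i" "y - g i x \<in> boundaries N i"
          using quasi_iso_surj[OF dgN(4) y] unfolding eq .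
        have x': "scale (1 / r) x \<in> cycles (bar a b) i"
          by (rule cycle_scale[OF dgM(2) x(1)])
        have "scale r (g i (scale (1 / r) x)) = g i x"
          using chain_map_scale[OF dgN(2,3,5), of x i "1 / r"] cycle_gr[OF dgM(2) x(1)] \<open>r \<noteq> 0\<close> unfolding eq by simp
        then show ?thesis
          using boundary_trans[OF dgN(3) x(2)] boundary_sym[OF dgN(3) fg[OF x']] x' by auto
      qed
    qed
    then have "resolution (bar a b) f N"
      using dgM(1) dgN(3) by (simp add: resolution_def)
    then have "d_iso M N F"
      using d_iso_of_resolutions[OF k] f(2) by blast
    then have "split_mono M N F"
      by (auto simp: d_iso_def split_mono_def)
    then show False
      using F by (simp add: irreducible_mor_def)
  qed
  ultimately show ?thesis
    using \<open>c = a\<close> by simp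
qed

lemma irreducible_bar:
  assumes M: "is_bar M a b" and N: "is_bar N c d" and F: "irreducible_mor M N F"
  shows "(c = a \<and> d < b) \<or> (c = a - 1 \<and> d = b)"
proof -
  obtain k where k: "resolution (bar a b) k M"
    using M by (rule is_barE)
  have "F \<in> dHom M N"
    using F by (simp add: irreducible_mor_def)
  then obtain f where f: "chain_map (bar a b) N f" "F = hclass (bar a b) k M N f"
    using dHomE[OF _ k] N Df_dg by (metis is_bar_def)
  show ?thesis
    using irreducible_bar_divisible[OF M N F k f] irreducible_bar_indivisible[OF M N F k f] by blast
qed

section \<open>Aisles\<close>

lemma acyclic_at_Sus:
  assumes "dg_module M"
  shows "acyclic_at (Sus M) i \<longleftrightarrow> acyclic_at M (i - 1)"
proof -
  have "x \<in> boundaries (Sus M) i \<longleftrightarrow> - x \<in> boundaries M (i - 1)" for x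
    by (auto simp: boundaries_def Sus_def image_iff) (metis minus_minus)
  then have "boundaries (Sus M) i = boundaries M (i - 1)"
    using boundary_neg[OF assms] by (metis minus_minus subsetI subset_antisym)
  moreover have "cycles (Sus M) i = cycles M (i - 1)"
    by (simp add: cycles_def Sus_def)
  ultimately show ?thesis
    by (simp add: acyclic_at_def)
qed

text \<open>\<open>Sus\<close> takes its sign from \<open>degree p\<close>, which may differ from
  \<open>n\<close> if \<open>p\<close> is zero; in that case both sides vanish.\<close>

lemma act_Sus:
  assumes M: "dg_module M" and "p \<in> kT n" "x \<in> gr M (i - 1)"
  shows "act (Sus M) p i x = koszul n (act M p (i - 1) x)"
proof -
  obtain c where p: "p = monom c n"
    using assms(2) by (auto simp: kT_def)
  show ?thesis
    using act_monom[OF M assms(3), of c n]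
    by (cases "c = 0") (simp_all add: p Sus_def degree_monom_eq koszul_def)
qed

lemma dg_module_Sus:
  assumes M: "dg_module M"
  shows "dg_module (Sus M)"
proof -
  have gr: "gr (Sus M) i = gr M (i - 1)" and dif: "dif (Sus M) i x = - dif M (i - 1) x" for i x
    by (simp_all add: Sus_def)
  have kos_in: "koszul n y \<in> gr M i" if "y \<in> gr M i" for n y i
    using that gr_neg[OF M] by (simp add: koszul_def)
  have kos: "koszul n (koszul n y) = y" for n and y :: 'v
    by (simp add: koszul_def)
  show ?thesis
    unfolding dg_module_def gr dif
  proof (intro conjI allI ballI)
    fix i x assume x: "x \<in> gr M (i - 1)"
    show "- dif M (i - 1) x \<in> gr M (i - 1 - 1)"
      using gr_neg[OF M dif_in[OF M x]] .
    show "- dif M (i - 1 - 1) (- dif M (i - 1) x) = 0"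
      unfolding dif_neg[OF M dif_in[OF M x]] dif_dif[OF M x] by simp
    show "act (Sus M) [:c:] i x = scale c x" for c
      using act_Sus[OF M const_in_kT x] by (simp add: koszul_def act_const[OF M x])
    fix n and p :: "'k poly" assume p: "p \<in> kT n"
    note px = act_Sus[OF M p x] and ap = act_in[OF M x p]
    have e: "i - 1 + int n = i + int n - 1" by simp
    show "act (Sus M) p i x \<in> gr M (i + int n - 1)"
      using kos_in[OF ap] by (simp add: px e)
    have "act M p (i - 1 - 1) (dif M (i - 1) x) \<in> gr M (i - 1 - 1 + int n)"
      by (rule act_in[OF M dif_in[OF M x] p])
    have "- dif M (i + int n - 1) (koszul n (act M p (i - 1) x)) = - koszul n (dif M (i + int n - 1) (act M p (i - 1) x))"
      using dif_neg[OF M ap] by (simp add: koszul_def e)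
    also have "\<dots> = - act M p (i - 1 - 1) (dif M (i - 1) x)"
      using dif_act[OF M x p] by (simp add: e kos)
    also have "\<dots> = koszul n (act (Sus M) p (i - 1) (- dif M (i - 1) x))"
      by (simp only: act_Sus[OF M p gr_neg[OF M dif_in[OF M x]]] kos act_neg[OF M dif_in[OF M x] p])
    finally show "- dif M (i + int n - 1) (act (Sus M) p i x) = koszul n (act (Sus M) p (i - 1) (- dif M (i - 1) x))"
      by (simp only: px)
    show "act (Sus M) (p + q) i x = act (Sus M) p i x + act (Sus M) q i x" if q: "q \<in> kT n" for q
    proof -
      have pq: "p + q \<in> kT n"
        using p q by (auto simp: kT_def add_monom)
      have "act M (p + q) (i - 1) x = act M p (i - 1) x + act M q (i - 1) x"
        using M x p q by (simp add: dg_module_def)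
      then show ?thesis
        by (simp add: act_Sus[OF M pq x] px act_Sus[OF M q x] koszul_simps)
    qed
    show "act (Sus M) (q * p) i x = act (Sus M) q (i + int n) (act (Sus M) p i x)" if q: "q \<in> kT m" for q m
    proof -
      have qp: "q * p \<in> kT (m + n)"
        using p q by (auto simp: kT_def mult_monom)
      have kx: "koszul n (act M p (i - 1) x) \<in> gr M (i + int n - 1)"
        using kos_in[OF ap] by (simp add: e)
      have "act M q (i + int n - 1) (koszul n (act M p (i - 1) x)) = koszul n (act M q (i + int n - 1) (act M p (i - 1) x))"
        using act_neg[OF M ap q] by (simp add: koszul_def e)
      then show ?thesis
        using act_Sus[OF M qp x] act_Sus[OF M q kx] act_mult[OF M x p q]
        by (simp add: px e) (simp add: koszul_def)
    qed
  next
    show "subspace (gr M (i - 1))" for i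
      by (rule gr_subspace[OF M])
    show "additive_on (gr M (i - 1)) (\<lambda>x. - dif M (i - 1) x)" for i
      by (simp add: additive_on_def dif_add[OF M])
    show "additive_on (gr M (i - 1)) (act (Sus M) p i)" if "p \<in> kT n" for i n p
      using that by (simp add: additive_on_def act_Sus[OF M that] gr_add[OF M] act_add[OF M] koszul_simps)
  qed
qed

text \<open>A bar of \<open>M\<close> starting in the lowest degree \<open>d\<close> is mapped to
  \<open>N\<close> by sending its generator to a cycle \<open>y\<close> with nonzero class, and all
  other bars go to 0. The only obstruction to this lies in degree \<open>b j0 + 1\<close>, above
  \<open>d\<close>, where \<open>N\<close> has no homology.\<close>

lemma nonzero_dHom:
  assumes M: "M \<in> Df" and N: "N \<in> Df" and Md: "\<not> acyclic_at M d" "\<And>i. i < d \<Longrightarrow> acyclic_at M i"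
    and Nd: "\<not> acyclic_at N d" "\<And>i. d < i \<Longrightarrow> acyclic_at N i"
  shows "dHom M N \<noteq> {dzero M N}"
proof
  assume zero: "dHom M N = {dzero M N}"
  note dgN = Df_dg[OF N]
  obtain J a b k where J: "finite J" "\<forall>j\<in>J. a j \<le> b j" and k: "resolution (barmod J a b) k M"
    using Df_resolution[OF M] by metis
  note K = resolutionD[OF k]
  have acyc: "acyclic_at M i \<longleftrightarrow> (\<forall>j\<in>J. \<not> (a j \<le> i \<and> i \<le> b j))" for i
    using quasi_iso_acyclic[OF K(2,3,4)] barmod_acyclic_at[OF J] by blast
  obtain j0 where j0: "j0 \<in> J" "a j0 \<le> d" "d \<le> b j0"
    using Md(1) acyc by blast
  have "\<not> acyclic_at M (a j0)"
    using acyc j0 J(2) by blast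
  then have a: "a j0 = d"
    using Md(2)[of "a j0"] j0(2) by force
  obtain y where y: "y \<in> cycles N d" "y \<notin> boundaries N d"
    using Nd(1) by (auto simp: acyclic_at_def)
  define r where "r = nat (b j0 + 1 - a j0)"
  have "tpow N r d y \<in> cycles N (b j0 + 1)"
    by (rule tpow_cycle[OF dgN y(1)]) (use j0 a in \<open>simp add: r_def\<close>)
  then have "sg (b j0) (tpow N r d y) \<in> boundaries N (b j0 + 1)"
    using Nd(2)[of "b j0 + 1"] j0(3) boundary_sg[OF dgN] by (auto simp: acyclic_at_def)
  then obtain w0 where w0: "w0 \<in> gr N (b j0 + 2)" "sg (b j0) (tpow N r d y) = dif N (b j0 + 2) w0"
    by (rule boundariesE[OF dgN]) (simp add: add.assoc that)
  define z w where zw: "z = (\<lambda>j. if j = j0 then y else 0)" "w = (\<lambda>j. if j = j0 then w0 else 0)"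
  define f where "f = bar_map J a b N 0 z w"
  have f: "chain_map (barmod J a b) N f"
    unfolding f_def
    by (rule chain_map_bar_map[OF J dgN])
      (use y w0 a in \<open>auto simp: zw cycle_0[OF dgN] gr_0[OF dgN] dif_0[OF dgN] tpow_0[OF dgN] r_def\<close>)
  have fv: "f d (vgen j0) = y"
    unfolding f_def a[symmetric] using bar_map_vgen[OF J dgN j0(1), of z] cycle_gr[OF dgN y(1)] a by (simp add: zw)
  have v: "vgen j0 \<in> cycles (barmod J a b) d"
    using vgen_cycle[OF J j0(1)] a by simp
  have "hclass (barmod J a b) k M N f = dzero M N"
    using hclass_in_dHom[OF k dgN f] zero by blast
  then have "(k d (vgen j0), y) \<in> hgraph M N (dmap M N (\<lambda>i x. 0)) d"
    using hgraph_hclass[OF k dgN f v] fv by (simp add: dzero_def)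
  then show False
    using hgraph_dmap[OF K(3) dgN chain_map_zero[OF dgN]] y(2) by simp
qed

lemma finite_not_acyclic:
  assumes "M \<in> Df"
  shows "finite {i. \<not> acyclic_at M i}"
proof (rule finite_subset)
  show "{i. \<not> acyclic_at M i} \<subseteq> {i. cycles M i \<noteq> boundaries M i}"
    by (auto simp: acyclic_at_def)
  show "finite {i. cycles M i \<noteq> boundaries M i}"
    using assms by (simp add: Df_def finite_homology_def)
qed

lemma torsion_theory_Df:
  assumes "torsion_theory U V"
  shows "U \<subseteq> Df" "V \<subseteq> Df"
  using assms by (auto simp: torsion_theory_def subcategory_def)

text \<open>
  Otherwise some suspension of \<open>M\<close> has its lowest homology in the degree of the highest homology of \<open>N\<close>,
  and any linear map between these two spaces comes from a morphism.
\<close>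

lemma aisle_above_coaisle:
  assumes t: "t_structure U V" and M: "M \<in> U" "\<not> acyclic_at M i" and N: "N \<in> V" "\<not> acyclic_at N l"
  shows "l < i"
proof -
  have tt: "torsion_theory U V" and S: "\<And>M. M \<in> U \<Longrightarrow> Sus M \<in> U"
    using t by (auto simp: t_structure_def)
  note UV = torsion_theory_Df[OF tt]
  have SM: "(Sus ^^ n) M \<in> U" for n
    by (induction n) (use M S in auto)
  have acyc: "acyclic_at ((Sus ^^ n) M) j \<longleftrightarrow> acyclic_at M (j - int n)" for n j
  proof (induction n arbitrary: j)
    case (Suc n)
    have "dg_module ((Sus ^^ n) M)"
      using SM UV(1) Df_dg by blast
    then show ?case
      using acyclic_at_Sus Suc by (simp add: algebra_simps)
  qed simp
  have finM: "finite {i. \<not> acyclic_at M i}" and finN: "finite {i. \<not> acyclic_at N i}"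
    using finite_not_acyclic UV M N by blast+
  define a where "a = Min {i. \<not> acyclic_at M i}"
  have a: "\<not> acyclic_at M a" "\<And>j. j < a \<Longrightarrow> acyclic_at M j" "a \<le> i"
    using Min_in[OF finM] Min_le[OF finM] M(2) unfolding a_def by (auto simp: not_less[symmetric])
  define d where "d = Max {i. \<not> acyclic_at N i}"
  have d: "\<not> acyclic_at N d" "\<And>j. d < j \<Longrightarrow> acyclic_at N j" "l \<le> d"
    using Max_in[OF finN] Max_ge[OF finN] N(2) unfolding d_def by (auto simp: not_less[symmetric])
  have "d < a"
  proof (rule ccontr)
    assume "\<not> d < a"
    define M' where "M' = (Sus ^^ nat (d - a)) M"
    have M': "acyclic_at M' j \<longleftrightarrow> acyclic_at M (j - (d - a))" for j
      using acyc[of "nat (d - a)" j] \<open>\<not> d < a\<close> by (simp add: M'_def)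
    have "dHom M' N = {dzero M' N}"
      using tt SM N(1) unfolding torsion_theory_def M'_def by blast
    moreover have "dHom M' N \<noteq> {dzero M' N}"
      by (rule nonzero_dHom[of M' N d]) (use M' a d SM UV N in \<open>auto simp: M'_def\<close>)
    ultimately show False by blast
  qed
  then show ?thesis
    using a d by linarith
qed

section \<open>Homology of cones and distinguished triangles\<close>

text \<open>A resolution lifts to the apex of a roof of quasi-isomorphisms and continues to its
  other foot.\<close>

lemma resolution_transfer:
  assumes res: "resolution K k M" and A: "dg_module A" and P: "dg_module P" "quasi_iso P M s" "quasi_iso P A f"
  obtains k' where "resolution K k' A"
proof -
  note K = resolutionD[OF res]
  obtain l where l: "chain_map K P l" "homotopic K M (s \<odot> l) k"
    using kproj_lift[OF K(1) P(1) K(3) P(2) K(5)] .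
  have "quasi_iso K P l"
    by (rule quasi_iso_cancel[OF K(2) P(1) K(3) l(1) P(2) K(4) l(2)])
  then have "quasi_iso K A (f \<odot> l)"
    using quasi_iso_comp[OF K(2) P(1) A] P(3) by blast
  then show thesis
    using that K(1) A by (simp add: resolution_def)
qed

lemma distinguishedE:
  assumes "distinguished M D N F G H" "dg_module M" "dg_module D" "dg_module N"
  obtains A B C f \<phi> where "dg_module A" "dg_module B" "dg_module C" "chain_map A B f" "dg_iso C (cone A B f) \<phi>"
    "isomorphic M A" "isomorphic D B" "isomorphic N C"
  using assms unfolding distinguished_def isomorphic_def by blast

context
  fixes A B C :: "('k, 'v) dgmod" and f :: "('v, 'v) gmap" and \<phi> :: "('v, 'v \<times> 'v) gmap"
  assumes A: "dg_module A" and B: "dg_module B" and C: "dg_module C" and f: "chain_map A B f"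
    and \<phi>: "dg_iso C (cone A B f) \<phi>"
begin

lemma cone_inverse:
  assumes "y \<in> gr B i" "x \<in> gr A (i - 1)"
  obtains c where "c \<in> gr C i" "\<phi> i c = (y, x)"
proof -
  have "bij_betw (\<phi> i) (gr C i) (gr B i \<times> gr A (i - 1))"
    using \<phi> by (simp add: dg_iso_def cone_def)
  then have "(y, x) \<in> \<phi> i ` gr C i"
    using assms by (simp add: bij_betw_imp_surj_on)
  then show thesis
    using that by auto
qed

lemma cone_inj: "c \<in> gr C i \<Longrightarrow> c' \<in> gr C i \<Longrightarrow> \<phi> i c = \<phi> i c' \<Longrightarrow> c = c'"
  using \<phi> by (auto simp: dg_iso_def bij_betw_def inj_on_def)

lemma cone_components:
  assumes "c \<in> gr C i" "\<phi> i c = (y, x)"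
  shows "y \<in> gr B i" "x \<in> gr A (i - 1)" "\<phi> (i - 1) (dif C i c) = (dif B i y + f (i - 1) x, - dif A (i - 1) x)"
proof -
  have c: "chain_map C (cone A B f) \<phi>"
    using \<phi> by (simp add: dg_iso_def)
  have "\<phi> i c \<in> gr (cone A B f) i" "\<phi> (i - 1) (dif C i c) = dif (cone A B f) i (\<phi> i c)"
    using c assms(1) unfolding chain_map_def by blast+
  then show "y \<in> gr B i" "x \<in> gr A (i - 1)" "\<phi> (i - 1) (dif C i c) = (dif B i y + f (i - 1) x, - dif A (i - 1) x)"
    using assms(2) by (simp_all add: cone_def)
qed

lemma cone_0: "\<phi> i 0 = (0, 0)"
proof -
  have "additive_on (gr C i) (\<phi> i)"
    using \<phi> by (simp add: dg_iso_def chain_map_def)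
  then have "\<phi> i (0 + 0) = \<phi> i 0 + \<phi> i 0"
    using gr_0[OF C] unfolding additive_on_def by blast
  then show ?thesis by (simp add: zero_prod_def)
qed

text \<open>Exactness of the homology sequence at the cone, carried out on elements through
  \<open>\<phi>\<close>: first the component in \<open>A\<close> is bounded, then what is left is a
  cycle of \<open>B\<close>.\<close>

lemma cone_acyclic:
  assumes BA: "acyclic_at B i" "acyclic_at A (i - 1)"
  shows "acyclic_at C i"
  unfolding acyclic_at_def
proof
  fix c assume c: "c \<in> cycles C i"
  note cg = cycle_gr[OF C c] and cd = cycle_dif[OF C c]
  obtain y x where yx: "\<phi> i c = (y, x)" by fastforce
  note comp = cone_components[OF cg yx]
  have "(dif B i y + f (i - 1) x, - dif A (i - 1) x) = (0, 0)"
    using comp(3) cd cone_0 by metis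
  then have dy: "dif B i y + f (i - 1) x = 0" and "dif A (i - 1) x = 0"
    by simp_all
  then have "x \<in> cycles A (i - 1)"
    using comp(2) by (simp add: cycles_def)
  then have "x \<in> boundaries A (i - 1)"
    using BA(2) by (auto simp: acyclic_at_def)
  then obtain x' where x': "x' \<in> gr A i" "x = dif A i x'"
    by (rule boundariesE[OF A]) simp
  have "y + f i x' \<in> cycles B i"
    using comp(1) chain_map_in[OF f x'(1)] dy chain_map_dif[OF f x'(1)] x'(2)
    by (simp add: cycles_def gr_add[OF B] dif_add[OF B])
  then have "y + f i x' \<in> boundaries B i"
    using BA(1) by (auto simp: acyclic_at_def)
  then obtain y' where y': "y' \<in> gr B (i + 1)" "y + f i x' = dif B (i + 1) y'"
    by (rule boundariesE[OF B])
  \<comment> \<open>The sign compensates for the sign of the differential on the suspended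
    summand.\<close>
  have "- x' \<in> gr A (i + 1 - 1)"
    using gr_neg[OF A x'(1)] by simp
  then obtain c' where c': "c' \<in> gr C (i + 1)" "\<phi> (i + 1) c' = (y', - x')"
    using cone_inverse[OF y'(1)] by blast
  have "\<phi> i (dif C (i + 1) c') = (dif B (i + 1) y' + f i (- x'), - dif A i (- x'))"
    using cone_components(3)[OF c'] by simp
  also have "\<dots> = \<phi> i c"
    by (simp add: yx y'(2)[symmetric] x' chain_map_neg[OF A f] dif_neg[OF A])
  finally have "c = dif C (i + 1) c'"
    using cone_inj[OF cg dif_in'[OF C c'(1)]] by simp
  then show "c \<in> boundaries C i"
    using boundariesI[OF C c'(1)] by blast
qed

text \<open>Every cycle of the cone bounds (\<open>solve\<close>). For injectivity this is applied
  to a chain bounding \<open>f i x\<close> together with \<open>- x\<close>, for surjectivity to a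
  cycle of \<open>B\<close> together with 0.\<close>

lemma quasi_iso_of_acyclic_cone:
  assumes acyc: "\<And>i. acyclic_at C i"
  shows "quasi_iso A B f"
proof -
  have solve: "\<exists>y' x'. y' \<in> gr B (i + 1) \<and> x' \<in> gr A i \<and> y = dif B (i + 1) y' + f i x' \<and> x = - dif A i x'"
    if yx: "y \<in> gr B i" "x \<in> gr A (i - 1)" "dif B i y + f (i - 1) x = 0" "dif A (i - 1) x = 0" for i y x
  proof -
    obtain c where c: "c \<in> gr C i" "\<phi> i c = (y, x)"
      using cone_inverse[OF yx(1,2)] .
    have "\<phi> (i - 1) (dif C i c) = \<phi> (i - 1) 0"
      using cone_components(3)[OF c] yx(3,4) by (simp add: cone_0)
    then have "dif C i c = 0"
      using cone_inj[OF dif_in[OF C c(1)] gr_0[OF C]] by blast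
    then have "c \<in> boundaries C i"
      using c(1) acyc[of i] by (auto simp: acyclic_at_def cycles_def)
    then obtain c' where c': "c' \<in> gr C (i + 1)" "c = dif C (i + 1) c'"
      by (rule boundariesE[OF C])
    obtain y' x' where yx': "\<phi> (i + 1) c' = (y', x')" by fastforce
    show ?thesis
      using cone_components[OF c'(1) yx'] c(2) c'(2) by (intro exI[of _ y'] exI[of _ x']) simp
  qed
  show ?thesis
    unfolding quasi_iso_def
  proof (intro conjI allI ballI impI)
    show "chain_map A B f" by (rule f)
    fix i
    show "x \<in> boundaries A i" if x: "x \<in> cycles A i" "f i x \<in> boundaries B i" for x
    proof -
      obtain y where y: "y \<in> gr B (i + 1)" "f i x = dif B (i + 1) y"
        using x(2) by (rule boundariesE[OF B])
      note xg = cycle_gr[OF A x(1)]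
      have "\<exists>y' x'. y' \<in> gr B (i + 1 + 1) \<and> x' \<in> gr A (i + 1) \<and> y = dif B (i + 1 + 1) y' + f (i + 1) x' \<and> - x = - dif A (i + 1) x'"
        by (rule solve) (use y xg cycle_dif[OF A x(1)] in \<open>simp_all add: gr_neg[OF A] chain_map_neg[OF A f] dif_neg[OF A]\<close>)
      then show ?thesis
        using boundariesI[OF A] by auto
    qed
    show "\<exists>x\<in>cycles A i. w - f i x \<in> boundaries B i" if w: "w \<in> cycles B i" for w
    proof -
      have "\<exists>y' x'. y' \<in> gr B (i + 1) \<and> x' \<in> gr A i \<and> w = dif B (i + 1) y' + f i x' \<and> 0 = - dif A i x'"
        by (rule solve) (use cycle_gr[OF B w] cycle_dif[OF B w] in \<open>simp_all add: gr_0[OF A] chain_map_0[OF A f] dif_0[OF A]\<close>)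
      then obtain y' x' where "y' \<in> gr B (i + 1)" "x' \<in> gr A i" "w = dif B (i + 1) y' + f i x'" "dif A i x' = 0"
        by auto
      then show ?thesis
        using boundariesI[OF B] by (intro bexI[of _ x']) (auto simp: cycles_def)
    qed
  qed
qed

end

lemma distinguished_acyclic:
  assumes "distinguished M D N F G H" "dg_module M" "dg_module D" "dg_module N"
    "acyclic_at D i" "acyclic_at M (i - 1)"
  shows "acyclic_at N i"
proof -
  obtain A B C f \<phi> where *: "dg_module A" "dg_module B" "dg_module C" "chain_map A B f" "dg_iso C (cone A B f) \<phi>"
    "isomorphic M A" "isomorphic D B" "isomorphic N C"
    using distinguishedE[OF assms(1-4)] by blast
  show ?thesis
    using cone_acyclic[OF *(1-5), of i] assms isomorphic_acyclic * by blast
qed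

text \<open>A triangle with acyclic third term is modelled by a cone whose map is a
  quasi-isomorphism. One resolution of \<open>M\<close> is then transported to \<open>B\<close> and
  on to \<open>D\<close>.\<close>

lemma distinguished_isomorphic:
  assumes t: "distinguished M D N F G H" and MDN: "M \<in> Df" "D \<in> Df" "dg_module N" and acyc: "\<And>i. acyclic_at N i"
  shows "isomorphic M D"
proof -
  note dg = Df_dg[OF MDN(1)] Df_dg[OF MDN(2)]
  obtain A B C f \<phi> where *: "dg_module A" "dg_module B" "dg_module C" "chain_map A B f" "dg_iso C (cone A B f) \<phi>"
    and iso: "isomorphic M A" "isomorphic D B" "isomorphic N C"
    using distinguishedE[OF t dg MDN(3)] by blast
  have f: "quasi_iso A B f"
    using quasi_iso_of_acyclic_cone[OF *] isomorphic_acyclic[OF MDN(3) *(3) iso(3)] acyc by blast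
  obtain K k where k: "resolution K k M"
    using Df_resolution[OF MDN(1)] by metis
  obtain \<alpha> \<beta> where \<alpha>: "d_iso M A \<alpha>" and \<beta>: "d_iso D B \<beta>"
    using iso unfolding isomorphic_def by blast
  obtain P s g where P: "dg_module P" "quasi_iso P M s" "quasi_iso P A g"
    using d_iso_roof[OF dg(1) *(1) \<alpha>] .
  obtain P' s' g' where P': "dg_module P'" "quasi_iso P' D s'" "quasi_iso P' B g'"
    using d_iso_roof[OF dg(2) *(2) \<beta>] .
  have "quasi_iso P B (f \<odot> g)"
    by (rule quasi_iso_comp[OF P(1) *(1,2) P(3) f])
  then obtain k1 where "resolution K k1 B"
    using resolution_transfer[OF k *(2) P(1,2)] by blast
  then obtain k2 where "resolution K k2 D"
    using resolution_transfer[OF _ dg(2) P'(1,3,2)] by blast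
  then show ?thesis
    using d_iso_of_resolutions[OF k] unfolding isomorphic_def by blast
qed

text \<open>\<open>s\<close> is the lowest degree in which some object of \<open>U\<close> has
  homology. If \<open>D\<close> is acyclic below \<open>s\<close>, the third term of its triangle is
  acyclic below \<open>s\<close> by the long exact sequence, and from \<open>s\<close> on because
  homology of \<open>V\<close> lies below that of \<open>U\<close>. Hence it vanishes and
  \<open>D\<close> is isomorphic to the term in \<open>U\<close>.\<close>

lemma t_structure_standard:
  assumes t: "t_structure U V" and nz: "\<exists>M\<in>U. \<not> zero_object M" and proper: "U \<noteq> Df"
  obtains s where "\<And>D. D \<in> Df \<Longrightarrow> D \<in> U \<longleftrightarrow> (\<forall>i<s. acyclic_at D i)"
proof -
  have tt: "torsion_theory U V"
    using t by (simp add: t_structure_def)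
  note UV = torsion_theory_Df[OF tt]
  have "\<forall>M\<in>U. \<forall>N\<in>Df. isomorphic M N \<longrightarrow> N \<in> U"
    using tt unfolding torsion_theory_def subcategory_def by (elim conjE) assumption
  then have closed: "N \<in> U" if "M \<in> U" "N \<in> Df" "isomorphic M N" for M N
    using that by blast
  have "\<forall>D\<in>Df. \<exists>M\<in>U. \<exists>N\<in>V. \<exists>F G H. distinguished M D N F G H"
    using tt unfolding torsion_theory_def by (elim conjE) assumption
  then have tri: "\<exists>M\<in>U. \<exists>N\<in>V. \<exists>F G H. distinguished M D N F G H" if "D \<in> Df" for D
    using that by blast
  have in_U: "D \<in> U" if "distinguished M D N F G H" "M \<in> U" "N \<in> V" "D \<in> Df" "\<And>i. acyclic_at N i" for M D N F G H
    using distinguished_isomorphic[OF that(1)] closed that UV Df_dg by blast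
  \<comment> \<open>If all objects of \<open>V\<close> were acyclic, every triangle would put its
    middle term in \<open>U\<close>. A nonzero object of \<open>V\<close> bounds the homology of
    \<open>U\<close> from below, so that \<open>s\<close> exists.\<close>
  obtain N0 l where N0: "N0 \<in> V" "\<not> acyclic_at N0 l"
  proof (rule ccontr)
    assume "\<not> thesis"
    then have "\<forall>N\<in>V. \<forall>i. acyclic_at N i"
      using that by blast
    then have "Df \<subseteq> U"
      using tri in_U by blast
    then show False
      using UV proper by blast
  qed
  obtain M0 i0 where M0: "M0 \<in> U" "\<not> acyclic_at M0 i0"
    using nz zero_object_iff Df_dg UV by blast
  define S where "S = {i. \<exists>M\<in>U. \<not> acyclic_at M i}"
  have Sl: "l < i" if "i \<in> S" for i
    using that aisle_above_coaisle[OF t _ _ N0] by (auto simp: S_def)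
  have "i0 \<in> S"
    using M0 by (auto simp: S_def)
  then obtain s where s: "s \<in> S" "\<And>i. i \<in> S \<Longrightarrow> nat (s - l) \<le> nat (i - l)"
    using ex_has_least_nat[of "\<lambda>i. i \<in> S" i0 "\<lambda>i. nat (i - l)"] by blast
  have s_le: "s \<le> i" if "i \<in> S" for i
    using s(2)[OF that] Sl[OF that] Sl[OF s(1)] by linarith
  have U_acyc: "acyclic_at M i" if "M \<in> U" "i < s" for M i
    using s_le[of i] that by (auto simp: S_def)
  show thesis
  proof (rule that)
    fix D assume D: "D \<in> Df"
    show "D \<in> U \<longleftrightarrow> (\<forall>i<s. acyclic_at D i)"
    proof
      assume a: "\<forall>i<s. acyclic_at D i"
      obtain M N F G H where MN: "M \<in> U" "N \<in> V" "distinguished M D N F G H"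
        using tri[OF D] by blast
      note dg = Df_dg[OF subsetD[OF UV(1) MN(1)]] Df_dg[OF D] Df_dg[OF subsetD[OF UV(2) MN(2)]]
      have "acyclic_at N i" for i
      proof (cases "i < s")
        case True
        then show ?thesis
          using distinguished_acyclic[OF MN(3) dg, of i] a U_acyc[OF MN(1), of "i - 1"] by simp
      next
        case False
        then show ?thesis
          using s(1) aisle_above_coaisle[OF t _ _ MN(2), of _ s i] by (auto simp: S_def)
      qed
      then show "D \<in> U"
        using in_U MN D by blast
    qed (use U_acyc in blast)
  qed
qed

section \<open>Coordinates\<close>

lemma is_bar_shift:
  assumes "is_bar M a b" "is_bar N c d" "\<And>i. acyclic_at N i \<longleftrightarrow> acyclic_at M (i - s)"
  shows "c = a + s \<and> d = b + s"
proof -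
  have "a \<le> b" "c \<le> d"
    using assms by (auto simp: is_bar_def)
  have *: "c \<le> i \<and> i \<le> d \<longleftrightarrow> a + s \<le> i \<and> i \<le> b + s" for i
    using assms(3)[of i] is_bar_acyclic[OF assms(1), of "i - s"] is_bar_acyclic[OF assms(2), of i] by auto
  show ?thesis
    using *[of c] *[of d] *[of "a + s"] *[of "b + s"] \<open>a \<le> b\<close> \<open>c \<le> d\<close> by auto
qed

end

lemma shift_equivariant:
  fixes f :: "int \<Rightarrow> int \<Rightarrow> int"
  assumes "\<And>m n. n - m \<ge> 2 \<Longrightarrow> f (m - 1) (n - 1) = f m n + 1" "n - m \<ge> 2"
  shows "f m n = f 0 (n - m) - m"
proof -
  have *: "f (m - int k) (n - int k) = f m n + int k" if "n - m \<ge> 2" for m n k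
  proof (induction k)
    case (Suc k)
    then show ?case
      using assms(1)[of "n - int k" "m - int k"] that by (simp add: algebra_simps)
  qed simp
  show ?thesis
  proof (cases "m \<ge> 0")
    case True
    then show ?thesis using *[OF assms(2), of "nat m"] by simp
  next
    case False
    then show ?thesis using *[of "n - m" 0 "nat (- m)"] assms(2) by simp
  qed
qed

text \<open>
  The arrows into and out of a vertex compose to the inverse suspension, so each of them changes exactly one
  of the endpoints, by one. Going up a ray, the length of the bar must then always increase: it is
  injective along the ray and nonnegative.
\<close>

lemma bar_coordinates:
  fixes f g :: "int \<Rightarrow> int \<Rightarrow> int"
  assumes le: "\<And>m n. n - m \<ge> 2 \<Longrightarrow> f m n \<le> g m n"
    and shift: "\<And>m n. n - m \<ge> 2 \<Longrightarrow> f (m - 1) (n - 1) = f m n + 1 \<and> g (m - 1) (n - 1) = g m n + 1"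
    and inj: "\<And>m n m' n'. n - m \<ge> 2 \<Longrightarrow> n' - m' \<ge> 2 \<Longrightarrow> f m n = f m' n' \<Longrightarrow> g m n = g m' n' \<Longrightarrow> m = m' \<and> n = n'"
    and up: "\<And>m n. n - m \<ge> 2 \<Longrightarrow> (f m (n + 1) = f m n \<and> g m (n + 1) < g m n) \<or> (f m (n + 1) = f m n - 1 \<and> g m (n + 1) = g m n)"
    and down: "\<And>m n. n - m \<ge> 3 \<Longrightarrow> (f (m + 1) n = f m n \<and> g (m + 1) n < g m n) \<or> (f (m + 1) n = f m n - 1 \<and> g (m + 1) n = g m n)"
  obtains c where "\<And>m n. n - m \<ge> 2 \<Longrightarrow> f m n = c - n"
proof -
  \<comment> \<open>By equivariance everything is determined on the ray \<open>m = 0\<close>;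
    \<open>p j\<close> and \<open>q j\<close> are the ends of the bar at the vertex
    \<open>(0, j)\<close>.\<close>
  define p q where pq: "p = f 0" "q = g 0"
  have f: "f m n = p (n - m) - m" and g: "g m n = q (n - m) - m" if "n - m \<ge> 2" for m n
    using shift_equivariant[of f, OF _ that] shift_equivariant[of g, OF _ that] shift by (simp_all add: pq)
  \<comment> \<open>The vertex \<open>(1, j + 1)\<close> is \<open>(0, j)\<close> shifted by one, so
    \<open>down\<close> at \<open>(0, j + 1)\<close> is again a statement about \<open>p\<close> and
    \<open>q\<close> at \<open>j\<close> and \<open>j + 1\<close>. Together with \<open>up\<close>
    it excludes drops of \<open>q\<close> by more than one.\<close>
  have step: "(p (j + 1) = p j \<and> q (j + 1) = q j - 1) \<or> (p (j + 1) = p j - 1 \<and> q (j + 1) = q j)" if j: "j \<ge> 2" for j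
  proof -
    have "(p j - 1 = p (j + 1) \<and> q j - 1 < q (j + 1)) \<or> (p j - 1 = p (j + 1) - 1 \<and> q j - 1 = q (j + 1))"
      using down[of "j + 1" 0] f[of "j + 1" 1] g[of "j + 1" 1] j by (simp add: pq)
    moreover have "(p (j + 1) = p j \<and> q (j + 1) < q j) \<or> (p (j + 1) = p j - 1 \<and> q (j + 1) = q j)"
      using up[of j 0] j by (simp add: pq)
    ultimately show ?thesis by linarith
  qed
  \<comment> \<open>Bars of equal length are suspensions of each other. Moving the vertex for
    \<open>j'\<close> along its diagonal by \<open>m\<close> makes both ends agree with those for
    \<open>j\<close>, so injectivity of the labelling applies.\<close>
  have inj': "j = j'" if "j \<ge> 2" "j' \<ge> 2" "q j - p j = q j' - p j'" for j j'
  proof -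
    define m where "m = p j' - p j"
    have "0 = m \<and> j = m + j'"
      by (rule inj) (use that f[of "m + j'" m] g[of "m + j'" m] in \<open>auto simp: pq m_def\<close>)
    then show ?thesis by simp
  qed
  have len: "q j - p j \<ge> 0" if "j \<ge> 2" for j
    using le[of j 0] that by (simp add: pq)
  \<comment> \<open>If the length dropped once, rising at the next step would repeat an earlier
    value, contrary to \<open>inj'\<close>. So it would drop forever and become negative.\<close>
  have inc: "p (j + 1) = p j - 1" if j: "j \<ge> 2" for j
  proof (rule ccontr)
    assume "p (j + 1) \<noteq> p j - 1"
    then have start: "q (j + 1) - p (j + 1) = q j - p j - 1"
      using step[OF j] by linarith
    have dec: "q (j + int k + 1) - p (j + int k + 1) = q (j + int k) - p (j + int k) - 1" for k
    proof (induction k)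
      case (Suc k)
      have "q (j + int k + 1 + 1) - p (j + int k + 1 + 1) \<noteq> q (j + int k) - p (j + int k)"
        using inj'[of "j + int k + 1 + 1" "j + int k"] j by linarith
      then have "q (j + int k + 1 + 1) - p (j + int k + 1 + 1) = q (j + int k + 1) - p (j + int k + 1) - 1"
        using step[of "j + int k + 1"] Suc j by linarith
      then show ?case by (simp add: algebra_simps)
    qed (use start in simp)
    have "q (j + int k) - p (j + int k) = q j - p j - int k" for k
    proof (induction k)
      case (Suc k)
      then show ?case using dec[of k] by (simp add: algebra_simps)
    qed simp
    from this[of "nat (q j - p j) + 1"] show False
      using len[of "j + int (nat (q j - p j) + 1)"] j by linarith
  qed
  have p: "p (2 + int k) = p 2 - int k" for k
  proof (induction k)
    case (Suc k)
    then show ?case using inc[of "2 + int k"] by (simp add: algebra_simps)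
  qed simp
  show thesis
  \<comment> \<open>At \<open>(m, n)\<close> the lower end is \<open>p (n - m) - m\<close>, and
    \<open>p (n - m)\<close> is \<open>p 2 - (n - m - 2)\<close>, so that \<open>m\<close>
    cancels.\<close>
  proof (rule that[of "p 2 + 2"])
    fix m n :: int assume "n - m \<ge> 2"
    then show "f m n = p 2 + 2 - n"
      using f[of n m] p[of "nat (n - m - 2)"] by simp
  qed
qed

context dg_universe
begin

lemma ar_labelling_bars:
  assumes X: "ar_labelling X"
  obtains c g where "\<And>m n. n - m \<ge> 2 \<Longrightarrow> is_bar (X m n) (c - n) (g m n)"
proof -
  have ind: "\<And>m n. n - m \<ge> 2 \<Longrightarrow> indecomposable (X m n)"
    and inj: "\<And>m n m' n'. n - m \<ge> 2 \<Longrightarrow> n' - m' \<ge> 2 \<Longrightarrow> isomorphic (X m n) (X m' n') \<Longrightarrow> m = m' \<and> n = n'"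
    and irr: "\<And>m n m' n'. n - m \<ge> 2 \<Longrightarrow> n' - m' \<ge> 2 \<Longrightarrow> (m' = m \<and> n' = n + 1) \<or> (n - m \<ge> 3 \<and> m' = m + 1 \<and> n' = n)
      \<Longrightarrow> \<exists>F. irreducible_mor (X m n) (X m' n') F"
    and sus: "\<And>m n. n - m \<ge> 2 \<Longrightarrow> isomorphic (Sus (X m n)) (X (m - 1) (n - 1))"
    using X unfolding ar_labelling_def by auto
  have "\<forall>m n. \<exists>a b. n - m \<ge> 2 \<longrightarrow> is_bar (X m n) a b"
    using indecomposable_is_bar[OF ind] by blast
  then obtain f g where "\<forall>m n. n - m \<ge> 2 \<longrightarrow> is_bar (X m n) (f m n) (g m n)"
    by metis
  then have fg: "\<And>m n. n - m \<ge> 2 \<Longrightarrow> is_bar (X m n) (f m n) (g m n)"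
    by blast
  obtain c where "\<And>m n. n - m \<ge> 2 \<Longrightarrow> f m n = c - n"
  proof (rule bar_coordinates[of f g])
    fix m n :: int assume mn: "n - m \<ge> 2"
    show "f m n \<le> g m n"
      using fg[OF mn] by (simp add: is_bar_def)
    have "(n - 1) - (m - 1) \<ge> 2"
      using mn by simp
    note fg' = fg[OF this]
    have dg: "dg_module (X m n)" "dg_module (X (m - 1) (n - 1))" "dg_module (Sus (X m n))"
      using fg[OF mn] fg' dg_module_Sus by (auto simp: is_bar_def Df_dg)
    show "f (m - 1) (n - 1) = f m n + 1 \<and> g (m - 1) (n - 1) = g m n + 1"
      by (rule is_bar_shift[OF fg[OF mn] fg'])
        (use isomorphic_acyclic[OF dg(3,2) sus[OF mn]] acyclic_at_Sus[OF dg(1)] in blast)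
    show "f m (n + 1) = f m n \<and> g m (n + 1) < g m n \<or> f m (n + 1) = f m n - 1 \<and> g m (n + 1) = g m n"
      using irreducible_bar[OF fg[OF mn] fg[of "n + 1" m]] irr[OF mn, of "n + 1" m] mn by auto
    show "m = m' \<and> n = n'" if "n' - m' \<ge> 2" "f m n = f m' n'" "g m n = g m' n'" for m' n'
      using isomorphic_of_is_bar[OF fg[OF mn]] fg[OF that(1)] inj[OF mn that(1)] that by metis
  next
    fix m n :: int assume mn: "n - m \<ge> 3"
    show "f (m + 1) n = f m n \<and> g (m + 1) n < g m n \<or> f (m + 1) n = f m n - 1 \<and> g (m + 1) n = g m n"
      using irreducible_bar[OF fg[of n m] fg[of n "m + 1"]] irr[of n m n "m + 1"] mn by auto
  qed blast
  then show thesis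
    using that fg by metis
qed

lemma t_structure_half_line:
  assumes X: "ar_labelling X" and t: "t_structure U V" and nz: "\<exists>M\<in>U. \<not> zero_object M" and proper: "U \<noteq> Df"
  shows "\<exists>n. \<forall>M. indecomposable M \<longrightarrow>
    (M \<in> U \<longleftrightarrow> (\<exists>(x, y)\<in>{(x, y). y \<le> n \<and> y - x \<ge> 2}. isomorphic M (X x y)))"
proof -
  obtain s where s: "\<And>D. D \<in> Df \<Longrightarrow> D \<in> U \<longleftrightarrow> (\<forall>i<s. acyclic_at D i)"
    using t_structure_standard[OF t nz proper] by blast
  obtain c g where bars: "\<And>m n. n - m \<ge> 2 \<Longrightarrow> is_bar (X m n) (c - n) (g m n)"
    using ar_labelling_bars[OF X] by blast
  \<comment> \<open>The lowest homology of the object at \<open>(m, n)\<close> is in degree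
    \<open>c - n\<close>, and membership in \<open>U\<close> requires this to be at least
    \<open>s\<close>; hence the bound \<open>c - s\<close> on the second coordinate.\<close>
  have in_U: "M \<in> U \<longleftrightarrow> n \<le> c - s" if M: "M \<in> Df" "isomorphic M (X m n)" and mn: "n - m \<ge> 2" for M m n
  proof -
    have acyc: "acyclic_at M i \<longleftrightarrow> \<not> (c - n \<le> i \<and> i \<le> g m n)" for i
      using isomorphic_acyclic[OF Df_dg[OF M(1)] _ M(2)] is_bar_acyclic[OF bars[OF mn]] bars[OF mn]
      by (auto simp: is_bar_def Df_dg)
    have "c - n \<le> g m n"
      using bars[OF mn] by (simp add: is_bar_def)
    then have "(\<forall>i<s. acyclic_at M i) \<longleftrightarrow> s \<le> c - n"
      unfolding acyc by (meson leD leI le_less_trans order_refl)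
    also have "\<dots> \<longleftrightarrow> n \<le> c - s"
      by linarith
    finally show ?thesis
      unfolding s[OF M(1)] .
  qed
  have "M \<in> U \<longleftrightarrow> (\<exists>(x, y)\<in>{(x, y). y \<le> c - s \<and> y - x \<ge> 2}. isomorphic M (X x y))" if M: "indecomposable M" for M
  proof -
    have "M \<in> Df"
      using M by (simp add: indecomposable_def)
    moreover have "\<exists>m n. n - m \<ge> 2 \<and> isomorphic M (X m n)"
      using X M unfolding ar_labelling_def by blast
    ultimately show ?thesis
      using in_U by blast
  qed
  then show ?thesis by blast
qed

end

theorem theorem4p1:
  fixes scale :: "'k::field \<Rightarrow> 'v::ab_group_add \<Rightarrow> 'v"
    and X :: "int \<Rightarrow> int \<Rightarrow> ('k, 'v) dgmod"
    and U V :: "('k, 'v) dgmod set"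
  assumes "dg_universe scale"
    and "dg_universe.ar_labelling scale X"
    and "dg_universe.t_structure scale U V"
    and "\<exists>M\<in>U. \<not> dg_universe.zero_object scale M"
    and "U \<noteq> dg_universe.Df scale"
  shows "\<exists>n. \<forall>M. dg_universe.indecomposable scale M \<longrightarrow>
           (M \<in> U \<longleftrightarrow>
             (\<exists>(x, y)\<in>{(x, y). y \<le> n \<and> y - x \<ge> 2}. dg_universe.isomorphic scale M (X x y)))"
  by (rule dg_universe.t_structure_half_line[OF assms])

end
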